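(* For every $r>0$, $$\Pi_h^{\mathrm{par}}(r)=\frac{4\pi^2}{\Gamma(1/3)^3}\int_r^{\infty}\eta\!\left(\tfrac{i}{\sqrt3}\,t\right)^{2}\eta\!\left(i\sqrt3\,t\right)^{2}\,dt.$$
   Context: For $r>0$, $P_r\subset\mathbb C$ is the closed parallelogram with vertices $0,\ r,\ r+e^{i\pi/3},\ e^{i\pi/3}$ in cyclic order. $\Delta\subset\mathbb C$ is the closed equilateral triangle with vertices $0,1,e^{i\pi/3}$. Cardy--Smirnov function of $P_r$ (defined purely conformally, as a Carleson length). Let $g:P_r\to\Delta$ be the unique homeomorphism that is conformal (biholomorphic) between the interiors and satisfies $g(0)=0$, $g(r+e^{i\pi/3})=1$, $g(e^{i\pi/3})=e^{i\pi/3}$. Then $g(r)\in(0,1)$, and $\Pi_h^{\mathrm{par}}(r):=1-g(r)$, the Euclidean length of the segment $[g(r),1]$. $\eta(\tau)=q^{1/24}\prod_{n\ge1}(1-q^n)$, $q=e^{2\pi i\tau}$ (with $q^{1/24}=e^{2\pi i\tau/24}$), is the Dedekind eta function on the upper half-plane. *)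

theory Defs
  imports "HOL-Analysis.Analysis"
begin

definition parallelogram :: "real \<Rightarrow> complex set" where
  "parallelogram r =
     convex hull {0, complex_of_real r, complex_of_real r + cis (pi / 3), cis (pi / 3)}"

definition equilateral_triangle :: "complex set" where
  "equilateral_triangle = convex hull {0, 1, cis (pi / 3)}"

definition is_cardy_smirnov_map :: "real \<Rightarrow> (complex \<Rightarrow> complex) \<Rightarrow> bool" where
  "is_cardy_smirnov_map r g \<longleftrightarrow>
     (\<exists>h. homeomorphism (parallelogram r) equilateral_triangle g h \<and>
          g ` interior (parallelogram r) = interior equilateral_triangle \<and>
          g holomorphic_on interior (parallelogram r) \<and>
          h holomorphic_on interior equilateral_triangle) \<and>
     g 0 = 0 \<and>
     g (complex_of_real r + cis (pi / 3)) = 1 \<and>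
     g (cis (pi / 3)) = cis (pi / 3)"

text \<open>The map is determined only on the parallelogram; \<^const>\<open>extensional\<close> fixes its irrelevant
  values elsewhere, so that it is unique as a total function.\<close>

definition cardy_smirnov_map :: "real \<Rightarrow> complex \<Rightarrow> complex" where
  "cardy_smirnov_map r =
     (THE g. g \<in> extensional (parallelogram r) \<and> is_cardy_smirnov_map r g)"

text \<open>The value is kept in \<^typ>\<open>complex\<close>, so an equation with a real number also says that
  the image of the vertex \<open>r\<close> is real.\<close>

definition Pi_h_par :: "real \<Rightarrow> complex" where
  "Pi_h_par r = 1 - cardy_smirnov_map r (complex_of_real r)"

text \<open>\<^const>\<open>prodinf\<close> starts at index \<open>0\<close>, hence the exponent \<open>Suc n\<close>.\<close>

definition dedekind_eta :: "complex \<Rightarrow> complex" where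
  "dedekind_eta \<tau> =
     exp (2 * of_real pi * \<i> * \<tau> / 24) *
     prodinf (\<lambda>n. 1 - exp (2 * of_real pi * \<i> * \<tau>) ^ Suc n)"

end

theory Submission
  imports Defs "HOL-Complex_Analysis.Complex_Analysis"
begin

text \<open>
The Schwarz--Christoffel maps of the disc onto the parallelogram and onto the triangle can be given
the prevertices \<open>0\<close>, \<open>1\<close>, \<open>\<infinity>\<close> (in a half-plane coordinate \<open>w\<close>) in common; the parallelogram
has one more, \<open>l\<close> in \<open>(0,1)\<close>. Both maps are injective because the derivative, up to a rotation,
has positive real part. With \<open>F\<close> the hypergeometric function \<open>2F1(1/3,2/3;1)\<close> and \<open>x = 1 - l\<close>,
Euler's integral turns the ratio of the sides into \<open>r = F(1-x) / F(x)\<close>, while \<open>1 - g(r)\<close> is the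
regularised incomplete Beta integral of \<open>w powr (-2/3) * (1-w) powr (-2/3)\<close> over \<open>[0, x]\<close>.

The ratio is inverted by the cubic theta functions \<open>a, b, c\<close> of Borwein and Borwein, with
\<open>b\<close> and \<open>c\<close> eta quotients and \<open>a^3 = b^3 + c^3\<close>: at the nome \<open>q = exp (-2 pi r / sqrt 3)\<close> one has
\<open>x = c^3 / a^3\<close> and \<open>F(x) = a\<close>. Jacobi's series for the cube of \<open>\<Prod>n\<ge>1. 1 - q^n\<close>, split modulo 3, expresses
\<open>a(q)\<close> and \<open>a(q^3)\<close> linearly in \<open>b(q)\<close> and \<open>c(q^3)\<close>; together with the cubic transformation of \<open>F\<close>
this makes \<open>a / F(x)\<close> invariant, and \<open>F(1-x) / F(x)\<close> homogeneous, under \<open>q \<mapsto> q^3\<close>, and the limit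
\<open>q \<rightarrow> 0\<close> decides. The Legendre relation gives \<open>dx/dr\<close>, and the Beta integrand becomes \<open>b c\<close>, a
multiple of the product of eta functions.
\<close>

section \<open>Jacobi's identity and the cubic theta functions\<close>

text \<open>Since the disc maps \<open>S\<close> (parallelogram) and \<open>V\<close> (triangle)
  share three prevertices, the Cardy-Smirnov map is \<open>V\<close> after the inverse of
  \<open>S\<close>, with no Moebius correction, and \<open>g(r)\<close> is the value of
  \<open>V\<close> at the prevertex that belongs to \<open>l\<close>. Both maps are built on the
  closed disc, so that their boundary values are explicit. Uniqueness is what evaluates the
  description operator; it is the rigidity of a disc automorphism with three fixed points.

  The inversion of the ratio avoids modular transformations: the defect between
  \<open>F(1-x) / F(x)\<close> and \<open>- hyp_const * ln q\<close> triples under q -> q^3, yet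
  stays bounded as q tends to 0, so it vanishes.

  One number governs the constants: \<open>hyp_const\<close> = 1 / (Gamma(1/3) Gamma(2/3)) = sqrt 3
  / (2 pi). It is the value in the Legendre relation, its reciprocal is the rate 2 pi / sqrt 3 in
  the nome, and the prefactor 4 pi^2 / Gamma(1/3)^3 equals 3 / (\<open>hyp_const\<close> * Beta(1/3,
  1/3)), where the 3 is the leading coefficient of \<open>c\<close>.\<close>

definition qpoch :: "nat \<Rightarrow> 'a::comm_ring_1 \<Rightarrow> 'a" where
  "qpoch n q = (\<Prod>k<n. 1 - q ^ Suc k)"

lemma qpoch_0 [simp]: "qpoch 0 q = 1"
  and qpoch_Suc: "qpoch (Suc n) q = qpoch n q * (1 - q ^ Suc n)"
  by (simp_all add: qpoch_def)

lemma one_minus_power_nonzero: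
  fixes q :: "'a::real_normed_field"
  assumes "norm q < 1"
  shows "1 - q ^ Suc n \<noteq> 0"
proof
  assume "1 - q ^ Suc n = 0"
  hence "norm q ^ Suc n = 1"
    by (metis norm_one norm_power right_minus_eq)
  moreover have "norm q ^ Suc n < 1"
    using assms by (subst power_less_one_iff) auto
  ultimately show False by simp
qed

lemma qpoch_nonzero:
  fixes q :: "'a::real_normed_field"
  shows "norm q < 1 \<Longrightarrow> qpoch n q \<noteq> 0"
  using one_minus_power_nonzero[of q] by (simp add: qpoch_def)

text \<open>The Gaussian binomial coefficient \<open>[2n+1, n-j]\<close>.\<close>
definition mid_gbinom :: "'a::field \<Rightarrow> nat \<Rightarrow> nat \<Rightarrow> 'a" where
  "mid_gbinom q n j =
     (if j \<le> n then qpoch (2 * n + 1) q / (qpoch (n - j) q * qpoch (n + 1 + j) q) else 0)"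

lemma mid_gbinom_diag: "norm q < 1 \<Longrightarrow> mid_gbinom q n n = 1" for q :: "'a::real_normed_field"
  using qpoch_nonzero[of q "2 * n + 1"] by (simp add: mid_gbinom_def mult_2)

text \<open>Two q-Pascal steps lead from row 2n+1 to row 2n+3 of the Gaussian triangle. At
  \<open>j = 0\<close> the left neighbour would have index -1; by the symmetry of the row it is the
  entry with index 0, hence the conditional.\<close>

lemma mid_gbinom_Suc:
  fixes q :: "'a::real_normed_field"
  assumes q: "norm q < 1" and j: "j \<le> n"
  shows "mid_gbinom q (Suc n) j =
     (1 + q ^ (2 * n + 2)) * mid_gbinom q n j + q ^ (n + 2 + j) * mid_gbinom q n (Suc j) +
     q ^ (n + 1 - j) * mid_gbinom q n (if j = 0 then 0 else j - 1)"
proof -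
  define X Y where "X = q ^ (n - j)" and "Y = q ^ (n + 1 + j)"
  \<comment> \<open>All four binomials are multiples of \<open>u\<close>; what remains is a
    polynomial identity in \<open>q\<close>, \<open>X\<close> and \<open>Y\<close>.\<close>
  define u where "u = qpoch (2 * n + 1) q / (qpoch (n + 1 - j) q * qpoch (n + 2 + j) q)"
  note nz = qpoch_nonzero[OF q] one_minus_power_nonzero[OF q]
  have XY: "q ^ (2 * n + 2) = q * X * Y" "q ^ (2 * n + 3) = q^2 * X * Y"
    "q ^ (n + 2 + j) = q * Y" "q ^ (n + 1 - j) = q * X"
  proof -
    have "X * Y = q ^ (2 * n + 1)"
      using j by (simp add: X_def Y_def mult_2 flip: power_add)
    thus "q ^ (2 * n + 2) = q * X * Y" "q ^ (2 * n + 3) = q^2 * X * Y"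
      by (simp_all add: mult.assoc power2_eq_square numeral_3_eq_3)
    show "q ^ (n + 2 + j) = q * Y" "q ^ (n + 1 - j) = q * X"
      using j by (simp_all add: X_def Y_def Suc_diff_le)
  qed
  have p1: "qpoch (n + 1 - j) q = qpoch (n - j) q * (1 - q * X)"
    using j by (simp add: X_def qpoch_Suc Suc_diff_le)
  have p2: "qpoch (n + 2 + j) q = qpoch (n + 1 + j) q * (1 - q * Y)"
    using qpoch_Suc[of "n + 1 + j" q] by (simp add: Y_def)
  have nz1: "1 - q * X \<noteq> 0" "1 - q * Y \<noteq> 0"
    using nz(2)[of "n - j"] nz(2)[of "n + 1 + j"] by (simp_all add: X_def Y_def)
  have b0: "mid_gbinom q n j = u * ((1 - q * X) * (1 - q * Y))"
    using j nz1 nz(1) unfolding mid_gbinom_def u_def p1 p2 by simp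
  have b1: "mid_gbinom q n (Suc j) = u * ((1 - q * X) * (1 - X))"
  proof (cases "j = n")
    case True
    thus ?thesis by (simp add: mid_gbinom_def X_def)
  next
    case False
    hence *: "n - j = Suc (n - Suc j)" using j by simp
    have "qpoch (n - j) q = qpoch (n - Suc j) q * (1 - X)"
      by (simp add: X_def * qpoch_Suc)
    moreover have "1 - X \<noteq> 0"
      using nz(2)[of "n - Suc j"] by (simp add: X_def *)
    ultimately show ?thesis
      using j False nz1 nz(1) unfolding mid_gbinom_def u_def p1 by simp
  qed
  \<comment> \<open>For \<open>j = 0\<close> one has \<open>Y = q * X\<close>, so the formula for
    the reflected entry agrees with \<open>b0\<close>.\<close>
  have b2: "mid_gbinom q n (if j = 0 then 0 else j - 1) = u * ((1 - q * Y) * (1 - Y))"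
  proof (cases j)
    case 0
    hence "Y = q * X" by (simp add: X_def Y_def)
    with b0 show ?thesis by (simp add: 0 mult_ac)
  next
    case (Suc i)
    have "qpoch (n + 1 + j) q = qpoch (n + 1 + i) q * (1 - Y)"
      using qpoch_Suc[of "n + 1 + i" q] by (simp add: Suc Y_def)
    moreover have "1 - Y \<noteq> 0"
      using nz(2)[of "n + j"] by (simp add: Y_def)
    moreover have "n - i = n + 1 - j" using Suc by simp
    ultimately show ?thesis
      using j Suc nz1 nz(1) unfolding mid_gbinom_def u_def p2 by (simp add: mult_ac)
  qed
  have "mid_gbinom q (Suc n) j = u * ((1 - q * X * Y) * (1 - q^2 * X * Y))"
  proof -
    have "qpoch (2 * Suc n + 1) q = qpoch (2 * n + 1) q * (1 - q ^ (2 * n + 2)) * (1 - q ^ (2 * n + 3))"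
      using qpoch_Suc[of "2 * n + 1" q] qpoch_Suc[of "2 * n + 2" q] by (simp add: numeral_3_eq_3)
    thus ?thesis
      using j unfolding mid_gbinom_def u_def XY by simp
  qed
  thus ?thesis
    unfolding b0 b1 b2 XY by (simp add: algebra_simps power2_eq_square)
qed

text \<open>A finite form of Jacobi's series, by induction: the recurrence for the binomials is
  inserted and the two neighbour sums are shifted until every term contains \<open>B j\<close>. With
  Q = q^(n+1) the coefficients combine by (2j+1)(1+Q^2) - (2j-1)Q - (2j+3)Q = (2j+1)(1-Q)^2, which
  is the factor by which the right side grows.\<close>

lemma finite_jacobi_identity:
  fixes q :: "'a::real_normed_field"
  assumes q: "norm q < 1"
  shows "(\<Sum>j\<le>n. (-1) ^ j * of_nat (2 * j + 1) * q ^ (j * (j + 1) div 2) * mid_gbinom q n j)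
         = qpoch n q ^ 2"
proof (induction n)
  case 0
  thus ?case using mid_gbinom_diag[OF q, of 0] by simp
next
  case (Suc n)
  define T where "T = (\<lambda>j::nat. j * (j + 1) div 2)"
  define t :: "nat \<Rightarrow> 'a" where "t = (\<lambda>j. (-1) ^ j * of_nat (2 * j + 1) * q ^ T j)"
  define B where "B = mid_gbinom q n"
  have B0: "B j = 0" if "j > n" for j using that by (simp add: B_def mid_gbinom_def)
  have tri: "T (Suc j) = T j + (j + 1)" for j
  proof -
    have "Suc j * (Suc j + 1) = j * (j + 1) + 2 * (j + 1)" by simp
    thus ?thesis unfolding T_def by (simp only: div_mult_self2 zero_neq_numeral not_False_eq_True)
  qed
  have e1: "t (Suc j) * q ^ (n - j) = - ((-1) ^ j * of_nat (2 * j + 3) * q ^ T j * q ^ Suc n)"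
    if "j \<le> n" for j
  proof -
    have "q ^ (j + 1) * q ^ (n - j) = q ^ Suc n" using that by (simp only: power_add[symmetric]) simp
    moreover have "t (Suc j) = - ((-1) ^ j * of_nat (2 * j + 3) * q ^ T j * q ^ (j + 1))"
      unfolding t_def tri power_add[of q "T j"] by (simp add: numeral_3_eq_3)
    ultimately show ?thesis by (simp only: mult_minus_left mult.assoc)
  qed
  have e2: "t j * q ^ (n + 2 + j) = (-1) ^ j * of_nat (2 * j + 1) * q ^ T (Suc j) * q ^ Suc n" for j
  proof -
    have "q ^ (n + 2 + j) = q ^ (j + 1) * q ^ Suc n" by (simp only: power_add[symmetric]) (simp add: add_ac)
    thus ?thesis unfolding t_def tri power_add[of q "T j"] by (simp only: mult.assoc)
  qed
  have s0: "(\<Sum>j\<le>n. t j * (q ^ (n + 2 + j) * B (Suc j))) =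
     (\<Sum>j\<le>n. (if j = 0 then 0 else - ((-1) ^ j * (of_nat (2 * j) - 1) * q ^ T j * q ^ Suc n * B j)))"
    (is "_ = (\<Sum>j\<le>n. ?g j)")
  proof -
    have "(\<Sum>j\<le>n. ?g j) = (\<Sum>j\<le>Suc n. ?g j)" by (simp add: B0)
    also have "\<dots> = (\<Sum>j\<le>n. ?g (Suc j))" by (subst sum.atMost_Suc_shift) simp
    also have "\<dots> = (\<Sum>j\<le>n. t j * (q ^ (n + 2 + j) * B (Suc j)))"
    proof (intro sum.cong refl)
      fix j
      have "?g (Suc j) = t j * q ^ (n + 2 + j) * B (Suc j)" unfolding e2 by simp
      thus "?g (Suc j) = t j * (q ^ (n + 2 + j) * B (Suc j))" by (simp only: mult.assoc)
    qed
    finally show ?thesis ..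
  qed
  have s1: "(\<Sum>j\<le>Suc n. t j * (q ^ (n + 1 - j) * B (if j = 0 then 0 else j - 1))) =
     q ^ Suc n * B 0 + (\<Sum>j\<le>n. - ((-1) ^ j * of_nat (2 * j + 3) * q ^ T j * q ^ Suc n * B j))"
  proof -
    have "t (Suc j) * (q ^ (n + 1 - Suc j) * B (if Suc j = 0 then 0 else Suc j - 1)) =
        - ((-1) ^ j * of_nat (2 * j + 3) * q ^ T j * q ^ Suc n * B j)" if "j \<le> n" for j
      using arg_cong[OF e1[OF that], of "\<lambda>x. x * B j"] by (simp add: mult.assoc)
    moreover have "t 0 = 1" by (simp add: t_def T_def)
    ultimately show ?thesis by (subst sum.atMost_Suc_shift) simp
  qed
  have s2: "(\<Sum>j\<le>Suc n. t j * (q ^ (n + 1 - j) * B (if j = 0 then 0 else j - 1))) =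
      (\<Sum>j\<le>n. t j * (q ^ (n + 1 - j) * B (if j = 0 then 0 else j - 1))) + t (Suc n)"
    by (simp add: B_def mid_gbinom_diag[OF q])
  have "(\<Sum>j\<le>n. t j * mid_gbinom q (Suc n) j) =
    (\<Sum>j\<le>n. t j * ((1 + q ^ (2 * n + 2)) * B j)) + (\<Sum>j\<le>n. t j * (q ^ (n + 2 + j) * B (Suc j))) +
    (\<Sum>j\<le>n. t j * (q ^ (n + 1 - j) * B (if j = 0 then 0 else j - 1)))"
    unfolding sum.distrib[symmetric]
    by (intro sum.cong refl, subst mid_gbinom_Suc[OF q]) (simp_all add: B_def distrib_left)
  hence "(\<Sum>j\<le>Suc n. t j * mid_gbinom q (Suc n) j) =
    (\<Sum>j\<le>n. t j * ((1 + q ^ (2 * n + 2)) * B j)) + (\<Sum>j\<le>n. t j * (q ^ (n + 2 + j) * B (Suc j))) +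
    (\<Sum>j\<le>Suc n. t j * (q ^ (n + 1 - j) * B (if j = 0 then 0 else j - 1)))"
    unfolding s2 by (simp add: mid_gbinom_diag[OF q])
  also have "\<dots> = (\<Sum>j\<le>n. t j * ((1 + q ^ (2 * n + 2)) * B j)) +
    (\<Sum>j\<le>n. (if j = 0 then 0 else - ((-1) ^ j * (of_nat (2 * j) - 1) * q ^ T j * q ^ Suc n * B j))) +
    ((\<Sum>j\<le>n. if j = 0 then q ^ Suc n * B j else 0) +
     (\<Sum>j\<le>n. - ((-1) ^ j * of_nat (2 * j + 3) * q ^ T j * q ^ Suc n * B j)))"
    unfolding s0 s1 by simp
  \<comment> \<open>At \<open>j = 0\<close> the shifted sum contributes nothing; the reflected entry
    \<open>q ^ Suc n * B 0\<close> supplies exactly the missing term -(2j-1)Q = Q.\<close>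
  also have "\<dots> = (\<Sum>j\<le>n. t j * B j * (1 - q ^ Suc n) ^ 2)"
  proof -
    have "2 * n + 2 = Suc n * 2" by simp
    hence sq: "q ^ (2 * n + 2) = (q ^ Suc n) ^ 2" by (simp only: power_mult)
    show ?thesis
      unfolding sum.distrib[symmetric] sq
    proof (intro sum.cong refl)
      fix j
      define Q where "Q = q ^ Suc n"
      show "t j * ((1 + (q ^ Suc n)\<^sup>2) * B j) +
         (if j = 0 then 0 else - ((- 1) ^ j * (of_nat (2 * j) - 1) * q ^ T j * q ^ Suc n * B j)) +
         ((if j = 0 then q ^ Suc n * B j else 0) +
          - ((- 1) ^ j * of_nat (2 * j + 3) * q ^ T j * q ^ Suc n * B j)) =
         t j * B j * (1 - q ^ Suc n)\<^sup>2"
        unfolding Q_def[symmetric] t_def by (simp add: algebra_simps power2_eq_square T_def)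
    qed
  qed
  also have "\<dots> = (\<Sum>j\<le>n. t j * B j) * (1 - q ^ Suc n) ^ 2"
    by (simp only: sum_distrib_right)
  also have "(\<Sum>j\<le>n. t j * B j) = qpoch n q ^ 2"
    using Suc.IH by (simp add: t_def B_def T_def)
  finally show ?case unfolding qpoch_Suc power_mult_distrib by (simp only: t_def T_def)
qed

section \<open>Jacobi's series for the cube of Euler's product\<close>

definition euler_prod :: "complex \<Rightarrow> complex" where
  "euler_prod q = prodinf (\<lambda>n. 1 - q ^ Suc n)"

lemma convergent_prod_euler:
  fixes q :: "'a::{real_normed_field,banach}"
  assumes "norm q < 1" shows "convergent_prod (\<lambda>n. 1 - q ^ Suc n)"
proof -
  have "summable (\<lambda>n. norm q ^ Suc n)"
    using summable_geometric[of "norm q"] assms by (subst summable_Suc_iff) auto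
  hence "abs_convergent_prod (\<lambda>n. 1 - q ^ Suc n)"
    by (intro summable_imp_abs_convergent_prod) (simp add: norm_power norm_mult)
  thus ?thesis by (rule abs_convergent_prod_imp_convergent_prod)
qed

lemma qpoch_LIMSEQ: "norm q < 1 \<Longrightarrow> (\<lambda>n. qpoch n q) \<longlonglongrightarrow> euler_prod q"
  unfolding qpoch_def euler_prod_def
  using convergent_prod_LIMSEQ[OF convergent_prod_euler, of q] LIMSEQ_lessThan_iff_atMost by blast

lemma euler_prod_nonzero: "norm q < 1 \<Longrightarrow> euler_prod q \<noteq> 0"
  unfolding euler_prod_def
  by (intro prodinf_nonzero convergent_prod_euler one_minus_power_nonzero)

definition jacobi_term :: "complex \<Rightarrow> nat \<Rightarrow> complex" where
  "jacobi_term q j = (-1) ^ j * of_nat (2 * j + 1) * q ^ (j * (j + 1) div 2)"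

lemma summable_jacobi_norm:
  fixes x :: real assumes "0 \<le> x" "x < 1"
  shows "summable (\<lambda>j. real (2 * j + 1) * x ^ (j * (j + 1) div 2))"
proof (rule summable_comparison_test')
  have "summable (\<lambda>n. diffs (\<lambda>_. 1) n * x ^ n)"
    using assms by (intro termdiff_converges[where K = 1]) (auto intro: summable_geometric)
  thus "summable (\<lambda>j. 2 * (real (Suc j) * x ^ j))"
    by (intro summable_mult) (simp add: diffs_def)
  fix n :: nat
  have "n \<le> n * (n + 1) div 2" by (cases n) auto
  hence "x ^ (n * (n + 1) div 2) \<le> x ^ n"
    using assms by (intro power_decreasing) auto
  hence "real (2 * n + 1) * x ^ (n * (n + 1) div 2) \<le> real (2 * Suc n) * x ^ n"
    using assms by (intro mult_mono) auto
  thus "norm (real (2 * n + 1) * x ^ (n * (n + 1) div 2)) \<le> 2 * (real (Suc n) * x ^ n)"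
    using assms by (simp add: algebra_simps)
qed

lemma norm_jacobi_term: "norm (jacobi_term q j) = real (2 * j + 1) * norm q ^ (j * (j + 1) div 2)"
proof -
  have "norm (1 + 2 * of_nat j :: complex) = real (1 + 2 * j)"
    using norm_of_nat[of "1 + 2 * j", where 'a = complex] by simp
  thus ?thesis by (simp add: jacobi_term_def norm_mult norm_power add_ac)
qed

lemma summable_jacobi_term: "norm q < 1 \<Longrightarrow> summable (jacobi_term q)"
  by (rule summable_norm_cancel) (use summable_jacobi_norm[of "norm q"] in \<open>simp add: norm_jacobi_term\<close>)

text \<open>In the finite identity each binomial tends to 1/E, with E the Euler product, and the
  right side to E^2; multiplying by E gives the cube. Tannery's theorem exchanges limit and sum: the
  finite products and their inverses converge, hence are bounded by \<open>C\<close> and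
  \<open>D\<close>, so \<open>C * D * D\<close> bounds all binomials.\<close>

theorem jacobi_euler_cube:
  assumes q: "norm q < 1"
  shows "euler_prod q ^ 3 = (\<Sum>j. jacobi_term q j)"
proof -
  note nz = qpoch_nonzero[OF q] euler_prod_nonzero[OF q]
  note lim = qpoch_LIMSEQ[OF q]
  have "Bseq (\<lambda>n. qpoch n q)"
    using lim convergentI convergent_imp_Bseq by blast
  then obtain C where C: "norm (qpoch n q) \<le> C" for n unfolding Bseq_def by auto
  have "Bseq (\<lambda>n. inverse (qpoch n q))"
    using tendsto_inverse[OF lim nz(2)] convergentI convergent_imp_Bseq by blast
  then obtain D where D: "norm (inverse (qpoch n q)) \<le> D" for n unfolding Bseq_def by auto
  have CD: "C \<ge> 0" "D \<ge> 0" using norm_ge_zero order_trans C D by blast+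
  have bnd: "norm (mid_gbinom q n j) \<le> C * D * D" for n j
  proof (cases "j \<le> n")
    case True
    have "norm (mid_gbinom q n j) = norm (qpoch (2 * n + 1) q) *
        norm (inverse (qpoch (n - j) q)) * norm (inverse (qpoch (n + 1 + j) q))"
      using True by (simp add: mid_gbinom_def norm_divide norm_mult norm_inverse field_simps)
    also have "\<dots> \<le> C * D * D"
      using CD by (intro mult_mono C D mult_nonneg_nonneg norm_ge_zero)
    finally show ?thesis .
  qed (use CD in \<open>simp add: mid_gbinom_def\<close>)
  have lim_mid: "(\<lambda>n. mid_gbinom q n j) \<longlonglongrightarrow> 1 / euler_prod q" for j
  proof -
    have f1: "filterlim (\<lambda>n::nat. 2 * n + 1) at_top at_top" "filterlim (\<lambda>n::nat. n - j) at_top at_top"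
       "filterlim (\<lambda>n::nat. n + 1 + j) at_top at_top"
      using filterlim_minus_const_nat_at_top[of j]
      by (auto intro!: filterlim_subseq strict_monoI)
    have "(\<lambda>n. qpoch (2 * n + 1) q / (qpoch (n - j) q * qpoch (n + 1 + j) q)) \<longlonglongrightarrow>
        euler_prod q / (euler_prod q * euler_prod q)"
      by (intro tendsto_divide tendsto_mult filterlim_compose[OF lim] f1) (use nz in auto)
    moreover have "\<forall>\<^sub>F n in sequentially. qpoch (2 * n + 1) q / (qpoch (n - j) q * qpoch (n + 1 + j) q) = mid_gbinom q n j"
      using eventually_ge_at_top[of j] by eventually_elim (simp add: mid_gbinom_def)
    ultimately show ?thesis
      using nz by (simp add: Lim_transform_eventually)
  qed
  have "(\<lambda>n. \<Sum>j. jacobi_term q j * mid_gbinom q n j) \<longlonglongrightarrow> (\<Sum>j. jacobi_term q j * (1 / euler_prod q))"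
  proof (intro tannerys_theorem[THEN conjunct2, THEN conjunct2] always_eventually allI)
    show "(\<lambda>n. jacobi_term q k * mid_gbinom q n k) \<longlonglongrightarrow> jacobi_term q k * (1 / euler_prod q)" for k
      by (intro tendsto_intros lim_mid)
    show "summable (\<lambda>j. norm (jacobi_term q j) * (C * D * D))"
      unfolding norm_jacobi_term using q by (intro summable_mult2 summable_jacobi_norm) auto
    show "case x of (k, n) \<Rightarrow> norm (jacobi_term q k * mid_gbinom q n k) \<le> norm (jacobi_term q k) * (C * D * D)" for x
      by (auto simp: norm_mult intro!: mult_left_mono bnd)
  qed auto
  also have "(\<lambda>n. \<Sum>j. jacobi_term q j * mid_gbinom q n j) = (\<lambda>n. qpoch n q ^ 2)"
  proof
    fix n
    have "(\<Sum>j. jacobi_term q j * mid_gbinom q n j) = (\<Sum>j\<le>n. jacobi_term q j * mid_gbinom q n j)"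
      by (intro suminf_finite) (auto simp: mid_gbinom_def)
    thus "(\<Sum>j. jacobi_term q j * mid_gbinom q n j) = qpoch n q ^ 2"
      using finite_jacobi_identity[OF q, of n] by (simp add: jacobi_term_def mult.assoc)
  qed
  finally have "(\<lambda>n. qpoch n q ^ 2) \<longlonglongrightarrow> (\<Sum>j. jacobi_term q j) * (1 / euler_prod q)"
    using suminf_mult2[OF summable_jacobi_term[OF q], of "1 / euler_prod q"] by (simp only:)
  from LIMSEQ_unique[OF tendsto_power[OF lim] this]
  show ?thesis using nz by (simp add: field_simps power2_eq_square power3_eq_cube)
qed

section \<open>Dissection modulo 3 by cube roots of unity\<close>

definition cube_root :: complex where "cube_root = cis (2 * pi / 3)"

lemma cube_root_rel: "cube_root\<^sup>2 = - 1 - cube_root"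
  unfolding cube_root_def power2_eq_square
  by (simp add: complex_eq_iff cos_120 sin_120)

lemma cube_root_of_unity_cubed:
  fixes w :: "'a::comm_ring_1"
  assumes "w\<^sup>2 = - 1 - w" shows "w ^ 3 = 1"
proof -
  have "w ^ 3 - 1 = (w - 1) * (w\<^sup>2 + w + 1)" by (simp add: power2_eq_square power3_eq_cube algebra_simps)
  thus ?thesis using assms by simp
qed

lemma norm_cube_root [simp]: "norm cube_root = 1" by (simp add: cube_root_def)

text \<open>Only the exponents \<open>j(j+1)/2\<close> with \<open>j\<close> congruent to \<open>1\<close> modulo \<open>3\<close> are not divisible by \<open>3\<close>,
  and these terms again form a Jacobi series.\<close>

lemma jacobi_three_dissection:
  assumes q: "norm q < 1" and w: "w ^ 3 = 1"
  shows "euler_prod (w * q) ^ 3 + 3 * (w * q) * euler_prod (q ^ 9) ^ 3 =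
         (\<Sum>m. jacobi_term q (3 * m) + jacobi_term q (3 * m + 2))"
proof -
  have nw: "norm w = 1"
    using power_eq_imp_eq_norm[of w 3 1] w by simp
  have wq: "norm (w * q) < 1" using q nw by (simp add: norm_mult)
  have q9: "norm (q ^ 9) < 1" using q by (simp add: norm_power power_less_one_iff)
  have "(\<lambda>m. sum (jacobi_term (w * q)) {m * 3..<m * 3 + 3}) sums euler_prod (w * q) ^ 3"
    using sums_group[OF summable_sums[OF summable_jacobi_term[OF wq]], of 3] jacobi_euler_cube[OF wq] by simp
  moreover have "(\<lambda>m. jacobi_term (q ^ 9) m) sums (euler_prod (q ^ 9) ^ 3)"
    using summable_sums[OF summable_jacobi_term[OF q9]] jacobi_euler_cube[OF q9] by simp
  ultimately have "(\<lambda>m. sum (jacobi_term (w * q)) {m * 3..<m * 3 + 3} + 3 * (w * q) * jacobi_term (q ^ 9) m) sums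
      (euler_prod (w * q) ^ 3 + 3 * (w * q) * euler_prod (q ^ 9) ^ 3)"
    by (intro sums_add sums_mult)
  moreover have "sum (jacobi_term (w * q)) {m * 3..<m * 3 + 3} + 3 * (w * q) * jacobi_term (q ^ 9) m =
      jacobi_term q (3 * m) + jacobi_term q (3 * m + 2)" for m
  proof -
    define k where "k = m * (m + 1) div 2"
    have "even (m * (m + 1))" by simp
    hence k: "m * (m + 1) = 2 * k" by (auto simp: k_def)
    have ev: "even (m * 3 * (m * 3 + 1))" by simp
    define l where "l = (m * (3 * m + 1)) div 2"
    have l: "m * (3 * m + 1) = 2 * l" unfolding l_def by (cases "even m") auto
    have "3 * m * (3 * m + 1) = 2 * (3 * l)" using l by (simp add: algebra_simps)
    hence t0: "3 * m * (3 * m + 1) div 2 = 3 * l" by simp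
    have "(3 * m + 1) * (3 * m + 1 + 1) = 2 * (1 + 9 * k)" using k by (simp add: algebra_simps)
    hence t1: "(3 * m + 1) * (3 * m + 1 + 1) div 2 = 1 + 9 * k" by simp
    have "(3 * m + 2) * (3 * m + 2 + 1) = 2 * (3 * (l + 2 * m + 1))" using l by (simp add: algebra_simps)
    hence t2: "(3 * m + 2) * (3 * m + 2 + 1) div 2 = 3 * (l + 2 * m + 1)" by simp
    have w3: "w ^ (3 * i) = 1" for i by (simp add: power_mult w)
    have w9: "w ^ (9 * i) = 1" for i using w3[of "3 * i"] by simp
    have "{m * 3..<m * 3 + 3} = {3 * m, 3 * m + 1, 3 * m + 2}" by auto
    hence "sum (jacobi_term (w * q)) {m * 3..<m * 3 + 3} =
        jacobi_term (w * q) (3 * m) + jacobi_term (w * q) (3 * m + 1) + jacobi_term (w * q) (3 * m + 2)"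
      by (simp add: add_ac)
    moreover have "jacobi_term (w * q) (3 * m) = jacobi_term q (3 * m)"
      unfolding jacobi_term_def t0 power_mult_distrib w3 by simp
    moreover have "jacobi_term (w * q) (3 * m + 2) = jacobi_term q (3 * m + 2)"
      unfolding jacobi_term_def t2 power_mult_distrib w3 by simp
    \<comment> \<open>For j = 3m+1 the weight 2j+1 is 3(2m+1) and the exponent is 1 + 9 m(m+1)/2, so
      this term is -3wq times a Jacobi term in q^9.\<close>
    moreover have "jacobi_term (w * q) (3 * m + 1) + 3 * (w * q) * jacobi_term (q ^ 9) m = 0"
    proof -
      have "jacobi_term (w * q) (3 * m + 1) =
         (-1) ^ (3 * m + 1) * of_nat (2 * (3 * m + 1) + 1) * ((w * q) * q ^ (9 * k))"
        unfolding jacobi_term_def t1 power_add by (simp add: power_mult_distrib w9)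
      moreover have "(-1 :: complex) ^ (3 * m + 1) = - ((-1) ^ m)"
        by (simp add: power_mult)
      moreover have "of_nat (2 * (3 * m + 1) + 1) = (3 * of_nat (2 * m + 1) :: complex)" by simp
      moreover have "jacobi_term (q ^ 9) m = (-1) ^ m * of_nat (2 * m + 1) * q ^ (9 * k)"
        by (simp add: jacobi_term_def k_def flip: power_mult)
      ultimately show ?thesis by (simp only:) (simp add: mult_ac)
    qed
    ultimately show ?thesis by (simp add: algebra_simps add_eq_0_iff)
  qed
  ultimately show ?thesis by (simp add: sums_iff)
qed

text \<open>Multiplying 1 - x^m over the three rotations x of q by cube roots of unity gives 1 -
  q^(3m) when 3 does not divide m, and (1 - q^m)^3 otherwise. The factor in q^9 restores the factors
  1 - q^(3m) with 3 dividing m, completing the product in q^3.\<close>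

lemma qpoch_cube_roots:
  fixes q w :: complex
  assumes w: "w\<^sup>2 = - 1 - w"
  shows "qpoch (3 * n) q * qpoch (3 * n) (w * q) * qpoch (3 * n) (w\<^sup>2 * q) * qpoch n (q ^ 9) =
         qpoch (3 * n) (q ^ 3) * qpoch n (q ^ 3) ^ 3"
proof (induction n)
  case (Suc n)
  have w3: "w ^ 3 = 1" using w by (rule cube_root_of_unity_cubed)
  have w3n: "w ^ (3 * n) = 1" by (simp add: power_mult w3)
  have 3: "3 * Suc n = Suc (Suc (Suc (3 * n)))" by simp
  \<comment> \<open>The coefficients are the elementary symmetric functions of 1, w^m and
    w^(2m).\<close>
  have split: "(1 - q ^ m) * (1 - (w * q) ^ m) * (1 - (w\<^sup>2 * q) ^ m) =
      1 - (1 + w ^ m + (w ^ m)\<^sup>2) * q ^ m + (w ^ m + (w ^ m)\<^sup>2 + (w ^ m) ^ 3) * (q ^ m)\<^sup>2 - (w ^ m) ^ 3 * (q ^ m) ^ 3" for m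
    by (simp add: power_mult_distrib algebra_simps power2_eq_square power3_eq_cube)
  have p: "w ^ Suc (3 * n) = w" "w ^ Suc (Suc (3 * n)) = w\<^sup>2" "w ^ Suc (Suc (Suc (3 * n))) = 1"
    using w3 by (simp_all add: w3n power2_eq_square power3_eq_cube mult.assoc)
  have w4: "(w\<^sup>2)\<^sup>2 = w" "(w\<^sup>2) ^ 3 = 1"
    using w3 by (simp_all add: power2_eq_square power3_eq_cube mult.assoc)
  have sum0: "1 + w + w\<^sup>2 = 0" "1 + w\<^sup>2 + w = 0" "w + w\<^sup>2 + 1 = 0" "w\<^sup>2 + w + 1 = 0" using w by simp_all
  have pw: "(q ^ m) ^ 3 = (q ^ 3) ^ m" for m by (metis mult.commute power_mult)
  have f1: "(1 - q ^ Suc (3 * n)) * (1 - (w * q) ^ Suc (3 * n)) * (1 - (w\<^sup>2 * q) ^ Suc (3 * n)) =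
      1 - (q ^ 3) ^ Suc (3 * n)"
    unfolding split p w3 sum0 pw by simp
  have f2: "(1 - q ^ Suc (Suc (3 * n))) * (1 - (w * q) ^ Suc (Suc (3 * n))) * (1 - (w\<^sup>2 * q) ^ Suc (Suc (3 * n))) =
      1 - (q ^ 3) ^ Suc (Suc (3 * n))"
    unfolding split p w4 sum0 pw by simp
  have f3: "(1 - q ^ Suc (Suc (Suc (3 * n)))) * (1 - (w * q) ^ Suc (Suc (Suc (3 * n)))) *
     (1 - (w\<^sup>2 * q) ^ Suc (Suc (Suc (3 * n)))) = (1 - (q ^ 3) ^ Suc n) ^ 3"
  proof -
    have "q ^ Suc (Suc (Suc (3 * n))) = (q ^ 3) ^ Suc n" by (simp only: power_mult[symmetric] 3)
    moreover have "1 - (1 + 1 + 1\<^sup>2) * y + (1 + 1\<^sup>2 + 1 ^ 3) * y\<^sup>2 - 1 ^ 3 * y ^ 3 = (1 - y) ^ 3" for y :: complex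
      by (simp add: algebra_simps power2_eq_square power3_eq_cube)
    ultimately show ?thesis unfolding split p by simp
  qed
  have f4: "1 - (q ^ 9) ^ Suc n = 1 - (q ^ 3) ^ Suc (Suc (Suc (3 * n)))"
  proof -
    have "9 * Suc n = 3 * Suc (Suc (Suc (3 * n)))" by simp
    thus ?thesis by (simp only: power_mult[symmetric])
  qed
  have "qpoch (3 * Suc n) q * qpoch (3 * Suc n) (w * q) * qpoch (3 * Suc n) (w\<^sup>2 * q) * qpoch (Suc n) (q ^ 9) =
     (qpoch (3 * n) q * qpoch (3 * n) (w * q) * qpoch (3 * n) (w\<^sup>2 * q) * qpoch n (q ^ 9)) *
     ((1 - q ^ Suc (3 * n)) * (1 - (w * q) ^ Suc (3 * n)) * (1 - (w\<^sup>2 * q) ^ Suc (3 * n))) *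
     ((1 - q ^ Suc (Suc (3 * n))) * (1 - (w * q) ^ Suc (Suc (3 * n))) * (1 - (w\<^sup>2 * q) ^ Suc (Suc (3 * n)))) *
     ((1 - q ^ Suc (Suc (Suc (3 * n)))) * (1 - (w * q) ^ Suc (Suc (Suc (3 * n)))) *
     (1 - (w\<^sup>2 * q) ^ Suc (Suc (Suc (3 * n))))) * (1 - (q ^ 9) ^ Suc n)"
    unfolding 3 qpoch_Suc by (simp only: mult_ac)
  also have "\<dots> = (qpoch (3 * n) (q ^ 3) * qpoch n (q ^ 3) ^ 3) * (1 - (q ^ 3) ^ Suc (3 * n)) *
     (1 - (q ^ 3) ^ Suc (Suc (3 * n))) * (1 - (q ^ 3) ^ Suc n) ^ 3 * (1 - (q ^ 3) ^ Suc (Suc (Suc (3 * n))))"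
    unfolding f1 f2 f3 f4 Suc.IH ..
  also have "\<dots> = qpoch (3 * Suc n) (q ^ 3) * qpoch (Suc n) (q ^ 3) ^ 3"
    unfolding 3 qpoch_Suc power_mult_distrib by (simp only: mult_ac)
  finally show ?case .
qed auto

lemma euler_prod_cube_roots:
  assumes q: "norm q < 1"
  defines "w \<equiv> cube_root"
  shows "euler_prod q * euler_prod (w * q) * euler_prod (w\<^sup>2 * q) * euler_prod (q ^ 9) = euler_prod (q ^ 3) ^ 4"
proof -
  have f: "filterlim (\<lambda>n::nat. 3 * n) at_top at_top"
    by (intro filterlim_subseq strict_monoI) simp
  have n: "norm (w * q) < 1" "norm (w\<^sup>2 * q) < 1" "norm (q ^ 9) < 1" "norm (q ^ 3) < 1"
    using q by (simp_all add: w_def norm_mult norm_power power_less_one_iff)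
  have "(\<lambda>n. qpoch (3 * n) q * qpoch (3 * n) (w * q) * qpoch (3 * n) (w\<^sup>2 * q) * qpoch n (q ^ 9)) \<longlonglongrightarrow>
     euler_prod q * euler_prod (w * q) * euler_prod (w\<^sup>2 * q) * euler_prod (q ^ 9)"
    by (intro tendsto_mult filterlim_compose[OF qpoch_LIMSEQ f] qpoch_LIMSEQ n q)
  moreover have "(\<lambda>n. qpoch (3 * n) (q ^ 3) * qpoch n (q ^ 3) ^ 3) \<longlonglongrightarrow> euler_prod (q ^ 3) * euler_prod (q ^ 3) ^ 3"
    by (intro tendsto_mult tendsto_power filterlim_compose[OF qpoch_LIMSEQ f] qpoch_LIMSEQ n)
  ultimately show ?thesis
    using qpoch_cube_roots[OF cube_root_rel] LIMSEQ_unique by (simp add: w_def eval_nat_numeral)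
qed

text \<open>The dissected series \<open>A\<close> depends only on q^3, so it is common to the three
  rotations of q, whose Euler cubes are A - 3 w^i q C. Their product is A^3 - 27 q^3 C^3, and by the
  product formula for the rotations it also equals a quotient of Euler products in q^3 and
  q^9.\<close>

theorem euler_prod_cubic_identity:
  assumes q: "norm q < 1"
  shows "euler_prod (q ^ 3) ^ 12 =
    euler_prod (q ^ 9) ^ 3 * ((euler_prod q ^ 3 + 3 * q * euler_prod (q ^ 9) ^ 3) ^ 3 - 27 * q ^ 3 * euler_prod (q ^ 9) ^ 9)"
proof -
  define w where "w = cube_root"
  define C where "C = euler_prod (q ^ 9) ^ 3"
  define A where "A = euler_prod q ^ 3 + 3 * q * C"
  have w: "w\<^sup>2 = - 1 - w" "w ^ 3 = 1"
    using cube_root_rel cube_root_of_unity_cubed by (auto simp: w_def)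
  have w6: "(w\<^sup>2) ^ 3 = 1"
    unfolding power_mult[symmetric] using w(2) power_mult[of w 3 2] by simp
  have A: "A = (\<Sum>m. jacobi_term q (3 * m) + jacobi_term q (3 * m + 2))"
    using jacobi_three_dissection[OF q, of 1] by (simp add: A_def C_def)
  have 0: "euler_prod q ^ 3 = A - 3 * q * C" by (simp add: A_def)
  have 1: "euler_prod (w * q) ^ 3 = A - 3 * (w * q) * C"
    using jacobi_three_dissection[OF q w(2)] unfolding A[symmetric] C_def by (simp add: algebra_simps)
  have 2: "euler_prod (w\<^sup>2 * q) ^ 3 = A - 3 * (w\<^sup>2 * q) * C"
    using jacobi_three_dissection[OF q w6] unfolding A[symmetric] C_def by (simp add: algebra_simps)
  have "euler_prod (q ^ 3) ^ 12 = (euler_prod (q ^ 3) ^ 4) ^ 3" by (simp flip: power_mult)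
  also have "\<dots> = euler_prod q ^ 3 * euler_prod (w * q) ^ 3 * euler_prod (w\<^sup>2 * q) ^ 3 * C"
    unfolding euler_prod_cube_roots[OF q, symmetric] by (simp add: C_def w_def power_mult_distrib)
  also have "\<dots> = (A ^ 3 - 3 * (1 + w + w\<^sup>2) * A\<^sup>2 * q * C + 9 * (w + w\<^sup>2 + w ^ 3) * A * (q * C)\<^sup>2 - 27 * w ^ 3 * q ^ 3 * C ^ 3) * C"
    unfolding 0 1 2 by (simp add: algebra_simps power2_eq_square power3_eq_cube)
  also have "\<dots> = (A ^ 3 - 27 * q ^ 3 * C ^ 3) * C" using w by simp
  finally show ?thesis by (simp add: A_def C_def mult_ac flip: power_mult)
qed

section \<open>The cubic theta functions on the unit interval\<close>

definition euler_real :: "real \<Rightarrow> real" where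
  "euler_real q = prodinf (\<lambda>n. 1 - q ^ Suc n)"

lemma euler_prod_of_real:
  assumes "0 \<le> q" "q < 1"
  shows "euler_prod (of_real q) = of_real (euler_real q)"
proof (rule LIMSEQ_unique)
  show "(\<lambda>n. qpoch n (complex_of_real q)) \<longlonglongrightarrow> euler_prod (of_real q)"
    using assms by (intro qpoch_LIMSEQ) auto
  have "convergent_prod (\<lambda>n. 1 - q ^ Suc n)"
    using assms by (intro convergent_prod_euler) auto
  hence "(\<lambda>n. \<Prod>k<n. 1 - q ^ Suc k) \<longlonglongrightarrow> euler_real q"
    unfolding euler_real_def using convergent_prod_LIMSEQ LIMSEQ_lessThan_iff_atMost by blast
  hence "(\<lambda>n. complex_of_real (\<Prod>k<n. 1 - q ^ Suc k)) \<longlonglongrightarrow> of_real (euler_real q)"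
    by (rule tendsto_of_real)
  thus "(\<lambda>n. qpoch n (complex_of_real q)) \<longlonglongrightarrow> of_real (euler_real q)"
    by (simp add: qpoch_def)
qed

text \<open>The lower bound is Weierstrass's inequality, a product of 1 - q^k being at least 1 minus
  the sum of the q^k; it provides the limit 1 at q = 0.\<close>

lemma euler_real_bounds:
  assumes "0 \<le> q" "q < 1"
  shows "0 < euler_real q" "euler_real q \<le> 1" "1 - q / (1 - q) \<le> euler_real q"
proof -
  have conv: "convergent_prod (\<lambda>n. 1 - q ^ Suc n)"
    using assms by (intro convergent_prod_euler) auto
  have fac: "0 < 1 - q ^ Suc n" "1 - q ^ Suc n \<le> 1" for n
    using assms power_Suc_less_one[of q n] by (cases "q = 0"; simp)+
  show "0 < euler_real q" unfolding euler_real_def by (intro less_0_prodinf conv fac)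
  have lim: "(\<lambda>n. \<Prod>k<n. 1 - q ^ Suc k) \<longlonglongrightarrow> euler_real q"
    unfolding euler_real_def using convergent_prod_LIMSEQ[OF conv] LIMSEQ_lessThan_iff_atMost by blast
  show "euler_real q \<le> 1"
    by (rule LIMSEQ_le_const2[OF lim]) (use fac in \<open>auto intro!: prod_le_1 simp: less_imp_le simp del: power_Suc\<close>)
  have part: "1 - (\<Sum>k<n. q ^ Suc k) \<le> (\<Prod>k<n. 1 - q ^ Suc k) \<and> (\<Prod>k<n. 1 - q ^ Suc k) \<le> 1" for n
  proof (induction n)
    case (Suc n)
    define P where "P = (\<Prod>k<n. 1 - q ^ Suc k)"
    have "P \<le> 1" "1 - (\<Sum>k<n. q ^ Suc k) \<le> P" using Suc by (auto simp: P_def)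
    moreover have "0 \<le> q ^ Suc n" using assms by simp
    moreover have "P \<ge> 0" unfolding P_def using fac by (intro prod_nonneg) (auto simp: less_imp_le simp del: power_Suc)
    ultimately have "P * q ^ Suc n \<le> q ^ Suc n" "P * q ^ Suc n \<ge> 0" by (auto intro: mult_left_le_one_le)
    thus ?case using \<open>P \<le> 1\<close> \<open>1 - (\<Sum>k<n. q ^ Suc k) \<le> P\<close>
      unfolding P_def[symmetric] prod.lessThan_Suc sum.lessThan_Suc by (simp add: algebra_simps del: power_Suc)
  qed auto
  have "(\<Sum>k<n. q ^ Suc k) \<le> q / (1 - q)" for n
  proof -
    have "(\<Sum>k<n. q ^ Suc k) = q * (\<Sum>k<n. q ^ k)" by (simp add: sum_distrib_left)
    also have "(\<Sum>k<n. q ^ k) \<le> 1 / (1 - q)"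
      using assms by (subst sum_gp_strict) (auto simp: divide_simps)
    finally show ?thesis using assms by (simp add: mult_left_mono)
  qed
  hence "1 - q / (1 - q) \<le> (\<Prod>k<n. 1 - q ^ Suc k)" for n using part[of n] by (smt (verit))
  thus "1 - q / (1 - q) \<le> euler_real q" by (intro LIMSEQ_le_const[OF lim]) auto
qed

lemma euler_real_tendsto_1: "(euler_real \<longlongrightarrow> 1) (at_right 0)"
proof (rule tendsto_sandwich)
  show "\<forall>\<^sub>F q in at_right 0. 1 - q / (1 - q) \<le> euler_real q" "\<forall>\<^sub>F q in at_right 0. euler_real q \<le> 1"
    unfolding eventually_at_right[OF zero_less_one] using euler_real_bounds by (auto intro!: exI[of _ 1])
  show "((\<lambda>q::real. 1 - q / (1 - q)) \<longlongrightarrow> 1) (at_right 0)"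
    by (rule tendsto_eq_intros refl | simp)+
qed auto

definition cubic_b :: "real \<Rightarrow> real" where "cubic_b q = euler_real q ^ 3 / euler_real (q ^ 3)"
definition cubic_c :: "real \<Rightarrow> real" where "cubic_c q = 3 * root 3 q * euler_real (q ^ 3) ^ 3 / euler_real q"
text \<open>Taking the real cube root, instead of the theta series of the hexagonal lattice, makes
  a^3 = b^3 + c^3 true by construction; the substance moves into the two linear relations for
  \<open>cubic_a\<close> at q and q^3.\<close>

definition cubic_a :: "real \<Rightarrow> real" where "cubic_a q = root 3 (cubic_b q ^ 3 + cubic_c q ^ 3)"

lemma cubic_pos:
  assumes "0 < q" "q < 1"
  shows "cubic_b q > 0" "cubic_c q > 0" "cubic_a q > 0"
proof -
  have "euler_real q > 0" "euler_real (q ^ 3) > 0"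
    using assms by (auto intro!: euler_real_bounds simp: power_less_one_iff)
  thus "cubic_b q > 0" "cubic_c q > 0" using assms by (simp_all add: cubic_b_def cubic_c_def)
  thus "cubic_a q > 0" by (simp add: cubic_a_def add_pos_pos)
qed

lemma cubic_a_cubed: "cubic_a q ^ 3 = cubic_b q ^ 3 + cubic_c q ^ 3"
  by (simp add: cubic_a_def odd_real_root_pow)

lemma cubic_a_eqI: "t ^ 3 = cubic_b q ^ 3 + cubic_c q ^ 3 \<Longrightarrow> cubic_a q = t"
  by (simp add: cubic_a_def odd_real_root_unique)

text \<open>Real cube roots are unique, so it suffices to compare cubes. With u = e1^3 and v = q
  e9^3 both comparisons reduce to the cubic identity for Euler products, by (u+3v)^3 - 27v^3 = u(u^2
  + 9uv + 27v^2) and u^3 + 27v(u^2 + 9uv + 27v^2) = (u+9v)^3.\<close>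

lemma
  assumes q: "0 < q" "q < 1"
  shows cubic_a_cube_arg: "cubic_a (q ^ 3) = cubic_b q + cubic_c (q ^ 3)"
    and cubic_a_eq: "cubic_a q = cubic_b q + 3 * cubic_c (q ^ 3)"
proof -
  have q3: "0 < q ^ 3" "q ^ 3 < 1" and q9: "0 < q ^ 9" "q ^ 9 < 1"
    using q by (simp_all add: power_less_one_iff)
  define e1 e3 e9 where "e1 = euler_real q" and "e3 = euler_real (q ^ 3)" and "e9 = euler_real (q ^ 9)"
  have pos: "e1 > 0" "e3 > 0" "e9 > 0"
    using q q3 q9 by (simp_all add: e1_def e3_def e9_def euler_real_bounds)
  have "complex_of_real (e3 ^ 12) = of_real (e9 ^ 3 * ((e1 ^ 3 + 3 * q * e9 ^ 3) ^ 3 - 27 * q ^ 3 * e9 ^ 9))"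
    using euler_prod_cubic_identity[of "of_real q"] q q3 q9
      euler_prod_of_real[of q] euler_prod_of_real[of "q ^ 3"] euler_prod_of_real[of "q ^ 9"]
    by (simp add: e1_def e3_def e9_def)
  hence id: "e3 ^ 12 = e9 ^ 3 * ((e1 ^ 3 + 3 * q * e9 ^ 3) ^ 3 - 27 * q ^ 3 * e9 ^ 9)"
    unfolding of_real_eq_iff .
  have q33: "(q ^ 3) ^ 3 = q ^ 9" by simp
  have r: "root 3 (q ^ 3) = q" using q by (simp add: real_root_power_cancel)
  have rq: "root 3 q ^ 3 = q" by (simp add: odd_real_root_pow)
  have b: "cubic_b q = e1 ^ 3 / e3" and b3: "cubic_b (q ^ 3) = e3 ^ 3 / e9"
    and c3: "cubic_c (q ^ 3) = 3 * q * e9 ^ 3 / e3"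
    unfolding cubic_b_def cubic_c_def q33 r by (simp_all add: e1_def e3_def e9_def)
  have "cubic_c q ^ 3 = 27 * q * e3 ^ 9 / e1 ^ 3"
    unfolding cubic_c_def by (simp add: rq power_divide power_mult_distrib e1_def e3_def)
  define u v where "u = e1 ^ 3" and "v = q * e9 ^ 3"
  have id2: "q * e3 ^ 12 = v * u * (u\<^sup>2 + 9 * u * v + 27 * v\<^sup>2)"
    unfolding id u_def v_def by (simp add: algebra_simps power2_eq_square eval_nat_numeral)
  show "cubic_a (q ^ 3) = cubic_b q + cubic_c (q ^ 3)"
  proof (rule cubic_a_eqI)
    define X where "X = (e1 ^ 3 + 3 * q * e9 ^ 3) ^ 3 - 27 * q ^ 3 * e9 ^ 9"
    have "e3 ^ 9 * e3 ^ 3 = e9 ^ 3 * X"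
      unfolding X_def id[symmetric] by (simp flip: power_add)
    hence "e3 ^ 9 / e9 ^ 3 = X / e3 ^ 3"
      using pos by (simp add: divide_simps mult_ac)
    hence "e3 ^ 9 / e9 ^ 3 = ((e1 ^ 3 + 3 * q * e9 ^ 3) ^ 3 - 27 * q ^ 3 * e9 ^ 9) / e3 ^ 3"
      unfolding X_def .
    thus "(cubic_b q + cubic_c (q ^ 3)) ^ 3 = cubic_b (q ^ 3) ^ 3 + cubic_c (q ^ 3) ^ 3"
      using pos unfolding b b3 c3 by (simp add: power_divide power_mult_distrib diff_divide_distrib flip: power_mult add_divide_distrib)
  qed
  show "cubic_a q = cubic_b q + 3 * cubic_c (q ^ 3)"
  proof (rule cubic_a_eqI)
    have "cubic_c q ^ 3 = 27 * (q * e3 ^ 12) / (u * e3 ^ 3)"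
      unfolding \<open>cubic_c q ^ 3 = _\<close> u_def using pos by (simp add: divide_simps flip: power_add)
    also have "\<dots> = 27 * v * (u\<^sup>2 + 9 * u * v + 27 * v\<^sup>2) / e3 ^ 3"
      unfolding id2 using pos by (simp add: u_def)
    finally have "cubic_b q ^ 3 + cubic_c q ^ 3 = (u ^ 3 + 27 * v * (u\<^sup>2 + 9 * u * v + 27 * v\<^sup>2)) / e3 ^ 3"
      unfolding b by (simp add: u_def power_divide add_divide_distrib)
    also have "u ^ 3 + 27 * v * (u\<^sup>2 + 9 * u * v + 27 * v\<^sup>2) = (u + 9 * v) ^ 3"
      by (simp add: algebra_simps power2_eq_square power3_eq_cube)
    finally show "(cubic_b q + 3 * cubic_c (q ^ 3)) ^ 3 = cubic_b q ^ 3 + cubic_c q ^ 3"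
      unfolding b c3 by (simp add: u_def v_def mult_ac power_divide flip: add_divide_distrib)
  qed
qed

text \<open>The link to the eta functions: in eta^2 at q times eta^2 at q^3 the prefactors combine
  to q^(2/24 + 6/24) = q^(1/3).\<close>

lemma cubic_b_times_c: "0 < q \<Longrightarrow> q < 1 \<Longrightarrow>
    cubic_b q * cubic_c q = 3 * root 3 q * euler_real q ^ 2 * euler_real (q ^ 3) ^ 2"
  using euler_real_bounds(1)[of q] euler_real_bounds(1)[of "q ^ 3"]
  by (simp add: cubic_b_def cubic_c_def field_simps power_less_one_iff eval_nat_numeral)

section \<open>The hypergeometric function with parameters 1/3, 2/3; 1\<close>

definition hyp_coeff :: "nat \<Rightarrow> real" where
  "hyp_coeff n = pochhammer (1/3) n * pochhammer (2/3) n / (fact n)\<^sup>2"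

definition hyp :: "real \<Rightarrow> real" where "hyp x = (\<Sum>n. hyp_coeff n * x ^ n)"
definition hyp_deriv :: "real \<Rightarrow> real" where "hyp_deriv x = (\<Sum>n. diffs hyp_coeff n * x ^ n)"

lemma hyp_coeff_0 [simp]: "hyp_coeff 0 = 1"
  and hyp_coeff_Suc: "hyp_coeff (Suc n) = hyp_coeff n * ((real n + 1/3) * (real n + 2/3) / (real n + 1)\<^sup>2)"
  by (simp_all add: hyp_coeff_def pochhammer_Suc power2_eq_square mult_ac add_ac)

lemma hyp_coeff_pos: "hyp_coeff n > 0"
  by (simp add: hyp_coeff_def pochhammer_pos)

lemma hyp_coeff_le_1: "hyp_coeff n \<le> 1"
proof (induction n)
  case (Suc n)
  have "(real n + 1/3) * (real n + 2/3) / (real n + 1)\<^sup>2 \<le> 1"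
    by (simp add: divide_le_eq_1 power2_eq_square mult_mono)
  with Suc hyp_coeff_pos[of n] show ?case
    unfolding hyp_coeff_Suc by (intro mult_le_one) (auto simp: less_imp_le)
qed simp

lemma hyp_summable:
  assumes "\<bar>x\<bar> < 1" shows "summable (\<lambda>n. hyp_coeff n * x ^ n)"
proof (rule summable_comparison_test')
  show "summable (\<lambda>n. \<bar>x\<bar> ^ n)" using assms by (intro summable_geometric) auto
  show "norm (hyp_coeff n * x ^ n) \<le> \<bar>x\<bar> ^ n" for n
    using hyp_coeff_le_1[of n] hyp_coeff_pos[of n]
    by (simp add: abs_mult power_abs mult_left_le_one_le)
qed

lemma hyp_0 [simp]: "hyp 0 = 1"
  by (simp add: hyp_def)

lemma hyp_has_derivative:
  assumes "\<bar>x\<bar> < 1" shows "(hyp has_field_derivative hyp_deriv x) (at x)"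
  unfolding hyp_def[abs_def] hyp_deriv_def using assms
  by (intro termdiffs_strong'[of 1]) (auto intro: hyp_summable)

lemma hyp_deriv_summable:
  assumes "\<bar>x\<bar> < 1" shows "summable (\<lambda>n. diffs hyp_coeff n * x ^ n)"
  using assms by (intro termdiff_converges[of x 1]) (auto intro: hyp_summable)

lemma hyp_bounds:
  assumes "0 \<le> x" "x < 1" shows "1 \<le> hyp x" "hyp x \<le> 1 / (1 - x)" "0 \<le> hyp_deriv x"
proof -
  have sm: "summable (\<lambda>n. hyp_coeff n * x ^ n)" using assms by (intro hyp_summable) auto
  have "(\<Sum>n<1. hyp_coeff n * x ^ n) \<le> hyp x"
    unfolding hyp_def using assms hyp_coeff_pos by (intro sum_le_suminf sm) (auto simp: less_imp_le)
  thus "1 \<le> hyp x" by simp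
  have "hyp x \<le> (\<Sum>n. x ^ n)" unfolding hyp_def using assms hyp_coeff_le_1 hyp_coeff_pos
    by (intro suminf_le sm summable_geometric mult_left_le_one_le) (auto simp: less_imp_le)
  thus "hyp x \<le> 1 / (1 - x)" using assms by (simp add: suminf_geometric)
  show "0 \<le> hyp_deriv x" unfolding hyp_deriv_def using assms hyp_coeff_pos
    by (intro suminf_nonneg hyp_deriv_summable) (auto simp: diffs_def less_imp_le)
qed

text \<open>The hypergeometric equation for \<open>F = hyp\<close> is \<open>(x(1-x)F')' = (2/9) F\<close>.\<close>
definition hyp_flux_coeff :: "nat \<Rightarrow> real" where
  "hyp_flux_coeff n = (case n of 0 \<Rightarrow> 0 | Suc m \<Rightarrow> 2 / 9 * hyp_coeff m / real (Suc m))"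

definition hyp_flux :: "real \<Rightarrow> real" where "hyp_flux x = x * (1 - x) * hyp_deriv x"

lemma hyp_flux_sums:
  assumes "\<bar>x\<bar> < 1" shows "(\<lambda>n. hyp_flux_coeff n * x ^ n) sums hyp_flux x"
proof -
  let ?d = "\<lambda>n. diffs hyp_coeff n * x ^ n"
  have s: "?d sums hyp_deriv x"
    unfolding hyp_deriv_def using hyp_deriv_summable[OF assms] by (rule summable_sums)
  have s1: "(\<lambda>n. case n of 0 \<Rightarrow> 0 | Suc m \<Rightarrow> x * ?d m) sums (x * hyp_deriv x)"
    by (subst sums_Suc_iff[where f = "\<lambda>n. case n of 0 \<Rightarrow> 0 | Suc m \<Rightarrow> x * ?d m", simplified, symmetric]) (intro sums_mult s)
  have s2: "(\<lambda>n. case n of 0 \<Rightarrow> 0 | Suc m \<Rightarrow> x * (case m of 0 \<Rightarrow> 0 | Suc m \<Rightarrow> x * ?d m)) sums (x * (x * hyp_deriv x))"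
    by (subst sums_Suc_iff[where f = "\<lambda>n. case n of 0 \<Rightarrow> 0 | Suc m \<Rightarrow> x * (case m of 0 \<Rightarrow> 0 | Suc m \<Rightarrow> x * ?d m)", simplified, symmetric]) (intro sums_mult s1)
  have "hyp_flux_coeff n * x ^ n = (case n of 0 \<Rightarrow> 0 | Suc m \<Rightarrow> x * ?d m) -
      (case n of 0 \<Rightarrow> 0 | Suc m \<Rightarrow> x * (case m of 0 \<Rightarrow> 0 | Suc m \<Rightarrow> x * ?d m))" for n
  proof -
    \<comment> \<open>The hypergeometric equation coefficientwise: (m+1)^2 c(m+1) = (m^2 + m + 2/9)
      c(m), divided by m+1.\<close>
    have main: "2 / 9 * hyp_coeff m / real (Suc m) = real (Suc m) * hyp_coeff (Suc m) - real m * hyp_coeff m" for m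
      unfolding hyp_coeff_Suc by (simp add: divide_simps power2_eq_square) (simp add: algebra_simps)
    show ?thesis
    proof (cases n)
      case (Suc m)
      show ?thesis unfolding Suc hyp_flux_coeff_def nat.case main
        by (cases m) (simp_all add: diffs_def algebra_simps)
    qed (simp add: hyp_flux_coeff_def)
  qed
  moreover have "hyp_flux x = x * hyp_deriv x - x * (x * hyp_deriv x)"
    by (simp add: hyp_flux_def algebra_simps)
  ultimately show ?thesis using sums_diff[OF s1 s2] by simp
qed

lemma hyp_flux_has_derivative:
  assumes "\<bar>x\<bar> < 1" shows "(hyp_flux has_field_derivative (2 / 9 * hyp x)) (at x)"
proof -
  have eq: "(\<Sum>n. diffs hyp_flux_coeff n * x ^ n) = 2 / 9 * hyp x"
    unfolding hyp_def suminf_mult[OF hyp_summable[OF assms], symmetric]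
    by (intro suminf_cong) (simp add: diffs_def hyp_flux_coeff_def mult_ac del: of_nat_Suc)
  have "((\<lambda>x. \<Sum>n. hyp_flux_coeff n * x ^ n) has_field_derivative (\<Sum>n. diffs hyp_flux_coeff n * x ^ n)) (at x)"
    using assms by (intro termdiffs_strong'[of 1]) (auto intro: sums_summable hyp_flux_sums)
  moreover have "\<forall>\<^sub>F y in nhds x. (\<Sum>n. hyp_flux_coeff n * y ^ n) = hyp_flux y"
  proof -
    have "\<forall>\<^sub>F y in nhds x. y \<in> {-1<..<1}" using assms by (intro eventually_nhds_in_open) auto
    thus ?thesis by eventually_elim (use hyp_flux_sums in \<open>auto simp: sums_iff\<close>)
  qed
  ultimately show ?thesis unfolding eq by (subst (asm) DERIV_cong_ev) auto
qed

section \<open>The cubic transformation\<close>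

lemma hyp_const_on_unit_interval:
  fixes f :: "real \<Rightarrow> real"
  assumes cont: "continuous_on {0..<1} f"
    and der: "\<And>x. 0 < x \<Longrightarrow> x < 1 \<Longrightarrow> (f has_field_derivative 0) (at x)"
    and x: "0 \<le> x" "x < 1"
  shows "f x = f 0"
proof (cases "x = 0")
  case False
  show ?thesis
    using x False by (intro DERIV_isconst2[of 0 x f x] continuous_on_subset[OF cont] der) auto
qed auto

lemma hyp_isCont [continuous_intros]:
  assumes "isCont f x" "\<bar>f x\<bar> < 1" shows "isCont (\<lambda>x. hyp (f x)) x"
  using assms DERIV_isCont[OF hyp_has_derivative] isCont_o2 by blast

lemma hyp_flux_isCont [continuous_intros]:
  assumes "isCont f x" "\<bar>f x\<bar> < 1" shows "isCont (\<lambda>x. hyp_flux (f x)) x"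
  using assms DERIV_isCont[OF hyp_flux_has_derivative] isCont_o2 by blast

text \<open>Both sides, \<open>y2\<close> and \<open>y1\<close>, solve the self-adjoint equation (p
  y')' = (2/9) \<phi>' y on (0,1). Hence the Wronskian \<open>y1 * P2 - y2 * P1\<close>, with P = p
  y', is constant; it vanishes at 0, so \<open>y2 / y1\<close> is constant, with value 1 at 0.
  Writing \<open>P1\<close> and \<open>P2\<close> through \<open>hyp_flux\<close> makes them
  continuous up to 0.\<close>

theorem hyp_cubic_transformation:
  assumes s: "0 \<le> s" "s < 1"
  shows "hyp (1 - ((1 - s) / (1 + 2 * s)) ^ 3) = (1 + 2 * s) * hyp (s ^ 3)"
proof -
  define \<phi> where "\<phi> = (\<lambda>s::real. 1 - ((1 - s) / (1 + 2 * s)) ^ 3)"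
  define \<phi>' where "\<phi>' = (\<lambda>s::real. 9 * (1 - s)\<^sup>2 / (1 + 2 * s) ^ 4)"
  define y1 where "y1 = (\<lambda>s. (1 + 2 * s) * hyp (s ^ 3))"
  define y1' where "y1' = (\<lambda>s. 2 * hyp (s ^ 3) + (1 + 2 * s) * (hyp_deriv (s ^ 3) * (3 * s\<^sup>2)))"
  define y2 where "y2 = (\<lambda>s. hyp (\<phi> s))"
  define y2' where "y2' = (\<lambda>s. hyp_deriv (\<phi> s) * \<phi>' s)"
  \<comment> \<open>Chosen so that \<phi>(1 - \<phi>) = p \<phi>'; then p y2' is the flux evaluated
    at \<phi>.\<close>
  define p where "p = (\<lambda>s::real. s * (1 - s ^ 3) / (1 + 2 * s)\<^sup>2)"
  define P1 where "P1 = (\<lambda>s. 3 * hyp_flux (s ^ 3) / (1 + 2 * s) + 2 * s * (1 - s ^ 3) / (1 + 2 * s)\<^sup>2 * hyp (s ^ 3))"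
  define P2 where "P2 = (\<lambda>s. hyp_flux (\<phi> s))"
  have \<phi>_range: "0 \<le> \<phi> t" "\<phi> t < 1" if "0 \<le> t" "t < 1" for t
  proof -
    have "0 < (1 - t) / (1 + 2 * t)" "(1 - t) / (1 + 2 * t) \<le> 1" using that by (auto simp: divide_simps)
    thus "0 \<le> \<phi> t" "\<phi> t < 1" by (auto simp: \<phi>_def power_le_one)
  qed
  have cube_range: "\<bar>t ^ 3\<bar> < 1" if "0 \<le> t" "t < 1" for t :: real
    using that by (simp add: power_abs power_less_one_iff)
  have \<phi>_eq: "\<phi> t = 9 * t * (1 + t + t\<^sup>2) / (1 + 2 * t) ^ 3" if "0 \<le> t" for t
  proof -
    have "1 - (1 - t) ^ 3 / (1 + 2 * t) ^ 3 = ((1 + 2 * t) ^ 3 - (1 - t) ^ 3) / (1 + 2 * t) ^ 3"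
      using that by (simp add: diff_divide_distrib)
    also have "(1 + 2 * t) ^ 3 - (1 - t) ^ 3 = 9 * t * (1 + t + t\<^sup>2)"
      by (simp add: algebra_simps power2_eq_square power3_eq_cube)
    finally show ?thesis by (simp add: \<phi>_def power_divide)
  qed
  have d\<phi>: "(\<phi> has_field_derivative \<phi>' t) (at t)" if "0 < t" "t < 1" for t
  proof -
    have "((\<lambda>s. (1 - s) / (1 + 2 * s)) has_field_derivative (- 3 / (1 + 2 * t)\<^sup>2)) (at t)"
      using that by (auto intro!: derivative_eq_intros simp: power2_eq_square divide_simps algebra_simps)
    hence "(\<phi> has_field_derivative (- (3 * ((1 - t) / (1 + 2 * t))\<^sup>2 * (- 3 / (1 + 2 * t)\<^sup>2)))) (at t)"
      unfolding \<phi>_def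
      by (rule DERIV_cong[OF DERIV_diff[OF DERIV_const DERIV_power]]) (simp add: mult_ac)
    also have "- (3 * ((1 - t) / (1 + 2 * t))\<^sup>2 * (- 3 / (1 + 2 * t)\<^sup>2)) = \<phi>' t"
      by (simp add: \<phi>'_def power_divide flip: power_add)
    finally show ?thesis .
  qed
  have dy1: "(y1 has_field_derivative y1' t) (at t)" if "0 < t" "t < 1" for t
    unfolding y1_def y1'_def using that cube_range
    by (auto intro!: derivative_eq_intros DERIV_chain2[OF hyp_has_derivative])
  have dy2: "(y2 has_field_derivative y2' t) (at t)" if "0 < t" "t < 1" for t
    unfolding y2_def y2'_def using that \<phi>_range[of t]
    by (intro DERIV_chain2[OF hyp_has_derivative] d\<phi>) auto
  have dP2: "(P2 has_field_derivative (2 / 9 * \<phi>' t * y2 t)) (at t)" if "0 < t" "t < 1" for t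
    unfolding P2_def y2_def using that \<phi>_range[of t]
    by (intro DERIV_cong[OF DERIV_chain2[OF hyp_flux_has_derivative d\<phi>[OF that]]]) (auto simp: abs_less_iff)
  have P2: "P2 t = p t * y2' t" if "0 < t" "t < 1" for t
  proof -
    have "\<phi> t * (1 - \<phi> t) = p t * \<phi>' t"
    proof -
      have "1 - \<phi> t = (1 - t) ^ 3 / (1 + 2 * t) ^ 3" by (simp add: \<phi>_def power_divide)
      moreover have "9 * t * (1 + t + t\<^sup>2) * (1 - t) ^ 3 = 9 * (t * (1 - t ^ 3)) * (1 - t)\<^sup>2"
        by (simp add: algebra_simps power2_eq_square power3_eq_cube)
      moreover have "(1 + 2 * t) ^ 3 * (1 + 2 * t) ^ 3 = (1 + 2 * t)\<^sup>2 * (1 + 2 * t) ^ 4"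
        by (simp flip: power_add)
      ultimately show ?thesis using that by (simp add: \<phi>_eq p_def \<phi>'_def)
    qed
    thus ?thesis by (simp add: P2_def hyp_flux_def y2'_def)
  qed
  have P1: "P1 t = p t * y1' t" if "0 < t" "t < 1" for t
    using that unfolding P1_def hyp_flux_def p_def y1'_def
    by (simp add: divide_simps) (simp add: algebra_simps power2_eq_square eval_nat_numeral)
  \<comment> \<open>This is where the special cubic substitution enters: (1+2s) hyp(s^3) satisfies
    the pulled-back equation, because the terms with the derivative of hyp cancel.\<close>
  have dP1: "(P1 has_field_derivative (2 / 9 * \<phi>' t * y1 t)) (at t)" if "0 < t" "t < 1" for t
  proof -
    define v v' where "v = hyp (t ^ 3)" and "v' = hyp_deriv (t ^ 3)"
    have "(P1 has_field_derivative
       (3 * (2 / 9 * v * (3 * t\<^sup>2)) / (1 + 2 * t) - 6 * (t ^ 3 * (1 - t ^ 3) * v') / (1 + 2 * t)\<^sup>2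
        + (2 * (1 - 4 * t ^ 3) / (1 + 2 * t)\<^sup>2 - 8 * t * (1 - t ^ 3) / (1 + 2 * t) ^ 3) * v
        + 2 * t * (1 - t ^ 3) / (1 + 2 * t)\<^sup>2 * (v' * (3 * t\<^sup>2)))) (at t)"
      unfolding P1_def using that cube_range[of t]
      apply (auto intro!: derivative_eq_intros DERIV_chain2[OF hyp_flux_has_derivative] DERIV_chain2[OF hyp_has_derivative])
      apply (simp add: v_def v'_def hyp_flux_def divide_simps)
      apply (simp add: algebra_simps power2_eq_square eval_nat_numeral)
      done
    also have "(3 * (2 / 9 * v * (3 * t\<^sup>2)) / (1 + 2 * t) - 6 * (t ^ 3 * (1 - t ^ 3) * v') / (1 + 2 * t)\<^sup>2
        + (2 * (1 - 4 * t ^ 3) / (1 + 2 * t)\<^sup>2 - 8 * t * (1 - t ^ 3) / (1 + 2 * t) ^ 3) * v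
        + 2 * t * (1 - t ^ 3) / (1 + 2 * t)\<^sup>2 * (v' * (3 * t\<^sup>2))) = 2 / 9 * \<phi>' t * y1 t"
      using that unfolding \<phi>'_def y1_def v_def[symmetric]
      by (simp add: divide_simps) (simp add: algebra_simps power2_eq_square eval_nat_numeral)
    finally show ?thesis .
  qed
  have cont: "continuous_on {0..<1} y1" "continuous_on {0..<1} y2" "continuous_on {0..<1} P1" "continuous_on {0..<1} P2"
  proof -
    have c\<phi>: "isCont \<phi> t" if "0 \<le> t" "t < 1" for t
      unfolding \<phi>_def using that by (intro continuous_intros) auto
    show "continuous_on {0..<1} y1" "continuous_on {0..<1} y2" "continuous_on {0..<1} P1" "continuous_on {0..<1} P2"
      unfolding y1_def y2_def P1_def P2_def using cube_range \<phi>_range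
      by (auto intro!: continuous_at_imp_continuous_on continuous_intros c\<phi> simp: abs_less_iff)
  qed
  have pos: "y1 t > 0" if "0 \<le> t" "t < 1" for t
    using that hyp_bounds(1)[of "t ^ 3"] by (simp add: y1_def power_less_one_iff)
  have W: "y1 t * P2 t - y2 t * P1 t = 0" if "0 \<le> t" "t < 1" for t
  proof -
    have "y1 t * P2 t - y2 t * P1 t = y1 0 * P2 0 - y2 0 * P1 0"
    proof (rule hyp_const_on_unit_interval[of "\<lambda>t. y1 t * P2 t - y2 t * P1 t"])
      show "continuous_on {0..<1} (\<lambda>t. y1 t * P2 t - y2 t * P1 t)"
        by (intro continuous_intros cont)
      fix x :: real assume x: "0 < x" "x < 1"
      show "((\<lambda>t. y1 t * P2 t - y2 t * P1 t) has_field_derivative 0) (at x)"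
        using x by (auto intro!: derivative_eq_intros dy1 dy2 dP1 dP2 simp: P1 P2 algebra_simps)
    qed (use that in auto)
    also have "\<dots> = 0" by (simp add: P1_def P2_def \<phi>_def hyp_flux_def)
    finally show ?thesis .
  qed
  have "y2 s / y1 s = y2 0 / y1 0"
  proof (rule hyp_const_on_unit_interval[of "\<lambda>t. y2 t / y1 t"])
    show "continuous_on {0..<1} (\<lambda>t. y2 t / y1 t)"
      using pos by (intro continuous_intros cont) (auto simp: less_imp_neq[symmetric])
    fix t :: real assume t: "0 < t" "t < 1"
    have "p t > 0" using t by (simp add: p_def power_less_one_iff)
    moreover have "p t * (y1 t * y2' t - y2 t * y1' t) = 0"
      using W[of t] t by (simp add: P1 P2 algebra_simps)
    ultimately have "y2' t * y1 t - y2 t * y1' t = 0" by (simp add: mult.commute)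
    moreover have "((\<lambda>t. y2 t / y1 t) has_field_derivative ((y2' t * y1 t - y2 t * y1' t) / (y1 t * y1 t))) (at t)"
      using t pos[of t] by (intro DERIV_divide dy1 dy2) auto
    ultimately show "((\<lambda>t. y2 t / y1 t) has_field_derivative 0) (at t)" by simp
  qed (use s in auto)
  also have "\<dots> = 1" by (simp add: y1_def y2_def \<phi>_def)
  finally show ?thesis using pos[OF s] by (simp add: y1_def y2_def \<phi>_def)
qed

section \<open>The singularity at 1 and the Legendre relation\<close>

definition hyp_const :: real where "hyp_const = sqrt 3 / (2 * pi)"

lemma hyp_const_pos: "hyp_const > 0"
  by (simp add: hyp_const_def)

lemma rGamma_thirds: "rGamma (1/3) * rGamma (2/3 :: real) = hyp_const"
proof -
  have "complex_of_real (rGamma (1/3) * rGamma (2/3)) = rGamma (1/3) * rGamma (1 - 1/3)"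
    by (simp add: rGamma_complex_of_real[symmetric])
  also have "\<dots> = sin (of_real pi * (1/3)) / of_real pi"
    by (rule rGamma_reflection_complex)
  also have "\<dots> = of_real (sin (pi / 3) / pi)"
    by (simp add: sin_of_real[symmetric])
  finally show ?thesis unfolding of_real_eq_iff by (simp add: hyp_const_def sin_60)
qed

text \<open>Gauss's limit for 1/Gamma at 1/3 and 2/3: the powers n^(1/3) and n^(2/3) combine to a
  single n, which is why the singularity at 1 is logarithmic.\<close>

lemma hyp_coeff_asymp: "(\<lambda>n. real n * hyp_coeff n) \<longlonglongrightarrow> hyp_const"
proof -
  have "(\<lambda>n. rGamma_series (1/3) n * rGamma_series (2/3) n * ((real n / (real n + 1/3)) * (real n / (real n + 2/3)))) \<longlonglongrightarrow>
      rGamma (1/3) * rGamma (2/3) * (1 * 1)"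
  proof (intro tendsto_mult rGamma_series_LIMSEQ)
    have "(\<lambda>n. 1 / (1 + c / real n)) \<longlonglongrightarrow> 1 / (1 + 0)" for c
      by (intro tendsto_intros) (auto intro: lim_const_over_n)
    moreover have "\<forall>\<^sub>F n in sequentially. 1 / (1 + c / real n) = real n / (real n + c)" for c
      using eventually_gt_at_top[of 0] by eventually_elim (simp add: divide_simps)
    ultimately show "(\<lambda>n. real n / (real n + 1/3)) \<longlonglongrightarrow> 1" "(\<lambda>n. real n / (real n + 2/3)) \<longlonglongrightarrow> 1"
      by (auto intro: Lim_transform_eventually)
  qed
  moreover have "\<forall>\<^sub>F n in sequentially. rGamma_series (1/3) n * rGamma_series (2/3) n * ((real n / (real n + 1/3)) * (real n / (real n + 2/3))) = real n * hyp_coeff n"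
    using eventually_gt_at_top[of 0]
  proof eventually_elim
    case (elim n)
    have e: "exp (1/3 * ln (real n)) * exp (2/3 * ln (real n)) = real n"
      using elim by (simp flip: exp_add)
    have p: "pochhammer (1/3) (n + 1) = pochhammer (1/3) n * (real n + 1/3)"
        "pochhammer (2/3) (n + 1) = pochhammer (2/3) n * (real n + 2/3)"
      by (simp_all add: pochhammer_Suc add.commute)
    have "rGamma_series (1/3) n * rGamma_series (2/3) n =
        (pochhammer (1/3) n * pochhammer (2/3) n / (fact n)\<^sup>2) * ((real n + 1/3) * (real n + 2/3)) / (exp (1/3 * ln (real n)) * exp (2/3 * ln (real n)))"
      unfolding rGamma_series_def p by (simp add: power2_eq_square mult_ac)
    also have "\<dots> = hyp_coeff n * ((real n + 1/3) * (real n + 2/3)) / real n"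
      unfolding e hyp_coeff_def ..
    finally have *: "rGamma_series (1/3) n * rGamma_series (2/3) n = hyp_coeff n * ((real n + 1/3) * (real n + 2/3)) / real n" .
    have "(real n + 1/3) \<noteq> 0" "(real n + 2/3) \<noteq> 0" by linarith+
    thus ?case unfolding * using elim by (simp del: of_nat_Suc add: divide_simps)
  qed
  ultimately show ?thesis unfolding rGamma_thirds using Lim_transform_eventually by force
qed

text \<open>The coefficients telescope to the partial sums n c(n), so the flux at 1 is the limit of
  n c(n).\<close>

lemma hyp_flux_coeff_sums: "hyp_flux_coeff sums hyp_const"
proof -
  have part: "(\<Sum>k<Suc n. hyp_flux_coeff k) = real n * hyp_coeff n" for n
  proof (induction n)
    case (Suc n)
    have "2 / 9 * hyp_coeff n / real (Suc n) = real (Suc n) * hyp_coeff (Suc n) - real n * hyp_coeff n"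
      unfolding hyp_coeff_Suc by (simp add: divide_simps power2_eq_square) (simp add: algebra_simps)
    thus ?case unfolding sum.lessThan_Suc[of _ "Suc n"] Suc.IH by (simp add: hyp_flux_coeff_def)
  qed (simp add: hyp_flux_coeff_def)
  show ?thesis unfolding sums_def
    by (subst filterlim_sequentially_Suc[symmetric]) (simp only: part hyp_coeff_asymp)
qed

lemma hyp_flux_coeff_nonneg: "hyp_flux_coeff n \<ge> 0"
  using hyp_coeff_pos by (cases n) (auto simp: hyp_flux_coeff_def less_imp_le)

text \<open>The flux series has nonnegative coefficients and no constant term, so x^n <= x compares
  it with x times its sum at 1.\<close>

lemma hyp_flux_bounds:
  assumes "0 \<le> x" "x < 1" shows "0 \<le> hyp_flux x" "hyp_flux x \<le> hyp_const * x"
proof -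
  have s: "(\<lambda>n. hyp_flux_coeff n * x ^ n) sums hyp_flux x" using assms by (intro hyp_flux_sums) auto
  show "0 \<le> hyp_flux x" using assms by (simp add: hyp_flux_def hyp_bounds(3))
  have "hyp_flux_coeff n * x ^ n \<le> hyp_flux_coeff n * x" for n
  proof (cases n)
    case (Suc m)
    have "x ^ n \<le> x" using assms by (simp add: Suc mult_left_le power_le_one)
    thus ?thesis using hyp_flux_coeff_nonneg by (intro mult_left_mono)
  qed (simp add: hyp_flux_coeff_def)
  thus "hyp_flux x \<le> hyp_const * x" by (intro sums_le[OF _ s sums_mult2[OF hyp_flux_coeff_sums]])
qed

lemma hyp_flux_at_left_1: "(hyp_flux \<longlongrightarrow> hyp_const) (at_left 1)"
proof -
  have ev: "\<forall>\<^sub>F x in at_left 1. 0 < x \<and> x < (1::real)"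
    unfolding eventually_at_left[OF zero_less_one] by (intro exI[of _ 0]) auto
  have "((\<lambda>x. \<Sum>k. hyp_flux_coeff k * x ^ k) \<longlongrightarrow> (\<Sum>k. hyp_flux_coeff k * 1 ^ k)) (at_left 1)"
  proof (intro tannerys_theorem[THEN conjunct2, THEN conjunct2])
    show "((\<lambda>x. hyp_flux_coeff k * x ^ k) \<longlongrightarrow> hyp_flux_coeff k * 1 ^ k) (at_left 1)" for k
      by (intro tendsto_intros)
    show "summable hyp_flux_coeff" using hyp_flux_coeff_sums by (rule sums_summable)
    have "\<forall>\<^sub>F (k::nat, x) in at_top \<times>\<^sub>F at_left 1. 0 < x \<and> x < (1::real)"
      using ev by (subst eventually_prod2) auto
    thus "\<forall>\<^sub>F (k, x) in at_top \<times>\<^sub>F at_left 1. norm (hyp_flux_coeff k * x ^ k) \<le> hyp_flux_coeff k"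
      by (rule eventually_mono) (auto simp: abs_mult hyp_flux_coeff_nonneg power_abs intro!: mult_right_le_one_le power_le_one)
  qed auto
  also have "(\<Sum>k. hyp_flux_coeff k * 1 ^ k) = hyp_const" using hyp_flux_coeff_sums by (simp add: sums_iff)
  finally show ?thesis
  proof (rule Lim_transform_eventually)
    show "\<forall>\<^sub>F x in at_left 1. (\<Sum>k. hyp_flux_coeff k * x ^ k) = hyp_flux x"
      using ev by eventually_elim (use hyp_flux_sums in \<open>auto simp: sums_iff\<close>)
  qed
qed

text \<open>The flux bound gives F'(y) <= \<open>hyp_const\<close> / (1-y), hence at most
  logarithmic growth at 1; this makes the product of F(1-x) with the flux at x vanish as x tends to
  0.\<close>

lemma hyp_log_bound:
  assumes "0 < x" "x \<le> 1 / 2"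
  shows "hyp (1 - x) \<le> hyp (1 / 2) - 2 * hyp_const * ln x"
proof -
  define f where "f = (\<lambda>y. hyp y + 2 * hyp_const * ln (1 - y))"
  have "f (1 - x) \<le> f (1 / 2)"
  proof (rule DERIV_nonpos_imp_nonincreasing[of "1 / 2" "1 - x" f])
    fix y assume y: "1 / 2 \<le> y" "y \<le> 1 - x"
    have "(f has_field_derivative (hyp_deriv y - 2 * hyp_const / (1 - y))) (at y)"
      unfolding f_def using y assms by (auto intro!: derivative_eq_intros hyp_has_derivative simp: abs_less_iff divide_simps)
    moreover have "hyp_deriv y \<le> 2 * hyp_const / (1 - y)"
    proof -
      have "y * (1 - y) * hyp_deriv y \<le> hyp_const * y"
        using hyp_flux_bounds(2)[of y] y assms by (simp add: hyp_flux_def)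
      hence "(1 - y) * hyp_deriv y \<le> hyp_const" using y by (simp add: mult.assoc mult.commute[of _ y])
      also have "\<dots> \<le> 2 * hyp_const" using hyp_const_pos by simp
      finally show ?thesis using y assms by (simp add: field_simps)
    qed
    ultimately show "\<exists>D. (f has_field_derivative D) (at y) \<and> D \<le> 0" by force
  qed (use assms in auto)
  moreover have "2 * hyp_const * ln (1 / 2) \<le> 0" using hyp_const_pos by (simp add: ln_div)
  ultimately show ?thesis by (simp add: f_def)
qed

lemma hyp_reflected_flux_at_right_0: "((\<lambda>x. hyp (1 - x) * hyp_flux x) \<longlongrightarrow> 0) (at_right 0)"
proof (rule tendsto_sandwich)
  have ev: "\<forall>\<^sub>F x in at_right 0. 0 < x \<and> x \<le> (1/2::real)"
    unfolding eventually_at_right[OF zero_less_one] by (intro exI[of _ "1/2"]) auto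
  show "\<forall>\<^sub>F x in at_right 0. 0 \<le> hyp (1 - x) * hyp_flux x"
    using ev
  proof eventually_elim
    case (elim x)
    thus ?case using hyp_bounds(1)[of "1 - x"] hyp_flux_bounds(1)[of x] by (intro mult_nonneg_nonneg) auto
  qed
  show "\<forall>\<^sub>F x in at_right 0. hyp (1 - x) * hyp_flux x \<le> (hyp (1 / 2) * x + 4 * hyp_const * sqrt x) * hyp_const"
    using ev
  proof eventually_elim
    case (elim x)
    \<comment> \<open>From ln t <= t - 1 at t = 1 / sqrt x: a square root dominates the logarithm
      and still leaves sqrt x after multiplication by the flux.\<close>
    have "- ln (sqrt x) = ln (1 / sqrt x)" using elim by (simp add: ln_div)
    also have "\<dots> \<le> 1 / sqrt x" using elim ln_le_minus_one[of "1 / sqrt x"] by simp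
    finally have "- ln x \<le> 2 / sqrt x" using elim by (simp add: ln_sqrt)
    hence "hyp (1 - x) \<le> hyp (1 / 2) + 2 * hyp_const * (2 / sqrt x)"
      using hyp_log_bound[of x] elim mult_left_mono[of "- ln x" "2 / sqrt x" "2 * hyp_const"] hyp_const_pos by auto
    hence "hyp (1 - x) * hyp_flux x \<le> (hyp (1 / 2) + 2 * hyp_const * (2 / sqrt x)) * (hyp_const * x)"
      using elim hyp_flux_bounds[of x] hyp_bounds(1)[of "1 - x"] by (intro mult_mono) auto
    also have "\<dots> = (hyp (1 / 2) * x + 2 * hyp_const * (2 / sqrt x * x)) * hyp_const"
      by (simp only: distrib_left distrib_right mult_ac)
    also have "2 / sqrt x * x = 2 * sqrt x" using real_div_sqrt[of x] elim by (simp add: field_simps)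
    also have "(hyp (1 / 2) * x + 2 * hyp_const * (2 * sqrt x)) * hyp_const =
        (hyp (1 / 2) * x + 4 * hyp_const * sqrt x) * hyp_const" by simp
    finally show ?case .
  qed
  show "((\<lambda>x. (hyp (1 / 2) * x + 4 * hyp_const * sqrt x) * hyp_const) \<longlongrightarrow> 0) (at_right 0)"
    by (rule tendsto_eq_intros refl | simp)+
qed auto

lemma
  assumes "0 < y" "y < 1"
  shows hyp_reflect_has_derivative: "((\<lambda>x. hyp (1 - x)) has_field_derivative (- hyp_deriv (1 - y))) (at y)"
    and hyp_flux_reflect_has_derivative:
      "((\<lambda>x. hyp_flux (1 - x)) has_field_derivative (- (2 / 9 * hyp (1 - y)))) (at y)"
proof -
  have d: "((\<lambda>x. 1 - x) has_field_derivative - 1) (at y)" by (auto intro!: derivative_eq_intros)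
  show "((\<lambda>x. hyp (1 - x)) has_field_derivative (- hyp_deriv (1 - y))) (at y)"
    using DERIV_chain2[OF hyp_has_derivative d] assms by simp
  show "((\<lambda>x. hyp_flux (1 - x)) has_field_derivative (- (2 / 9 * hyp (1 - y)))) (at y)"
    using DERIV_chain2[OF hyp_flux_has_derivative d] assms by simp
qed

text \<open>F(x) and F(1-x) solve the same self-adjoint equation, so this Wronskian-type expression
  has derivative 0. Its constant is read off as x tends to 0: the first product tends to the flux at
  1, the second to 0.\<close>

theorem hyp_legendre_relation:
  assumes x: "0 < x" "x < 1"
  shows "hyp_flux (1 - x) * hyp x + hyp (1 - x) * hyp_flux x = hyp_const"
proof -
  define L where "L = (\<lambda>x. hyp_flux (1 - x) * hyp x + hyp (1 - x) * hyp_flux x)"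
  have d: "(L has_field_derivative 0) (at y)" if "0 < y" "y < 1" for y
  proof -
    have "(L has_field_derivative ((- (2 / 9 * hyp (1 - y))) * hyp y + hyp_deriv y * hyp_flux (1 - y) +
        ((- hyp_deriv (1 - y)) * hyp_flux y + (2 / 9 * hyp y) * hyp (1 - y)))) (at y)"
      unfolding L_def using that
      by (intro DERIV_add DERIV_mult hyp_has_derivative hyp_flux_has_derivative
            hyp_reflect_has_derivative hyp_flux_reflect_has_derivative) auto
    thus ?thesis by (simp add: hyp_flux_def algebra_simps)
  qed
  have const: "L y = L (1/2)" if "0 < y" "y < 1" for y
    by (rule DERIV_isconst3[of 0 1]) (use that d in auto)
  have "\<forall>\<^sub>F y in at_right 0. L y = L (1/2)"
    unfolding eventually_at_right[OF zero_less_one] by (intro exI[of _ 1] conjI zero_less_one allI impI const)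
  moreover have "(L \<longlongrightarrow> hyp_const * 1 + 0) (at_right 0)"
    unfolding L_def
  proof (intro tendsto_add tendsto_mult hyp_reflected_flux_at_right_0)
    have "filterlim (\<lambda>x::real. 1 - x) (at_left 1) (at_right 0)"
      unfolding filterlim_at by (auto intro!: tendsto_eq_intros simp: eventually_at_filter)
    thus "((\<lambda>x. hyp_flux (1 - x)) \<longlongrightarrow> hyp_const) (at_right 0)"
      by (rule filterlim_compose[OF hyp_flux_at_left_1])
    have "isCont hyp 0" using DERIV_isCont[OF hyp_has_derivative[of 0]] by simp
    thus "(hyp \<longlongrightarrow> 1) (at_right 0)" by (simp add: isCont_def filterlim_at_split)
  qed
  ultimately have "((\<lambda>_. L (1/2)) \<longlongrightarrow> hyp_const) (at_right (0::real))"
    using tendsto_cong by fastforce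
  hence "L (1/2) = hyp_const" by (simp add: tendsto_const_iff)
  thus ?thesis using const[OF x] by (simp add: L_def)
qed

definition hyp_ratio :: "real \<Rightarrow> real" where "hyp_ratio x = hyp (1 - x) / hyp x"

text \<open>The numerator of the quotient rule, times x(1-x), is minus the Legendre
  expression.\<close>

lemma hyp_ratio_has_derivative:
  assumes x: "0 < x" "x < 1"
  shows "(hyp_ratio has_field_derivative (- hyp_const / (x * (1 - x) * (hyp x)\<^sup>2))) (at x)"
proof -
  have pos: "hyp x \<ge> 1" using x by (intro hyp_bounds) auto
  have "(hyp_ratio has_field_derivative ((- hyp_deriv (1 - x) * hyp x - hyp (1 - x) * hyp_deriv x) / (hyp x * hyp x))) (at x)"
    unfolding hyp_ratio_def using x pos
    by (intro DERIV_divide hyp_has_derivative hyp_reflect_has_derivative) auto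
  moreover have "x * (1 - x) * (- hyp_deriv (1 - x) * hyp x - hyp (1 - x) * hyp_deriv x) = - hyp_const"
    unfolding hyp_legendre_relation[OF x, symmetric] by (simp add: hyp_flux_def algebra_simps)
  hence "(- hyp_deriv (1 - x) * hyp x - hyp (1 - x) * hyp_deriv x) / (hyp x * hyp x) = - hyp_const / (x * (1 - x) * (hyp x)\<^sup>2)"
    using x pos by (simp add: divide_simps power2_eq_square) (simp add: algebra_simps)
  ultimately show ?thesis by simp
qed

text \<open>The derivatives of the ratio and of - \<open>hyp_const\<close> * ln x have the same pole
  at 0, so the derivative of the sum is bounded on (0, 1/2]. Boundedness is the form in which the
  tripling argument uses it.\<close>

lemma hyp_ratio_log_bounded:
  assumes x: "0 < x" "x \<le> 1 / 2"
  shows "\<bar>hyp_ratio x + hyp_const * ln x\<bar> \<le> \<bar>hyp_ratio (1/2) + hyp_const * ln (1/2)\<bar> + hyp_const"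
proof -
  define f where "f = (\<lambda>x. hyp_ratio x + hyp_const * ln x)"
  define f' where "f' = (\<lambda>x. - hyp_const / (x * (1 - x) * (hyp x)\<^sup>2) + hyp_const / x)"
  have "norm (f x - f (1/2)) \<le> 2 * hyp_const * norm (x - 1/2)"
  proof (rule field_differentiable_bound[of "{0<..1/2}"])
    fix y :: real assume y: "y \<in> {0<..1/2}"
    have "((\<lambda>x. hyp_const * ln x) has_field_derivative hyp_const / y) (at y)"
      using y by (auto intro!: derivative_eq_intros)
    hence "(f has_field_derivative f' y) (at y)"
      unfolding f_def f'_def using y by (intro DERIV_add hyp_ratio_has_derivative) auto
    thus "(f has_field_derivative f' y) (at y within {0<..1/2})"
      by (rule has_field_derivative_at_within)
    have h: "1 \<le> hyp y" "hyp y \<le> 1 / (1 - y)" using y by (auto intro!: hyp_bounds)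
    \<comment> \<open>The derivative in question is (\<open>hyp_const\<close> / y)(1 - t), and the
      bounds 1 <= F(y) <= 1/(1-y) squeeze t between 1 - y and 1 + 2y.\<close>
    define t where "t = 1 / ((1 - y) * (hyp y)\<^sup>2)"
    have "(1 - y) * (hyp y)\<^sup>2 \<le> (1 - y) * (1 / (1 - y))\<^sup>2"
      using h y by (intro mult_left_mono power_mono) auto
    hence "(1 - y) * (hyp y)\<^sup>2 \<le> 1 / (1 - y)" using y by (simp add: power2_eq_square)
    moreover have "1 - y \<le> (1 - y) * (hyp y)\<^sup>2" using h y by (simp add: mult_le_cancel_left1)
    moreover have "0 < (1 - y) * (hyp y)\<^sup>2" using h y by (intro mult_pos_pos) auto
    ultimately have "1 - y \<le> t" "t \<le> 1 / (1 - y)"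
      using y by (auto simp: t_def divide_simps mult_ac)
    moreover have "1 / (1 - y) \<le> 1 + 2 * y" using y by (simp add: divide_simps) (simp add: algebra_simps)
    ultimately have "\<bar>1 - t\<bar> \<le> 2 * y" using y by auto
    moreover have "f' y = hyp_const / y * (1 - t)"
      using y by (simp add: f'_def t_def divide_simps algebra_simps)
    ultimately have "norm (f' y) \<le> hyp_const / y * (2 * y)"
      using hyp_const_pos y by (simp add: abs_mult mult_left_mono del: times_divide_eq_left)
    thus "norm (f' y) \<le> 2 * hyp_const" using y by simp
  qed (use x in auto)
  also have "2 * hyp_const * norm (x - 1/2) \<le> hyp_const"
    using x hyp_const_pos by (simp add: abs_if mult_left_le algebra_simps)
  finally show ?thesis by (auto simp: f_def)
qed

section \<open>Cubic inversion\<close>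

definition cubic_x :: "real \<Rightarrow> real" where "cubic_x q = (cubic_c q / cubic_a q) ^ 3"

lemma one_minus_cubic_x:
  assumes "0 < q" "q < 1" shows "1 - cubic_x q = (cubic_b q / cubic_a q) ^ 3"
proof -
  have "cubic_a q \<noteq> 0" using cubic_pos[OF assms] by simp
  moreover have b: "cubic_b q ^ 3 = cubic_a q ^ 3 - cubic_c q ^ 3" by (simp add: cubic_a_cubed)
  ultimately show ?thesis by (simp add: cubic_x_def power_divide b diff_divide_distrib)
qed

lemma cubic_x_range:
  assumes "0 < q" "q < 1" shows "0 < cubic_x q" "cubic_x q < 1"
proof -
  note pos = cubic_pos[OF assms]
  show "0 < cubic_x q" using pos by (simp add: cubic_x_def)
  have "0 < (cubic_b q / cubic_a q) ^ 3" using pos by simp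
  thus "cubic_x q < 1" using one_minus_cubic_x[OF assms] by linarith
qed

lemma power3_less_1: "0 < q \<Longrightarrow> q < 1 \<Longrightarrow> 0 < q ^ 3 \<and> q ^ 3 < (1::real)"
  by (simp add: power_less_one_iff)

text \<open>The parameter is s = c(q^3) / a(q^3). By the linear relations 1 - s = b(q) / a(q^3) and
  1 + 2s = a(q) / a(q^3), which is the parametrisation in the cubic transformation.\<close>

lemma cubic_tripling:
  assumes q: "0 < q" "q < 1"
  obtains s where "0 < s" "s < 1" "cubic_x (q ^ 3) = s ^ 3" "1 - cubic_x q = ((1 - s) / (1 + 2 * s)) ^ 3"
    "cubic_a q = (1 + 2 * s) * cubic_a (q ^ 3)"
proof
  define s where "s = cubic_c (q ^ 3) / cubic_a (q ^ 3)"
  have q3: "0 < q ^ 3" "q ^ 3 < 1" using power3_less_1[OF q] by auto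
  note pos = cubic_pos[OF q] cubic_pos[OF q3]
  have s1: "1 - s = cubic_b q / cubic_a (q ^ 3)"
    using pos cubic_a_cube_arg[OF q] by (simp add: s_def divide_simps)
  have s2: "1 + 2 * s = cubic_a q / cubic_a (q ^ 3)"
    using pos cubic_a_cube_arg[OF q] cubic_a_eq[OF q] by (simp add: s_def divide_simps)
  show "0 < s" using pos by (simp add: s_def)
  have "0 < 1 - s" unfolding s1 using pos by simp
  thus "s < 1" by simp
  show "cubic_x (q ^ 3) = s ^ 3" by (simp add: cubic_x_def s_def)
  show "1 - cubic_x q = ((1 - s) / (1 + 2 * s)) ^ 3"
    unfolding one_minus_cubic_x[OF q] s1 s2 using pos by simp
  show "cubic_a q = (1 + 2 * s) * cubic_a (q ^ 3)" unfolding s2 using pos by simp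
qed

text \<open>The first claim is the cubic transformation at s. For the second it is applied also at u
  = (1-s)/(1+2s): this substitution is an involution with (1+2s)(1+2u) = 3, so F at the
  complementary arguments picks up 3/(1+2s) and the ratio picks up the factor 3.\<close>

lemma
  assumes q: "0 < q" "q < 1"
  shows cubic_a_hyp_tripling: "cubic_a q / hyp (cubic_x q) = cubic_a (q ^ 3) / hyp (cubic_x (q ^ 3))"
    and hyp_ratio_tripling: "hyp_ratio (cubic_x (q ^ 3)) = 3 * hyp_ratio (cubic_x q)"
proof -
  obtain s where s: "0 < s" "s < 1" "cubic_x (q ^ 3) = s ^ 3" "1 - cubic_x q = ((1 - s) / (1 + 2 * s)) ^ 3"
    "cubic_a q = (1 + 2 * s) * cubic_a (q ^ 3)" by (rule cubic_tripling[OF q])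
  have q3: "0 < q ^ 3" "q ^ 3 < 1" using power3_less_1[OF q] by auto
  have x: "cubic_x q = 1 - ((1 - s) / (1 + 2 * s)) ^ 3" using s(4) by simp
  have F: "hyp (cubic_x q) = (1 + 2 * s) * hyp (cubic_x (q ^ 3))"
    unfolding x s(3) using s by (intro hyp_cubic_transformation) auto
  show "cubic_a q / hyp (cubic_x q) = cubic_a (q ^ 3) / hyp (cubic_x (q ^ 3))"
    unfolding F s(5) using s by simp
  define u where "u = (1 - s) / (1 + 2 * s)"
  have u: "0 < u" "u < 1" using s by (auto simp: u_def divide_simps)
  have inv: "(1 - u) / (1 + 2 * u) = s" "1 + 2 * u = 3 / (1 + 2 * s)"
    using s by (simp_all add: u_def divide_simps)
  have "hyp (1 - s ^ 3) = (1 + 2 * u) * hyp (u ^ 3)"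
    using hyp_cubic_transformation[of u] u unfolding inv(1) by auto
  hence "hyp (1 - cubic_x (q ^ 3)) = 3 / (1 + 2 * s) * hyp (1 - cubic_x q)"
    unfolding s(3,4) u_def[symmetric] inv(2) .
  thus "hyp_ratio (cubic_x (q ^ 3)) = 3 * hyp_ratio (cubic_x q)"
    unfolding hyp_ratio_def F using s by simp
qed

lemma euler_cube_tendsto_1: "((\<lambda>q. euler_real (q ^ 3)) \<longlongrightarrow> 1) (at_right 0)"
proof (rule filterlim_compose[OF euler_real_tendsto_1])
  show "filterlim (\<lambda>x::real. x ^ 3) (at_right 0) (at_right 0)"
    unfolding filterlim_at by (auto intro!: tendsto_eq_intros simp: eventually_at_filter)
qed

text \<open>Since c behaves like 3 q^(1/3) and a tends to 1, x behaves like 27 q; so ln x and ln q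
  differ by a bounded amount near 0.\<close>

lemma cubic_tendsto:
  shows cubic_b_tendsto: "(cubic_b \<longlongrightarrow> 1) (at_right 0)"
    and cubic_c_tendsto: "(cubic_c \<longlongrightarrow> 0) (at_right 0)"
    and cubic_a_tendsto: "(cubic_a \<longlongrightarrow> 1) (at_right 0)"
    and cubic_x_tendsto: "(cubic_x \<longlongrightarrow> 0) (at_right 0)"
    and cubic_x_over_q_tendsto: "((\<lambda>q. cubic_x q / q) \<longlongrightarrow> 27) (at_right 0)"
proof -
  note lim = euler_real_tendsto_1 euler_cube_tendsto_1
  have "((\<lambda>q. euler_real q ^ 3 / euler_real (q ^ 3)) \<longlongrightarrow> 1 ^ 3 / 1) (at_right 0)"
    by (intro tendsto_intros lim) auto
  thus b: "(cubic_b \<longlongrightarrow> 1) (at_right 0)" by (simp add: cubic_b_def[abs_def])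
  have "((\<lambda>q. 3 * root 3 q * euler_real (q ^ 3) ^ 3 / euler_real q) \<longlongrightarrow> 3 * root 3 0 * 1 ^ 3 / 1) (at_right 0)"
    by (intro tendsto_intros lim) auto
  thus c: "(cubic_c \<longlongrightarrow> 0) (at_right 0)" by (simp add: cubic_c_def[abs_def])
  have "((\<lambda>q. root 3 (cubic_b q ^ 3 + cubic_c q ^ 3)) \<longlongrightarrow> root 3 (1 ^ 3 + 0 ^ 3)) (at_right 0)"
    by (intro tendsto_intros b c)
  thus a: "(cubic_a \<longlongrightarrow> 1) (at_right 0)" by (simp add: cubic_a_def[abs_def])
  have "((\<lambda>q. (cubic_c q / cubic_a q) ^ 3) \<longlongrightarrow> (0 / 1) ^ 3) (at_right 0)"
    by (intro tendsto_intros a c) auto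
  thus "(cubic_x \<longlongrightarrow> 0) (at_right 0)" by (simp add: cubic_x_def[abs_def])
  have "((\<lambda>q. (3 * euler_real (q ^ 3) ^ 3 / euler_real q / cubic_a q) ^ 3) \<longlongrightarrow> (3 * 1 ^ 3 / 1 / 1) ^ 3) (at_right 0)"
    by (intro tendsto_intros a lim) auto
  moreover have "\<forall>\<^sub>F q in at_right 0. (3 * euler_real (q ^ 3) ^ 3 / euler_real q / cubic_a q) ^ 3 = cubic_x q / q"
  proof -
    have "\<forall>\<^sub>F q::real in at_right 0. q > 0" by (simp add: eventually_at_right_less)
    thus ?thesis
    proof eventually_elim
      case (elim q)
      have "cubic_c q ^ 3 = (3 * euler_real (q ^ 3) ^ 3 / euler_real q) ^ 3 * root 3 q ^ 3"
        by (simp add: cubic_c_def power_mult_distrib power_divide)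
      also have "root 3 q ^ 3 = q" by (simp add: odd_real_root_pow)
      finally show ?case using elim by (simp add: cubic_x_def power_divide power_mult_distrib)
    qed
  qed
  ultimately show "((\<lambda>q. cubic_x q / q) \<longlongrightarrow> 27) (at_right 0)"
    by (auto intro: Lim_transform_eventually)
qed

lemma triple_power_at_right_0:
  assumes "0 < q" "q < (1::real)"
  shows "filterlim (\<lambda>n::nat. q ^ (3 ^ n)) (at_right 0) sequentially"
proof -
  have "filterlim (\<lambda>n::nat. 3 ^ n) sequentially sequentially"
    by (intro filterlim_subseq strict_monoI) (auto intro: power_strict_increasing)
  hence "(\<lambda>n. q ^ (3 ^ n)) \<longlonglongrightarrow> 0"
    using assms by (intro filterlim_compose[OF LIMSEQ_power_zero]) auto
  thus ?thesis unfolding filterlim_at using assms by auto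
qed

lemma triple_power_range: "0 < q \<Longrightarrow> q < (1::real) \<Longrightarrow> 0 < q ^ (3 ^ n) \<and> q ^ (3 ^ n) < 1"
  by (simp add: power_less_one_iff)

theorem cubic_a_eq_hyp:
  assumes q: "0 < q" "q < 1" shows "cubic_a q = hyp (cubic_x q)"
proof -
  define R where "R = (\<lambda>q. cubic_a q / hyp (cubic_x q))"
  have const: "R (q ^ (3 ^ n)) = R q" for n
  proof (induction n)
    case (Suc n)
    have "q ^ (3 ^ Suc n) = (q ^ (3 ^ n)) ^ 3" by (simp add: power_mult[symmetric] mult.commute)
    thus ?case using Suc cubic_a_hyp_tripling[of "q ^ (3 ^ n)"] triple_power_range[OF q] by (simp add: R_def)
  qed simp
  have "isCont hyp 0" using DERIV_isCont[OF hyp_has_derivative[of 0]] by simp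
  hence "((\<lambda>q. hyp (cubic_x q)) \<longlongrightarrow> hyp 0) (at_right 0)"
    by (rule isCont_tendsto_compose[OF _ cubic_x_tendsto])
  hence "(R \<longlongrightarrow> 1 / hyp 0) (at_right 0)"
    unfolding R_def by (intro tendsto_intros cubic_a_tendsto) auto
  hence "(\<lambda>n. R (q ^ (3 ^ n))) \<longlonglongrightarrow> 1"
    using filterlim_compose[OF _ triple_power_at_right_0[OF q]] by auto
  hence "R q = 1" by (simp add: const tendsto_const_iff LIMSEQ_const_iff)
  moreover have "hyp (cubic_x q) \<ge> 1" using cubic_x_range[OF q] by (intro hyp_bounds) auto
  ultimately show ?thesis by (simp add: R_def)
qed

text \<open>The defect \<open>D\<close> is multiplied by 3^n along q^(3^n), since both its terms
  triple. Along that orbit it stays bounded by \<open>M + C\<close>, so |D q| <= (M + C) / 3^n for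
  all large n.\<close>

theorem hyp_ratio_cubic_x:
  assumes q: "0 < q" "q < 1" shows "hyp_ratio (cubic_x q) = - hyp_const * ln q"
proof -
  define D where "D = (\<lambda>q. hyp_ratio (cubic_x q) + hyp_const * ln q)"
  have triple: "D (q ^ (3 ^ n)) = 3 ^ n * D q" for n
  proof (induction n)
    case (Suc n)
    have r: "0 < q ^ (3 ^ n)" "q ^ (3 ^ n) < 1" using triple_power_range[OF q] by auto
    have eq: "q ^ (3 ^ Suc n) = (q ^ (3 ^ n)) ^ 3" by (simp add: power_mult[symmetric] mult.commute)
    have "D ((q ^ (3 ^ n)) ^ 3) = 3 * D (q ^ (3 ^ n))"
      using r hyp_ratio_tripling[OF r] ln_realpow[of "q ^ (3 ^ n)" 3] by (simp only: D_def) (simp add: algebra_simps)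
    thus ?case unfolding eq Suc by simp
  qed simp
  define M where "M = \<bar>hyp_ratio (1/2) + hyp_const * ln (1/2)\<bar> + hyp_const"
  have lim: "filterlim (\<lambda>n. q ^ (3 ^ n)) (at_right 0) sequentially" by (rule triple_power_at_right_0[OF q])
  have "((\<lambda>q. hyp_const * ln (cubic_x q / q)) \<longlongrightarrow> hyp_const * ln 27) (at_right 0)"
    by (intro tendsto_intros cubic_x_over_q_tendsto) auto
  from filterlim_compose[OF this lim]
  have "(\<lambda>n. hyp_const * ln (cubic_x (q ^ (3 ^ n)) / q ^ (3 ^ n))) \<longlonglongrightarrow> hyp_const * ln 27" .
  hence "Bseq (\<lambda>n. hyp_const * ln (cubic_x (q ^ (3 ^ n)) / q ^ (3 ^ n)))"
    using convergentI convergent_imp_Bseq by blast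
  then obtain C where C: "\<bar>hyp_const * ln (cubic_x (q ^ (3 ^ n)) / q ^ (3 ^ n))\<bar> \<le> C" for n
    unfolding Bseq_def by auto
  have "(\<lambda>n. cubic_x (q ^ (3 ^ n))) \<longlonglongrightarrow> 0" by (rule filterlim_compose[OF cubic_x_tendsto lim])
  hence "\<forall>\<^sub>F n in sequentially. cubic_x (q ^ (3 ^ n)) < 1/2" by (rule order_tendstoD) auto
  hence "\<forall>\<^sub>F n in sequentially. norm (D q) \<le> norm ((M + C) / 3 ^ n)"
  proof eventually_elim
    case (elim n)
    have r: "0 < q ^ (3 ^ n)" "q ^ (3 ^ n) < 1" using triple_power_range[OF q] by auto
    define x y where "x = cubic_x (q ^ (3 ^ n))" and "y = q ^ (3 ^ n)"
    have x: "0 < x" "x \<le> 1/2" "0 < y" using elim cubic_x_range[OF r] r by (auto simp: x_def y_def)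
    have "\<bar>hyp_ratio x + hyp_const * ln x\<bar> \<le> M" unfolding M_def by (rule hyp_ratio_log_bounded[OF x(1,2)])
    \<comment> \<open>Two bounded parts: the ratio against ln x, and ln (x / y), which converges
      because x / y tends to 27.\<close>
    moreover have "D y = (hyp_ratio x + hyp_const * ln x) - hyp_const * ln (x / y)"
    proof -
      have "ln (x / y) = ln x - ln y" using x by (simp add: ln_div)
      hence "hyp_const * ln (x / y) = hyp_const * ln x - hyp_const * ln y" by (simp only: right_diff_distrib)
      moreover have "D y = hyp_ratio x + hyp_const * ln y" by (simp add: D_def x_def y_def)
      ultimately show ?thesis by linarith
    qed
    moreover have "\<bar>hyp_const * ln (x / y)\<bar> \<le> C" using C[of n] by (simp add: x_def y_def)
    ultimately have "\<bar>3 ^ n * D q\<bar> \<le> M + C"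
      unfolding triple[symmetric] y_def[symmetric] by linarith
    hence "\<bar>D q\<bar> \<le> (M + C) / 3 ^ n" by (simp add: abs_mult field_simps)
    thus ?case unfolding real_norm_def by linarith
  qed
  moreover have "(\<lambda>n. (M + C) / 3 ^ n) \<longlonglongrightarrow> 0"
    by (rule LIMSEQ_divide_realpow_zero) simp
  ultimately have "(\<lambda>n::nat. D q) \<longlonglongrightarrow> 0"
    by (rule Lim_null_comparison[OF _ tendsto_norm_zero, rotated 0])
  hence "D q = 0" by (simp add: LIMSEQ_const_iff)
  thus ?thesis by (simp add: D_def)
qed

section \<open>Conformal maps of the disc\<close>

text \<open>The image of the open disc is open, and compactness of the full image with the circle
  going to the frontier makes it relatively closed off the frontier. So a connected set missing the
  frontier is contained in the image or disjoint from it. The exterior is excluded because it is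
  unbounded; hence the interior is filled.\<close>

lemma image_disc_eq_convex:
  fixes f :: "complex \<Rightarrow> complex"
  assumes cont: "continuous_on (cball 0 1) f" and hol: "f holomorphic_on ball 0 1"
    and inj: "inj_on f (ball 0 1)"
    and Q: "compact Q" "convex Q" and bd: "f ` sphere 0 1 \<subseteq> frontier Q"
  shows "f ` ball 0 1 = interior Q" "f ` cball 0 1 = Q"
proof -
  let ?B = "ball (0::complex) 1" and ?C = "cball (0::complex) 1"
  have C: "?C = ?B \<union> sphere 0 1" by auto
  have opn: "open (f ` ?B)"
    using open_mapping_thm3[OF hol _ inj] by auto
  have cpt: "compact (f ` ?C)" by (intro compact_continuous_image cont) auto
  have clQ: "closed Q" using Q compact_imp_closed by auto
  have front: "frontier Q \<subseteq> Q" using clQ by (simp add: frontier_subset_closed)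
  have clopen: "f ` ?B \<inter> S = S" if S: "connected S" "f ` ?B \<inter> S \<noteq> {}" "S \<inter> frontier Q = {}" for S
  proof -
    have "openin (top_of_set S) (S \<inter> f ` ?B)" using opn by (rule openin_open_Int)
    moreover have "closedin (top_of_set S) (S \<inter> f ` ?C)"
      using cpt compact_imp_closed by (intro closedin_closed_Int) auto
    moreover have "S \<inter> f ` ?C = S \<inter> f ` ?B" using S(3) bd unfolding C by blast
    ultimately have "S \<inter> f ` ?B = {} \<or> S \<inter> f ` ?B = S" using S(1) connected_clopen by metis
    thus ?thesis using S(2) by blast
  qed
  have sub: "f ` ?B \<subseteq> interior Q"
  proof (rule interior_maximal[OF _ opn], rule ccontr)
    assume "\<not> f ` ?B \<subseteq> Q"
    moreover have "connected (- Q)"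
      using Q by (intro connected_complement_bounded_convex compact_imp_bounded) auto
    ultimately have "f ` ?B \<inter> - Q = - Q" using front by (intro clopen) auto
    moreover have "f ` ?B \<subseteq> f ` ?C" by (intro image_mono) auto
    ultimately have "- Q \<subseteq> f ` ?C" by blast
    hence "bounded (- Q)" using cpt compact_imp_bounded bounded_subset by blast
    hence "bounded (Q \<union> - Q)" using compact_imp_bounded[OF Q(1)] by (simp only: bounded_Un)
    thus False by (simp only: Compl_partition not_bounded_UNIV)
  qed
  moreover have "f 0 \<in> f ` ?B" by (rule imageI) simp
  ultimately have "f ` ?B \<inter> interior Q \<noteq> {}" by blast
  hence "f ` ?B \<inter> interior Q = interior Q"
    using Q by (intro clopen convex_connected convex_interior) (auto simp: frontier_def)
  thus eq: "f ` ?B = interior Q" using sub by blast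
  show "f ` ?C = Q"
  proof
    show "f ` ?C \<subseteq> Q" unfolding C image_Un using sub bd front interior_subset by blast
    have "interior Q \<noteq> {}" using eq by auto
    hence "Q = closure (interior Q)" using Q clQ by (simp add: convex_closure_interior)
    also have "\<dots> \<subseteq> f ` ?C"
    proof (rule closure_minimal)
      show "interior Q \<subseteq> f ` ?C" unfolding eq[symmetric] by auto
      show "closed (f ` ?C)" using cpt by (rule compact_imp_closed)
    qed
    finally show "Q \<subseteq> f ` ?C" .
  qed
qed

text \<open>A derivative of order \<open>(1 - \<bar>z\<bar>) powr (-2/3)\<close> makes the dilations \<open>f(\<rho>z)\<close>
  converge uniformly as \<open>\<rho>\<close> tends to \<open>1\<close>.\<close>
lemma continuous_extension_to_closed_disc:
  fixes f f' :: "complex \<Rightarrow> complex"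
  assumes der: "\<And>z. norm z < 1 \<Longrightarrow> (f has_field_derivative f' z) (at z)"
    and bnd: "\<And>z. norm z < 1 \<Longrightarrow> norm (f' z) \<le> K * (1 - norm z) powr (- 2 / 3)"
  obtains g where "continuous_on (cball 0 1) g" "\<And>z. norm z < 1 \<Longrightarrow> g z = f z"
proof -
  define \<rho> where "\<rho> = (\<lambda>n::nat. 1 - 1 / real (Suc n))"
  have \<rho>: "0 \<le> \<rho> n" "\<rho> n < 1" for n by (auto simp: \<rho>_def divide_simps)
  have K: "K \<ge> 0" using order_trans[OF norm_ge_zero bnd[of 0]] by simp
  \<comment> \<open>A primitive of K (1-t)^(-2/3): the mean value bound along a radius becomes
    uniform in the direction and tends to 0 at the circle.\<close>
  define u where "u = (\<lambda>t. - 3 * K * (1 - t) powr (1/3))"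
  have step: "norm (f (of_real b * z) - f (of_real a * z)) \<le> 3 * K * (1 - a) powr (1/3)"
    if ab: "0 \<le> a" "a \<le> b" "b < 1" and z: "norm z \<le> 1" for a b z
  proof -
    have "norm (f (of_real b * z) - f (of_real a * z)) \<le> u b - u a"
    proof (cases "a = b")
      case False
      show ?thesis
      proof (rule differentiable_bound_general[where f = "\<lambda>t. f (of_real t * z)" and \<phi> = u
            and f' = "\<lambda>t. z * f' (of_real t * z)" and \<phi>' = "\<lambda>t. K * (1 - t) powr (- 2 / 3)"])
        show "a < b" using False ab by simp
        have nz: "norm (of_real t * z) < 1" if "a \<le> t" "t \<le> b" for t
          using that ab z mult_left_le[of "norm z" t] by (simp add: norm_mult)
        have d: "((\<lambda>t. f (of_real t * z)) has_vector_derivative z * f' (of_real t * z)) (at t)" if "a \<le> t" "t \<le> b" for t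
        proof -
          have "((\<lambda>t. of_real t * z) has_vector_derivative z) (at t)"
            by (auto intro!: derivative_eq_intros)
          from field_vector_diff_chain_at[OF this der[OF nz[OF that]]] show ?thesis by (simp add: o_def)
        qed
        have du: "(u has_field_derivative K * (1 - t) powr (- 2 / 3)) (at t)" if "t \<le> b" for t
          unfolding u_def using that ab by (auto intro!: derivative_eq_intros)
        show "continuous_on {a..b} (\<lambda>t. f (of_real t * z))"
          using d by (intro continuous_at_imp_continuous_on ballI has_vector_derivative_continuous) auto
        show "continuous_on {a..b} u"
          using du by (intro continuous_at_imp_continuous_on ballI DERIV_isCont) auto
        fix t assume t: "a < t" "t < b"
        show "((\<lambda>t. f (of_real t * z)) has_vector_derivative z * f' (of_real t * z)) (at t)" using d t by simp
        show "(u has_vector_derivative K * (1 - t) powr (- 2 / 3)) (at t)"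
          using du[of t] t by (simp add: has_real_derivative_iff_has_vector_derivative)
        have le: "norm (of_real t * z) \<le> t" using t ab z by (simp add: norm_mult mult_left_le)
        have "norm (z * f' (of_real t * z)) \<le> norm (f' (of_real t * z))"
          using z by (simp add: norm_mult mult_left_le_one_le)
        also have "\<dots> \<le> K * (1 - norm (of_real t * z)) powr (- 2 / 3)" using nz t by (intro bnd) auto
        also have "\<dots> \<le> K * (1 - t) powr (- 2 / 3)"
          using K t ab le by (intro mult_left_mono powr_mono2') auto
        finally show "norm (z * f' (of_real t * z)) \<le> K * (1 - t) powr (- 2 / 3)" .
      qed
    qed (use K in \<open>simp add: u_def\<close>)
    also have "\<dots> \<le> 3 * K * (1 - a) powr (1/3)" using K by (simp add: u_def)
    finally show ?thesis .
  qed
  have lim: "(\<lambda>n. 3 * K * (1 - \<rho> n) powr (1/3)) \<longlonglongrightarrow> 0"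
  proof -
    have "(\<lambda>n. (1 / real (Suc n)) powr (1/3)) \<longlonglongrightarrow> 0 powr (1/3)"
      using LIMSEQ_Suc[OF lim_1_over_n] by (intro tendsto_powr2) auto
    from tendsto_mult[OF tendsto_const[of "3 * K"] this]
    have "(\<lambda>n. 3 * K * (1 / real (Suc n)) powr (1/3)) \<longlonglongrightarrow> 0" by simp
    thus ?thesis by (simp add: \<rho>_def)
  qed
  have mono: "\<rho> m \<le> \<rho> n" if "m \<le> n" for m n using that by (auto simp: \<rho>_def frac_le)
  have "uniformly_Cauchy_on (cball 0 1) (\<lambda>n z. f (of_real (\<rho> n) * z))"
  proof (rule uniformly_Cauchy_onI')
    fix e :: real assume "e > 0"
    hence "\<forall>\<^sub>F n in sequentially. 3 * K * (1 - \<rho> n) powr (1/3) < e" using order_tendstoD(2)[OF lim] by auto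
    then obtain M where M: "\<And>n. n \<ge> M \<Longrightarrow> 3 * K * (1 - \<rho> n) powr (1/3) < e" by (auto simp: eventually_sequentially)
    show "\<exists>M. \<forall>x\<in>cball 0 1. \<forall>m\<ge>M. \<forall>n>m. dist (f (of_real (\<rho> m) * x)) (f (of_real (\<rho> n) * x)) < e"
    proof (intro exI[of _ M] ballI allI impI)
      fix x :: complex and m n assume "x \<in> cball 0 1" "M \<le> m" "m < n"
      thus "dist (f (of_real (\<rho> m) * x)) (f (of_real (\<rho> n) * x)) < e"
        using step[of "\<rho> m" "\<rho> n" x] \<rho> mono[of m n] M[of m] by (auto simp: dist_norm norm_minus_commute)
    qed
  qed
  then obtain g where g: "uniform_limit (cball 0 1) (\<lambda>n z. f (of_real (\<rho> n) * z)) g sequentially"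
    using uniformly_convergent_eq_Cauchy unfolding uniformly_convergent_on_def by blast
  have "continuous_on (cball 0 1) g"
  proof (rule uniform_limit_theorem[OF always_eventually g])
    show "\<forall>n. continuous_on (cball 0 1) (\<lambda>z. f (of_real (\<rho> n) * z))"
    proof (intro allI continuous_at_imp_continuous_on ballI)
      fix n and z :: complex assume "z \<in> cball 0 1"
      hence "norm (of_real (\<rho> n) * z) < 1" using \<rho>[of n] mult_left_le[of "norm z" "\<rho> n"] by (simp add: norm_mult)
      from DERIV_isCont[OF der[OF this]] show "isCont (\<lambda>z. f (of_real (\<rho> n) * z)) z"
        by (rule isCont_o2[rotated]) (intro continuous_intros)
    qed
  qed auto
  moreover have "g z = f z" if z: "norm z < 1" for z
  proof (rule LIMSEQ_unique)
    show "(\<lambda>n. f (of_real (\<rho> n) * z)) \<longlonglongrightarrow> g z" using tendsto_uniform_limitI[OF g] z by simp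
    have "(\<lambda>n. of_real (\<rho> n) * z) \<longlonglongrightarrow> of_real (1 - 0) * z"
      unfolding \<rho>_def by (intro tendsto_intros LIMSEQ_Suc[OF lim_1_over_n])
    from isCont_tendsto_compose[OF DERIV_isCont[OF der[OF z]] this[simplified]]
    show "(\<lambda>n. f (of_real (\<rho> n) * z)) \<longlonglongrightarrow> f z" by simp
  qed
  ultimately show ?thesis using that by blast
qed

text \<open>Along the segment from a to b the real part of k f / (b - a) has derivative Re (k f') >
  0, so the end values differ. Points of the circle are included because the open segment between
  distinct points of the closed disc lies in the open disc.\<close>

lemma Noshiro_Warschawski_closed_disc:
  fixes f f' :: "complex \<Rightarrow> complex"
  assumes cont: "continuous_on (cball 0 1) f"
    and der: "\<And>z. norm z < 1 \<Longrightarrow> (f has_field_derivative f' z) (at z)"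
    and pos: "\<And>z. norm z < 1 \<Longrightarrow> Re (k * f' z) > 0"
  shows "inj_on f (cball 0 1)"
proof (rule inj_onI, rule ccontr)
  fix a b assume ab: "a \<in> cball 0 1" "b \<in> cball 0 1" "f a = f b" "a \<noteq> b"
  define l where "l = (\<lambda>t::real. a + of_real t * (b - a))"
  define F where "F = (\<lambda>t. Re (k * f (l t) / (b - a)))"
  have l_in: "l t \<in> cball 0 1" if "0 \<le> t" "t \<le> 1" for t
  proof -
    have "(1 - t) *\<^sub>R a + t *\<^sub>R b \<in> cball 0 1" using that by (intro convexD_alt convex_cball ab)
    moreover have "(1 - t) *\<^sub>R a + t *\<^sub>R b = l t" by (simp add: l_def scaleR_conv_of_real algebra_simps)
    ultimately show ?thesis by simp
  qed
  have l_ball: "norm (l t) < 1" if "0 < t" "t < 1" for t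
  proof -
    have "l t \<in> open_segment a b"
      unfolding in_segment using that ab(4) by (auto simp: l_def scaleR_conv_of_real algebra_simps intro!: exI[of _ t])
    from dist_decreases_open_segment[OF this, of 0] show ?thesis using ab by auto
  qed
  have "F 0 < F 1"
  proof (rule DERIV_pos_imp_increasing_open[of 0 1 F])
    fix t :: real assume t: "0 < t" "t < 1"
    have "(l has_vector_derivative (b - a)) (at t)"
      unfolding l_def by (auto intro!: derivative_eq_intros)
    from field_vector_diff_chain_at[OF this der[OF l_ball[OF t]]]
    have "((\<lambda>t. f (l t)) has_vector_derivative (b - a) * f' (l t)) (at t)" by (simp add: o_def)
    hence "((\<lambda>t. k / (b - a) * f (l t)) has_vector_derivative k / (b - a) * ((b - a) * f' (l t))) (at t)"
      by (rule has_vector_derivative_mult_right)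
    hence "((\<lambda>t. k * f (l t) / (b - a)) has_vector_derivative k * f' (l t)) (at t)"
      using ab(4) by (simp add: mult.commute)
    from bounded_linear.has_vector_derivative[OF bounded_linear_Re this]
    have "(F has_field_derivative Re (k * f' (l t))) (at t)"
      by (simp add: F_def has_real_derivative_iff_has_vector_derivative)
    thus "\<exists>y. (F has_field_derivative y) (at t) \<and> y > 0" using pos[OF l_ball[OF t]] by blast
  next
    have "continuous_on {0..1} l" unfolding l_def by (intro continuous_intros)
    moreover have "l ` {0..1} \<subseteq> cball 0 1" using l_in by auto
    ultimately have "continuous_on {0..1} (\<lambda>t. f (l t))"
      using continuous_on_compose2[OF cont] by blast
    thus "continuous_on {0..1} F" unfolding F_def using ab(4) by (intro continuous_intros) auto
  qed simp
  moreover have "F 0 = F 1" using ab by (simp add: F_def l_def)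
  ultimately show False by simp
qed

text \<open>Schwarz's lemma makes f a Moebius map on the open disc, and continuity carries the
  formula to the circle. Its fixed points are roots of a polynomial of degree at most 2, which three
  distinct roots force to be zero.\<close>

lemma disc_automorphism_three_fixed_points:
  fixes f g :: "complex \<Rightarrow> complex"
  assumes cont: "continuous_on (cball 0 1) f"
    and hol: "f holomorphic_on ball 0 1" "g holomorphic_on ball 0 1"
    and ball: "f ` ball 0 1 \<subseteq> ball 0 1" "g ` ball 0 1 \<subseteq> ball 0 1"
    and inv: "\<And>z. norm z < 1 \<Longrightarrow> f (g z) = z" "\<And>z. norm z < 1 \<Longrightarrow> g (f z) = z"
    and fp: "f x = x" "f y = y" "f w = w" "x \<noteq> y" "x \<noteq> w" "y \<noteq> w"
    and xyw: "x \<in> cball 0 1" "y \<in> cball 0 1" "w \<in> cball 0 1"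
    and z: "z \<in> cball 0 1"
  shows "f z = z"
proof -
  define a where "a = g 0"
  have "g 0 \<in> ball 0 1" by (rule subsetD[OF ball(2)], rule imageI) simp
  hence a: "norm a < 1" "norm (- a) < 1" by (simp_all add: a_def)
  let ?M = "Moebius_function 0 a" and ?N = "Moebius_function 0 (- a)"
  have MN: "norm (?M z) < 1" "norm (?N z) < 1" if "norm z < 1" for z
    using Moebius_function_norm_lt_1 a that by blast+
  have fg: "norm (f z) < 1" "norm (g z) < 1" if "norm z < 1" for z
    using subsetD[OF ball(1) imageI, of z] subsetD[OF ball(2) imageI, of z] that by simp_all
  have holM: "?M holomorphic_on ball 0 1" "?N holomorphic_on ball 0 1"
    by (intro Moebius_function_holomorphic a)+
  have hf: "(\<lambda>z. f (?N z)) holomorphic_on ball 0 1"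
    using holomorphic_on_compose_gen[OF holM(2) hol(1)] MN by (auto simp: o_def image_subset_iff)
  have hg: "(\<lambda>z. ?M (g z)) holomorphic_on ball 0 1"
    using holomorphic_on_compose_gen[OF hol(2) holM(1)] fg by (auto simp: o_def image_subset_iff)
  have z0: "f (?N 0) = 0" "?M (g 0) = 0"
    using inv(1)[of 0] by (simp_all add: Moebius_function_of_zero a_def Moebius_function_eq_zero)
  have no: "norm (f (?N z)) < 1" "norm (?M (g z)) < 1" if "norm z < 1" for z
    by (rule fg MN that)+
  have S1: "norm (f (?N z)) \<le> norm z" if "norm z < 1" for z
    by (rule Schwarz_Lemma(1)[OF hf z0(1) no(1) that])
  have S2: "norm (?M (g z)) \<le> norm z" if "norm z < 1" for z
    by (rule Schwarz_Lemma(1)[OF hg z0(2) no(2) that])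
  \<comment> \<open>Equality in Schwarz's lemma at a single nonzero point makes the map a rotation;
    1/2 serves as that point, the bound for the inverse map giving the reverse inequality.\<close>
  have "norm (f (?N (1/2))) = norm (1/2 :: complex)"
  proof (rule antisym)
    show "norm (f (?N (1/2))) \<le> norm (1/2 :: complex)" by (rule S1) simp
    have half: "norm (1/2 :: complex) < 1" by simp
    have "g (f (?N (1/2))) = ?N (1/2)" by (rule inv(2)[OF MN(2)[OF half]])
    moreover have "?M (?N (1/2)) = 1/2" using a by (intro Moebius_function_compose) auto
    ultimately show "norm (1/2 :: complex) \<le> norm (f (?N (1/2)))"
      using S2[OF no(1)[OF half]] by (simp only:)
  qed
  hence "\<exists>z. norm z < 1 \<and> z \<noteq> 0 \<and> norm (f (?N z)) = norm z" by (intro exI[of _ "1/2"]) auto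
  then obtain \<alpha> where \<alpha>: "\<And>z. norm z < 1 \<Longrightarrow> f (?N z) = \<alpha> * z" "norm \<alpha> = 1"
    using Schwarz_Lemma(3)[OF hf z0(1) no(1), of 0] by auto
  have den: "1 - cnj a * z \<noteq> 0" if "norm z \<le> 1" for z
  proof
    assume "1 - cnj a * z = 0"
    hence "norm (cnj a * z) = 1" by (metis norm_one right_minus_eq)
    moreover have "norm (cnj a * z) < 1" using a that mult_left_le[of "norm z" "norm a"] by (simp add: norm_mult)
    ultimately show False by simp
  qed
  define h where "h = (\<lambda>z. f z * (1 - cnj a * z) - \<alpha> * (z - a))"
  have "h z = 0" if "norm z < 1" for z
  proof -
    have "f z = f (?N (?M z))" using Moebius_function_compose[of "-a" a z] a that by simp
    also have "\<dots> = \<alpha> * ?M z" by (intro \<alpha> MN that)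
    finally show ?thesis using den[of z] that by (simp add: h_def Moebius_function_simple)
  qed
  moreover have "continuous_on (cball 0 1) h" unfolding h_def by (intro continuous_intros cont)
  ultimately have h: "h z = 0" if "z \<in> cball 0 1" for z
    using continuous_constant_on_closure[of "ball 0 1" h 0 z] that by auto
  \<comment> \<open>The coefficients of \<alpha>(z - a) = z(1 - cnj a z), the fixed point equation
    cleared of its denominator.\<close>
  define p where "p = [: - \<alpha> * a, \<alpha> - 1, cnj a :]"
  have root: "poly p z = 0" if "f z = z" "z \<in> cball 0 1" for z
    using h[OF that(2)] that(1) by (simp add: h_def p_def algebra_simps)
  have "p = 0"
  proof (rule ccontr)
    assume p: "p \<noteq> 0"
    have "3 = card {x, y, w}" using fp by simp
    also have "\<dots> \<le> card {z. poly p z = 0}"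
      using root fp xyw p by (intro card_mono poly_roots_finite) auto
    also have "\<dots> \<le> degree p" using p by (rule card_poly_roots_bound)
    also have "\<dots> \<le> 2" by (simp add: p_def)
    finally show False by simp
  qed
  hence "a = 0" "\<alpha> = 1" by (auto simp: p_def)
  thus ?thesis using h[OF z] by (simp add: h_def)
qed

section \<open>Schwarz--Christoffel maps\<close>

text \<open>A logarithm of the Schwarz-Christoffel derivative, with prevertices recorded by their
  angles and exterior angles pi times \<alpha>. Inside the disc each factor has positive real part,
  so principal logarithms give a holomorphic branch.\<close>

definition sc_exponent :: "real set \<Rightarrow> (real \<Rightarrow> real) \<Rightarrow> complex \<Rightarrow> complex" where
  "sc_exponent T \<alpha> z = - (\<Sum>t\<in>T. of_real (\<alpha> t) * Ln (1 - z * cis (- t)))"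

definition sc_deriv :: "real set \<Rightarrow> (real \<Rightarrow> real) \<Rightarrow> complex \<Rightarrow> complex" where
  "sc_deriv T \<alpha> z = exp (sc_exponent T \<alpha> z)"

text \<open>The plane without the outward rays from the prevertices. It contains the closed disc
  apart from the prevertices and is starlike about 0, so the derivative has a primitive across the
  boundary arcs.\<close>

definition slit_plane :: "real set \<Rightarrow> complex set" where
  "slit_plane T = {z. \<forall>t\<in>T. 1 - z * cis (- t) \<notin> \<real>\<^sub>\<le>\<^sub>0}"

lemma open_slit_plane: "finite T \<Longrightarrow> open (slit_plane T)"
proof -
  assume "finite T"
  have "slit_plane T = (\<Inter>t\<in>T. (\<lambda>z. 1 - z * cis (- t)) -` (- \<real>\<^sub>\<le>\<^sub>0))"
    by (auto simp: slit_plane_def)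
  also have "open \<dots>" using \<open>finite T\<close>
    by (intro open_INT ballI open_vimage continuous_intros) auto
  finally show ?thesis .
qed

lemma in_slit_plane:
  assumes "norm z \<le> 1" "\<And>t. t \<in> T \<Longrightarrow> z \<noteq> cis t"
  shows "z \<in> slit_plane T"
  unfolding slit_plane_def
proof safe
  fix t assume t: "t \<in> T" "1 - z * cis (- t) \<in> \<real>\<^sub>\<le>\<^sub>0"
  define u where "u = z * cis (- t)"
  have zu: "z = u * cis t" by (simp add: u_def mult.assoc cis_mult)
  have u: "norm u \<le> 1" using assms(1) by (simp add: u_def norm_mult)
  have "Im u = 0" "Re u \<ge> 1" using t(2) by (auto simp: u_def[symmetric] complex_nonpos_Reals_iff)
  moreover have "Re u \<le> 1" using u complex_Re_le_cmod[of u] by linarith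
  ultimately have "u = 1" by (simp add: complex_eq_iff)
  thus False using assms(2)[OF t(1)] zu by simp
qed

lemma ball_subset_slit_plane: "norm z < 1 \<Longrightarrow> z \<in> slit_plane T"
  by (intro in_slit_plane) auto

lemma starlike_slit_plane: "starlike (slit_plane T)"
  unfolding starlike_def
proof (intro bexI[of _ 0] ballI subsetI)
  show "0 \<in> slit_plane T" by (intro ball_subset_slit_plane) simp
  fix z w assume z: "z \<in> slit_plane T" "w \<in> closed_segment 0 z"
  then obtain s where s: "0 \<le> s" "s \<le> 1" "w = of_real s * z"
    by (auto simp: in_segment scaleR_conv_of_real)
  show "w \<in> slit_plane T" unfolding slit_plane_def
  proof safe
    fix t assume t: "t \<in> T" "1 - w * cis (- t) \<in> \<real>\<^sub>\<le>\<^sub>0"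
    define u where "u = z * cis (- t)"
    have "1 - of_real s * u \<in> \<real>\<^sub>\<le>\<^sub>0" using t(2) by (simp add: u_def s(3) mult.assoc)
    hence "s * Im u = 0" "s * Re u \<ge> 1" by (auto simp: complex_nonpos_Reals_iff)
    hence "s > 0" using s by (cases "s = 0") auto
    hence "Im u = 0" using \<open>s * Im u = 0\<close> by simp
    moreover have "Re u \<ge> 1"
      using \<open>s * Re u \<ge> 1\<close> s \<open>s > 0\<close> by (smt (verit) mult_left_le_one_le mult_nonneg_nonpos)
    ultimately have "1 - u \<in> \<real>\<^sub>\<le>\<^sub>0" by (auto simp: complex_nonpos_Reals_iff)
    thus False using z(1) t(1) by (auto simp: slit_plane_def u_def)
  qed
qed

lemma sc_deriv_holomorphic: "sc_deriv T \<alpha> holomorphic_on slit_plane T"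
  unfolding sc_deriv_def sc_exponent_def
  by (intro holomorphic_intros) (auto simp: slit_plane_def)

lemma norm_sc_deriv:
  assumes "finite T" "\<And>t. t \<in> T \<Longrightarrow> z \<noteq> cis t"
  shows "norm (sc_deriv T \<alpha> z) = exp (- (\<Sum>t\<in>T. \<alpha> t * ln (norm (1 - z * cis (- t)))))"
proof -
  have "Re (sc_exponent T \<alpha> z) = - (\<Sum>t\<in>T. \<alpha> t * ln (norm (1 - z * cis (- t))))"
    unfolding sc_exponent_def
  proof (simp, intro sum.cong refl)
    fix t assume t: "t \<in> T"
    have "1 - z * cis (- t) \<noteq> 0"
    proof
      assume "1 - z * cis (- t) = 0"
      hence "z * cis (- t) * cis t = cis t" by simp
      hence "z = cis t" by (simp add: mult.assoc cis_mult)
      thus False using assms(2)[OF t] by simp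
    qed
    thus "\<alpha> t * Re (Ln (1 - z * cis (- t))) = \<alpha> t * ln (norm (1 - z * cis (- t)))" by simp
  qed
  thus ?thesis by (simp add: sc_deriv_def)
qed

lemma norm_one_minus_mult_cis: "norm (1 - z * cis (- t)) = norm (z - cis t)"
proof -
  have "z - cis t = - ((1 - z * cis (- t)) * cis t)" by (simp add: algebra_simps cis_mult)
  thus ?thesis by (simp only: norm_minus_cancel norm_mult norm_cis mult_1_right)
qed

text \<open>Near the circle at most one factor of the derivative is large, and its exponent is at most \<open>2/3\<close>.\<close>
lemma sc_deriv_bound:
  assumes T: "finite T" "inj_on cis T" and \<alpha>: "\<And>t. t \<in> T \<Longrightarrow> 0 \<le> \<alpha> t \<and> \<alpha> t \<le> 2 / 3"
  obtains K where "\<And>z. norm z < 1 \<Longrightarrow> norm (sc_deriv T \<alpha> z) \<le> K * (1 - norm z) powr (- 2 / 3)"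
proof -
  have fin: "finite (cis ` T)" using T by simp
  obtain d where d: "d > 0" "\<And>s t. s \<in> T \<Longrightarrow> t \<in> T \<Longrightarrow> s \<noteq> t \<Longrightarrow> d \<le> norm (cis s - cis t)"
  proof -
    have "\<exists>d>0. \<forall>t\<in>T. t \<noteq> s \<longrightarrow> d \<le> norm (cis s - cis t)" if "s \<in> T" for s
    proof -
      obtain d where d: "d > 0" "\<And>x. x \<in> cis ` T \<Longrightarrow> x \<noteq> cis s \<Longrightarrow> d \<le> dist (cis s) x"
        using finite_set_avoid[OF fin, of "cis s"] by auto
      have "d \<le> norm (cis s - cis t)" if "t \<in> T" "t \<noteq> s" for t
        using d(2)[of "cis t"] that \<open>s \<in> T\<close> T(2) by (auto simp: dist_norm inj_on_def)
      thus ?thesis using d(1) by blast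
    qed
    then obtain D where D: "\<And>s. s \<in> T \<Longrightarrow> D s > 0" "\<And>s t. s \<in> T \<Longrightarrow> t \<in> T \<Longrightarrow> t \<noteq> s \<Longrightarrow> D s \<le> norm (cis s - cis t)"
      by metis
    define d where "d = Min (insert 1 (D ` T))"
    have "d > 0" "\<And>s. s \<in> T \<Longrightarrow> d \<le> D s" using T(1) D(1) by (auto simp: d_def)
    thus ?thesis using D(2) that[of d] by (metis order_trans)
  qed
  \<comment> \<open>At most one prevertex lies closer than half the separation \<open>d\<close>; the
    cap 1 keeps - ln e nonnegative.\<close>
  define e where "e = min 1 (d / 2)"
  have e: "0 < e" "e \<le> 1" "2 * e \<le> d" using d(1) by (auto simp: e_def)
  show ?thesis
  proof
    fix z :: complex assume z: "norm z < 1"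
    define m where "m = (\<lambda>t. norm (1 - z * cis (- t)))"
    have m_ge: "1 - norm z \<le> m t" for t
      using norm_triangle_ineq2[of 1 "z * cis (- t)"] by (simp add: m_def norm_mult)
    have sep: "e \<le> m t" if "s \<in> T" "t \<in> T" "s \<noteq> t" "m s < e" for s t
    proof (rule ccontr)
      assume "\<not> e \<le> m t"
      hence "norm (z - cis s) + norm (z - cis t) < d" using that e by (simp add: m_def norm_one_minus_mult_cis)
      moreover have "norm (cis s - cis t) \<le> norm (z - cis s) + norm (z - cis t)"
        using norm_triangle_ineq[of "cis s - z" "z - cis t"] by (simp add: norm_minus_commute)
      ultimately show False using d(2)[OF that(1-3)] by linarith
    qed
    have term_e: "- (\<alpha> t * ln (m t)) \<le> \<alpha> t * (- ln e)" if "t \<in> T" "e \<le> m t" for t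
      using that e \<alpha>[of t] by (simp add: mult_left_mono)
    have ln0: "ln (1 - norm z) \<le> 0" "ln e \<le> 0" using z e by simp_all
    have "(\<Sum>t\<in>T. - (\<alpha> t * ln (m t))) \<le> - (2 / 3) * ln (1 - norm z) + (\<Sum>t\<in>T. \<alpha> t * (- ln e))"
    proof (cases "\<exists>s\<in>T. m s < e")
      case False
      hence "(\<Sum>t\<in>T. - (\<alpha> t * ln (m t))) \<le> (\<Sum>t\<in>T. \<alpha> t * (- ln e))"
        by (intro sum_mono term_e) (auto simp: not_less)
      thus ?thesis using ln0 by linarith
    next
      case True
      then obtain s where s: "s \<in> T" "m s < e" by blast
      have "- (\<alpha> s * ln (m s)) \<le> \<alpha> s * (- ln (1 - norm z))"
        using m_ge[of s] z \<alpha>[OF s(1)] by (simp add: mult_left_mono)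
      also have "\<dots> \<le> 2 / 3 * (- ln (1 - norm z))" using \<alpha>[OF s(1)] ln0 by (intro mult_right_mono) auto
      also have "\<dots> \<le> - (2 / 3) * ln (1 - norm z) + \<alpha> s * (- ln e)" using \<alpha>[OF s(1)] ln0 by (simp add: mult_nonneg_nonpos)
      finally have 1: "- (\<alpha> s * ln (m s)) \<le> - (2 / 3) * ln (1 - norm z) + \<alpha> s * (- ln e)" .
      have 2: "(\<Sum>t\<in>T - {s}. - (\<alpha> t * ln (m t))) \<le> (\<Sum>t\<in>T - {s}. \<alpha> t * (- ln e))"
        using sep[OF s(1)] s by (intro sum_mono term_e) auto
      show ?thesis using 1 2 unfolding sum.remove[OF T(1) s(1)] by linarith
    qed
    hence "norm (sc_deriv T \<alpha> z) \<le> exp (- (2 / 3) * ln (1 - norm z) + (\<Sum>t\<in>T. \<alpha> t * (- ln e)))"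
      using z by (subst norm_sc_deriv[OF T(1)]) (auto simp: m_def sum_negf)
    also have "\<dots> = exp (\<Sum>t\<in>T. \<alpha> t * (- ln e)) * (1 - norm z) powr (- 2 / 3)"
    proof -
      have "(1 - norm z) powr (- 2 / 3) = exp (- (2 / 3) * ln (1 - norm z))"
        using z by (simp add: powr_def)
      thus ?thesis by (simp only: exp_add mult.commute)
    qed
    finally show "norm (sc_deriv T \<alpha> z) \<le> exp (\<Sum>t\<in>T. \<alpha> t * (- ln e)) * (1 - norm z) powr (- 2 / 3)" .
  qed
qed

text \<open>Two constructions are glued: a primitive on the slit plane gives derivatives along the
  open boundary arcs, and the uniform limit of dilations gives continuity also at the prevertices.
  Radial limits show that they agree on the arcs.\<close>

lemma sc_map_exists:
  assumes T: "finite T" "inj_on cis T" and \<alpha>: "\<And>t. t \<in> T \<Longrightarrow> 0 \<le> \<alpha> t \<and> \<alpha> t \<le> 2 / 3"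
  obtains f where "continuous_on (cball 0 1) f"
    "\<And>z. norm z < 1 \<Longrightarrow> (f has_field_derivative sc_deriv T \<alpha> z) (at z)"
    "\<And>\<theta>. (\<And>t. t \<in> T \<Longrightarrow> cis \<theta> \<noteq> cis t) \<Longrightarrow>
       ((\<lambda>\<theta>. f (cis \<theta>)) has_vector_derivative \<i> * cis \<theta> * sc_deriv T \<alpha> (cis \<theta>)) (at \<theta>)"
proof -
  have op: "open (slit_plane T)" using T(1) by (rule open_slit_plane)
  obtain F where F: "\<And>z. z \<in> slit_plane T \<Longrightarrow> (F has_field_derivative sc_deriv T \<alpha> z) (at z)"
    using holomorphic_starlike_primitive[OF holomorphic_on_imp_continuous_on[OF sc_deriv_holomorphic] starlike_slit_plane op finite.emptyI]
      holomorphic_on_imp_differentiable_at[OF sc_deriv_holomorphic op] by blast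
  obtain K where K: "\<And>z. norm z < 1 \<Longrightarrow> norm (sc_deriv T \<alpha> z) \<le> K * (1 - norm z) powr (- 2 / 3)"
    by (rule sc_deriv_bound[OF T, of \<alpha>]) (use \<alpha> in auto)
  obtain f where f: "continuous_on (cball 0 1) f" "\<And>z. norm z < 1 \<Longrightarrow> f z = F z"
    using continuous_extension_to_closed_disc[OF F[OF ball_subset_slit_plane] K] by blast
  have eq: "f z = F z" if "norm z \<le> 1" "z \<in> slit_plane T" for z
  proof (cases "norm z < 1")
    case False
    define \<rho> where "\<rho> = (\<lambda>n. 1 - 1 / real (Suc n))"
    have "(\<lambda>n. of_real (\<rho> n) * z) \<longlonglongrightarrow> of_real (1 - 0) * z"
      unfolding \<rho>_def by (intro tendsto_intros LIMSEQ_Suc[OF lim_1_over_n])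
    hence lim: "(\<lambda>n. of_real (\<rho> n) * z) \<longlonglongrightarrow> z" by simp
    have \<rho>: "0 \<le> \<rho> n" "\<rho> n < 1" for n by (auto simp: \<rho>_def divide_simps)
    have nz: "norm (of_real (\<rho> n) * z) < 1" for n
      using \<rho>[of n] False that by (simp add: norm_mult)
    have "(\<lambda>n. f (of_real (\<rho> n) * z)) \<longlonglongrightarrow> f z"
      using that nz by (intro continuous_on_tendsto_compose[OF f(1) lim] always_eventually) (auto intro: less_imp_le)
    moreover have "(\<lambda>n. F (of_real (\<rho> n) * z)) \<longlonglongrightarrow> F z"
      by (rule isCont_tendsto_compose[OF DERIV_isCont[OF F[OF that(2)]] lim])
    ultimately show ?thesis using f(2)[OF nz] LIMSEQ_unique by simp
  qed (use f in auto)
  show ?thesis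
  proof
    show "continuous_on (cball 0 1) f" by (rule f(1))
    show "(f has_field_derivative sc_deriv T \<alpha> z) (at z)" if "norm z < 1" for z
    proof (rule has_field_derivative_transform_within_open[OF F[OF ball_subset_slit_plane[OF that]]])
      show "F w = f w" if "w \<in> ball 0 1" for w using f(2)[of w] that by simp
    qed (use that in auto)
    fix \<theta> assume \<theta>: "\<And>t. t \<in> T \<Longrightarrow> cis \<theta> \<noteq> cis t"
    have in_slit: "cis \<theta> \<in> slit_plane T" using \<theta> by (intro in_slit_plane) auto
    have "(cis has_vector_derivative \<i> * cis \<theta>) (at \<theta>)"
      using has_derivative_cis[OF has_derivative_ident, of \<theta> UNIV]
      by (simp add: has_vector_derivative_def)
    from field_vector_diff_chain_at[OF this F[OF in_slit]]
    have "((\<lambda>\<theta>. F (cis \<theta>)) has_vector_derivative \<i> * cis \<theta> * sc_deriv T \<alpha> (cis \<theta>)) (at \<theta>)"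
      by (simp add: o_def)
    moreover have "open (cis -` slit_plane T)"
      using op by (intro open_vimage continuous_intros) (auto intro: continuous_on_cis)
    moreover have "F (cis x) = f (cis x)" if "x \<in> cis -` slit_plane T" for x
      using eq[of "cis x"] that by simp
    ultimately show "((\<lambda>\<theta>. f (cis \<theta>)) has_vector_derivative \<i> * cis \<theta> * sc_deriv T \<alpha> (cis \<theta>)) (at \<theta>)"
      using in_slit by (auto intro: has_vector_derivative_transform_within_open)
  qed
qed

lemma one_minus_cis: "1 - cis x = of_real (2 * sin (x / 2)) * cis ((x - pi) / 2)"
proof -
  have "cos x = 1 - 2 * sin (x / 2) ^ 2" "sin x = 2 * sin (x / 2) * cos (x / 2)"
    using cos_double_sin[of "x / 2"] sin_double[of "x / 2"] by simp_all
  moreover have "cos ((x - pi) / 2) = sin (x / 2)" "sin ((x - pi) / 2) = - cos (x / 2)"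
    by (simp_all add: diff_divide_distrib cos_diff sin_diff)
  ultimately show ?thesis by (simp add: complex_eq_iff power2_eq_square)
qed

lemma cis_minus_2pi: "cis (x - 2 * pi) = cis x"
  by (simp add: complex_eq_iff cos_diff sin_diff)

lemma exp_polar: "exp w = of_real (norm (exp w)) * cis (Im w)"
  unfolding norm_exp_eq_Re by (rule exp_eq_polar)

lemma norm_one_minus_cis: "norm (1 - cis x) = 2 * \<bar>sin (x / 2)\<bar>"
  unfolding one_minus_cis by (simp add: norm_mult)

lemma Im_Ln_one_minus_cis:
  assumes "0 < x" "x < 2 * pi" shows "Im (Ln (1 - cis x)) = (x - pi) / 2"
proof -
  have s: "sin (x / 2) > 0" using assms by (intro sin_gt_zero) auto
  have e: "exp (of_real (ln (2 * sin (x / 2)))) = complex_of_real (2 * sin (x / 2))"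
    using s by (simp add: exp_of_real)
  have "1 - cis x = exp (of_real (ln (2 * sin (x / 2))) + \<i> * of_real ((x - pi) / 2))"
    unfolding one_minus_cis exp_add e by (simp only: cis_conv_exp)
  moreover have "Ln (exp (of_real (ln (2 * sin (x / 2))) + \<i> * of_real ((x - pi) / 2))) =
      of_real (ln (2 * sin (x / 2))) + \<i> * of_real ((x - pi) / 2)"
    using assms by (intro Ln_exp) auto
  ultimately show ?thesis by simp
qed

text \<open>The argument of the boundary derivative is constant between two prevertices and jumps by
  \<open>\<pi> \<alpha> t\<close> at the prevertex \<open>cis t\<close>.\<close>
lemma sc_boundary_direction:
  assumes T: "finite T" "T \<subseteq> {0..<2 * pi}" and \<alpha>: "(\<Sum>t\<in>T. \<alpha> t) = 2"
    and \<theta>: "0 \<le> \<theta>" "\<theta> < 2 * pi" "\<theta> \<notin> T"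
  shows "\<i> * cis \<theta> * sc_deriv T \<alpha> (cis \<theta>) = of_real (norm (sc_deriv T \<alpha> (cis \<theta>))) *
     cis (pi / 2 + (\<Sum>t\<in>T. \<alpha> t * ((t + pi) / 2)) + pi * (\<Sum>t\<in>{t\<in>T. t < \<theta>}. \<alpha> t))"
proof -
  let ?c = "\<Sum>t\<in>T. \<alpha> t * ((t + pi) / 2)"
  \<comment> \<open>The formula for the argument needs an angle between 0 and 2 pi, so the
    difference is raised by 2 pi for prevertices ahead of \<theta>.\<close>
  have LnT: "Im (Ln (1 - cis \<theta> * cis (- t))) = (\<theta> - t + (if t < \<theta> then 0 else 2 * pi) - pi) / 2" if t: "t \<in> T" for t
  proof -
    have t': "0 \<le> t" "t < 2 * pi" "t \<noteq> \<theta>" using t T \<theta> by auto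
    show ?thesis
    proof (cases "t < \<theta>")
      case True
      thus ?thesis using Im_Ln_one_minus_cis[of "\<theta> - t"] t' \<theta> by (simp add: cis_mult)
    next
      case False
      have "cis (\<theta> - t) = cis (\<theta> - t + 2 * pi)" by (simp add: complex_eq_iff)
      thus ?thesis using Im_Ln_one_minus_cis[of "\<theta> - t + 2 * pi"] False t' \<theta> by (simp add: cis_mult)
    qed
  qed
  have "Im (sc_exponent T \<alpha> (cis \<theta>)) = - (\<Sum>t\<in>T. \<alpha> t * Im (Ln (1 - cis \<theta> * cis (- t))))"
    by (simp add: sc_exponent_def)
  also have "\<dots> = - (\<Sum>t\<in>T. \<alpha> t * ((\<theta> - t + (if t < \<theta> then 0 else 2 * pi) - pi) / 2))"
    by (simp only: LnT cong: sum.cong)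
  also have "\<dots> = (\<Sum>t\<in>T. - \<theta> / 2 * \<alpha> t + \<alpha> t * ((t + pi) / 2) - pi * \<alpha> t + pi * (if t < \<theta> then \<alpha> t else 0))"
    unfolding sum_negf[symmetric] by (intro sum.cong refl) (simp add: field_simps)
  also have "\<dots> = - \<theta> / 2 * (\<Sum>t\<in>T. \<alpha> t) + ?c - pi * (\<Sum>t\<in>T. \<alpha> t) + pi * (\<Sum>t\<in>T. if t < \<theta> then \<alpha> t else 0)"
    unfolding sum.distrib sum_subtractf sum_distrib_left by simp
  also have "(\<Sum>t\<in>T. if t < \<theta> then \<alpha> t else 0) = (\<Sum>t\<in>{t\<in>T. t < \<theta>}. \<alpha> t)"
    using T(1) by (simp add: sum.inter_filter)
  \<comment> \<open>Because the exponents sum to 2, \<theta> itself enters only as -\<theta>, and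
    the factor cis \<theta> of the tangent cancels it: the direction is piecewise constant.\<close>
  finally have "Im (sc_exponent T \<alpha> (cis \<theta>)) = - \<theta> + ?c - 2 * pi + pi * (\<Sum>t\<in>{t\<in>T. t < \<theta>}. \<alpha> t)"
    unfolding \<alpha> by simp
  hence "sc_deriv T \<alpha> (cis \<theta>) = of_real (norm (sc_deriv T \<alpha> (cis \<theta>))) *
      cis (- \<theta> + ?c - 2 * pi + pi * (\<Sum>t\<in>{t\<in>T. t < \<theta>}. \<alpha> t))"
    using exp_polar[of "sc_exponent T \<alpha> (cis \<theta>)"] by (simp only: sc_deriv_def)
  hence "\<i> * cis \<theta> * sc_deriv T \<alpha> (cis \<theta>) = of_real (norm (sc_deriv T \<alpha> (cis \<theta>))) *
      (cis (pi / 2) * cis \<theta> * cis (- \<theta> + ?c - 2 * pi + pi * (\<Sum>t\<in>{t\<in>T. t < \<theta>}. \<alpha> t)))"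
    by simp
  also have "cis (pi / 2) * cis \<theta> * cis (- \<theta> + ?c - 2 * pi + pi * (\<Sum>t\<in>{t\<in>T. t < \<theta>}. \<alpha> t)) =
      cis (pi / 2 + ?c + pi * (\<Sum>t\<in>{t\<in>T. t < \<theta>}. \<alpha> t) - 2 * pi)"
    unfolding cis_mult by (simp add: algebra_simps)
  also have "\<dots> = cis (pi / 2 + ?c + pi * (\<Sum>t\<in>{t\<in>T. t < \<theta>}. \<alpha> t))"
    by (rule cis_minus_2pi)
  finally show ?thesis .
qed

definition edge_length :: "(complex \<Rightarrow> complex) \<Rightarrow> real \<Rightarrow> real \<Rightarrow> real \<Rightarrow> real" where
  "edge_length f c a \<theta> = Re (cis (- c) * (f (cis \<theta>) - f (cis a)))"

lemma straight_edge:
  fixes f :: "complex \<Rightarrow> complex"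
  assumes cont: "continuous_on (cball 0 1) f" and ab: "a < b"
    and edge_der: "\<forall>\<theta>\<in>{a<..<b}. ((\<lambda>\<theta>. f (cis \<theta>)) has_vector_derivative of_real (m \<theta>) * cis c) (at \<theta>)"
    and edge_pos: "\<forall>\<theta>\<in>{a<..<b}. m \<theta> > 0"
  shows "\<And>\<theta>. a \<le> \<theta> \<Longrightarrow> \<theta> \<le> b \<Longrightarrow> f (cis \<theta>) = f (cis a) + of_real (edge_length f c a \<theta>) * cis c"
    and "continuous_on {a..b} (edge_length f c a)"
    and "\<And>\<theta>. a < \<theta> \<Longrightarrow> \<theta> < b \<Longrightarrow> (edge_length f c a has_field_derivative m \<theta>) (at \<theta>)"
    and "\<And>\<theta>. a \<le> \<theta> \<Longrightarrow> \<theta> \<le> b \<Longrightarrow> 0 \<le> edge_length f c a \<theta> \<and> edge_length f c a \<theta> \<le> edge_length f c a b"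
    and "0 < edge_length f c a b"
proof -
  have der: "((\<lambda>\<theta>. f (cis \<theta>)) has_vector_derivative of_real (m \<theta>) * cis c) (at \<theta>)"
    and pos: "m \<theta> > 0" if "a < \<theta>" "\<theta> < b" for \<theta>
    using edge_der edge_pos that by auto
  define G where "G = (\<lambda>\<theta>. cis (- c) * (f (cis \<theta>) - f (cis a)))"
  have dG: "(G has_vector_derivative of_real (m \<theta>)) (at \<theta>)" if "a < \<theta>" "\<theta> < b" for \<theta>
  proof -
    have "(G has_vector_derivative cis (- c) * (of_real (m \<theta>) * cis c - 0)) (at \<theta>)"
      unfolding G_def by (intro has_vector_derivative_mult_right has_vector_derivative_diff der that has_vector_derivative_const)
    also have "cis (- c) * (of_real (m \<theta>) * cis c - 0) = of_real (m \<theta>) * (cis (- c) * cis c)" by simp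
    finally show ?thesis by (simp only: cis_mult) simp
  qed
  have cG: "continuous_on {a..b} G" unfolding G_def
    by (intro continuous_intros continuous_on_compose2[OF cont]) auto
  have L: "edge_length f c a = (\<lambda>\<theta>. Re (G \<theta>))" by (simp add: edge_length_def G_def fun_eq_iff)
  show cL: "continuous_on {a..b} (edge_length f c a)" unfolding L by (intro continuous_intros cG)
  show dL: "(edge_length f c a has_field_derivative m \<theta>) (at \<theta>)" if "a < \<theta>" "\<theta> < b" for \<theta>
    using bounded_linear.has_vector_derivative[OF bounded_linear_Re dG[OF that]]
    by (simp add: L has_real_derivative_iff_has_vector_derivative)
  have mono: "edge_length f c a x < edge_length f c a y" if "a \<le> x" "x < y" "y \<le> b" for x y
  proof (rule DERIV_pos_imp_increasing_open[OF that(2)])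
    show "continuous_on {x..y} (edge_length f c a)" using continuous_on_subset[OF cL] that by simp
  qed (use dL pos that in \<open>meson less_le_trans le_less_trans\<close>)
  have L0: "edge_length f c a a = 0" by (simp add: edge_length_def)
  show "0 < edge_length f c a b" using mono[of a b] ab L0 by simp
  show "0 \<le> edge_length f c a \<theta> \<and> edge_length f c a \<theta> \<le> edge_length f c a b" if "a \<le> \<theta>" "\<theta> \<le> b" for \<theta>
    using mono[of a \<theta>] mono[of \<theta> b] that L0 ab by (cases "\<theta> = a"; cases "\<theta> = b"; fastforce)
  show "f (cis \<theta>) = f (cis a) + of_real (edge_length f c a \<theta>) * cis c" if "a \<le> \<theta>" "\<theta> \<le> b" for \<theta>
  proof -
    have dI: "((\<lambda>\<theta>. Im (G \<theta>)) has_field_derivative 0) (at \<theta>)" if "a < \<theta>" "\<theta> < b" for \<theta>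
      using bounded_linear.has_vector_derivative[OF bounded_linear_Im dG[OF that]]
      by (simp add: has_real_derivative_iff_has_vector_derivative)
    have "Im (G \<theta>) = Im (G a)"
      by (rule DERIV_isconst2[OF ab _ dI that]) (intro continuous_intros cG)
    hence "G \<theta> = of_real (edge_length f c a \<theta>)" by (simp add: L complex_eq_iff G_def)
    hence "cis c * G \<theta> = of_real (edge_length f c a \<theta>) * cis c" by (simp add: mult.commute)
    moreover have "cis c * G \<theta> = f (cis \<theta>) - f (cis a)" by (simp add: G_def mult.assoc[symmetric] cis_mult)
    ultimately show ?thesis by (simp add: diff_eq_eq add.commute)
  qed
qed

lemma cube_factorization: "(1 - z) * (1 - z * cis (- (2 * pi / 3))) * (1 - z * cis (- (4 * pi / 3))) = 1 - z ^ 3"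
proof -
  define w where "w = cis (- (2 * pi / 3))"
  have "cis (- (4 * pi / 3)) = w\<^sup>2" by (simp add: w_def power2_eq_square cis_mult)
  moreover have w2: "w\<^sup>2 = - 1 - w"
    by (simp add: w_def power2_eq_square complex_eq_iff cos_120 sin_120)
  moreover have w3: "w ^ 3 = 1"
  proof -
    have "w ^ 3 - 1 = (w - 1) * (w\<^sup>2 + w + 1)" by (simp add: power2_eq_square power3_eq_cube algebra_simps)
    thus ?thesis using w2 by simp
  qed
  moreover have "(1 - z) * (1 - z * w) * (1 - z * w\<^sup>2) = 1 - (1 + w + w\<^sup>2) * z + (w + w\<^sup>2 + w ^ 3) * z\<^sup>2 - w ^ 3 * z ^ 3"
    by (simp add: algebra_simps power2_eq_square power3_eq_cube)
  ultimately show ?thesis by (simp add: w_def[symmetric])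
qed

section \<open>Prevertices and the half-plane estimate\<close>

definition par_angles :: "real \<Rightarrow> real set" where "par_angles B = {0, 2 * pi / 3, B, 4 * pi / 3}"
text \<open>\<gamma> = 1/3 yields the exterior angles of the parallelogram; \<gamma> = 0 makes the
  prevertex \<open>B\<close> inert and yields the triangle. One estimate then serves both
  maps.\<close>

definition par_exponent :: "real \<Rightarrow> real \<Rightarrow> real \<Rightarrow> real" where
  "par_exponent B \<gamma> t = (if t = 0 then 2 / 3 - \<gamma> else if t = B then \<gamma> else 2 / 3)"

lemma par_sum:
  assumes "2 * pi / 3 < B" "B < 4 * pi / 3"
  shows "(\<Sum>t\<in>par_angles B. par_exponent B \<gamma> t * F t) =
     (2 / 3 - \<gamma>) * F 0 + 2 / 3 * F (2 * pi / 3) + \<gamma> * F B + 2 / 3 * F (4 * pi / 3)"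
  using assms by (simp add: par_angles_def par_exponent_def)

lemma cos_pos_wide:
  assumes "- (3 * pi / 2) < x" "x < 3 * pi / 2" "cos x > 0"
  shows "- (pi / 2) < x" "x < pi / 2"
proof -
  have *: "cos y \<le> 0" if "pi / 2 \<le> y" "y \<le> 3 * pi / 2" for y
  proof -
    have "cos y = - sin (y - pi / 2)" by (simp add: sin_diff)
    moreover have "sin (y - pi / 2) \<ge> 0" using that by (intro sin_ge_zero) auto
    ultimately show ?thesis by simp
  qed
  show "- (pi / 2) < x"
  proof (rule ccontr)
    assume "\<not> - (pi / 2) < x"
    hence "cos (- x) \<le> 0" using assms(1) by (intro *) auto
    thus False using assms(3) by simp
  qed
  show "x < pi / 2"
  proof (rule ccontr)
    assume "\<not> x < pi / 2"
    hence "cos x \<le> 0" using assms(2) by (intro *) auto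
    thus False using assms(3) by simp
  qed
qed

lemma sin_pos_wide:
  assumes "- pi < x" "x < 2 * pi" "sin x > 0" shows "0 < x" "x < pi"
proof -
  have "sin x = - cos (x + pi / 2)" by (simp add: cos_add)
  moreover have "sin x \<le> 0" if "x \<le> 0" using sin_ge_zero[of "- x"] that assms by auto
  moreover have "sin x \<le> 0" if "pi \<le> x" using sin_ge_zero[of "x - pi"] that assms by (auto simp: sin_diff)
  ultimately show "0 < x" "x < pi" using assms by (auto simp: not_le[symmetric])
qed

lemma Re_one_minus_pos: "norm z < 1 \<Longrightarrow> Re (1 - z * cis t) > 0"
  using complex_Re_le_cmod[of "z * cis t"] by (simp add: norm_mult del: times_complex.simps)

text \<open>The argument of the derivative is -(2/3) S + \<gamma> D. The three factors at the cube
  roots of unity multiply to 1 - z^3, so |S| < pi/2. The quotient (1-z) / (1 - z cis(-B)) maps the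
  disc into a half-plane, so D lies within pi/2 of pi/2 - k. After the rotation the argument stays
  below pi/3 + pi/6 = pi/2 in modulus.\<close>

lemma par_deriv_half_plane:
  assumes B: "2 * pi / 3 < B" "B < 4 * pi / 3" and \<gamma>: "0 \<le> \<gamma>" "\<gamma> \<le> 1 / 3" and z: "norm z < 1"
  shows "Re (cis (- (\<gamma> * (B - pi) / 2)) * sc_deriv (par_angles B) (par_exponent B \<gamma>) z) > 0"
proof -
  define A where "A = (\<lambda>t. Im (Ln (1 - z * cis (- t))))"
  have A: "- (pi / 2) < A t" "A t < pi / 2" for t
    using Re_Ln_pos_lt_imp[OF Re_one_minus_pos[OF z, of "- t"]] by (auto simp: A_def)
  have nz: "1 - z * cis (- t) \<noteq> 0" for t using Re_one_minus_pos[OF z, of "- t"] by (metis less_irrefl zero_complex.sel(1))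
  define S where "S = A 0 + A (2 * pi / 3) + A (4 * pi / 3)"
  define L where "L = Ln (1 - z * cis (- 0)) + Ln (1 - z * cis (- (2 * pi / 3))) + Ln (1 - z * cis (- (4 * pi / 3)))"
  have "exp L = 1 - z ^ 3"
    unfolding L_def exp_add using nz[of 0] nz[of "2 * pi / 3"] nz[of "4 * pi / 3"] by (simp add: cube_factorization)
  moreover have "Re (1 - z ^ 3) > 0"
  proof -
    have "norm (z ^ 3) < 1" using z by (simp add: norm_power power_less_one_iff)
    thus ?thesis using complex_Re_le_cmod[of "z ^ 3"] by simp
  qed
  ultimately have "exp (Re L) * cos (Im L) > 0" by (metis Re_exp)
  hence "cos S > 0" by (simp add: S_def L_def A_def zero_less_mult_iff)
  moreover have "- (3 * pi / 2) < S" "S < 3 * pi / 2" using A[of 0] A[of "2 * pi / 3"] A[of "4 * pi / 3"] by (auto simp: S_def)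
  ultimately have S: "- (pi / 2) < S" "S < pi / 2" using cos_pos_wide by blast+
  \<comment> \<open>Half the angle -B modulo 2 pi, so that cis(-B) = (cis k)^2; multiplying the
    quotient by cis k turns its half-plane into the upper one.\<close>
  define k where "k = pi - B / 2"
  define D where "D = A 0 - A B"
  have "0 < sin (k + D)"
  proof -
    define c N M where "c = cis k" and "N = 1 - z * cis (- 0)" and "M = 1 - z * cis (- B)"
    have cB: "cis (- B) = c * c"
      using cis_minus_2pi[of "2 * pi - B"] by (simp add: c_def cis_mult k_def)
    have cc: "c * cnj c = 1" by (simp add: c_def cis_cnj cis_mult)
    have "c * N * cnj M = c * (1 - z) - (c * cnj c) * cnj c * cnj z * (1 - z)"
      unfolding N_def M_def cB by (simp add: algebra_simps)
    also have "\<dots> = c - (c * z + cnj (c * z)) + cnj c * (z * cnj z)"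
      unfolding cc by (simp add: algebra_simps)
    also have "z * cnj z = of_real ((norm z)\<^sup>2)" by (simp only: complex_norm_square)
    finally have "c * N * cnj M = c - (c * z + cnj (c * z)) + cnj c * of_real ((norm z)\<^sup>2)" .
    hence "Im (c * N * cnj M) = Im (c - (c * z + cnj (c * z)) + cnj c * of_real ((norm z)\<^sup>2))"
      by (simp only:)
    also have "\<dots> = sin k * (1 - (norm z)\<^sup>2)"
      by (simp add: c_def algebra_simps)
    finally have "Im (c * N * cnj M) = sin k * (1 - (norm z)\<^sup>2)" .
    moreover have "c * N * cnj M = of_real (norm N * norm M) * cis (k + D)"
    proof -
      have "N = of_real (norm N) * cis (A 0)" "M = of_real (norm M) * cis (A B)"
        using exp_polar[of "Ln N"] exp_polar[of "Ln M"] nz[of 0] nz[of B] by (simp_all add: N_def M_def A_def)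
      hence "c * N * cnj M = c * (of_real (norm N) * cis (A 0)) * cnj (of_real (norm M) * cis (A B))" by simp
      also have "\<dots> = of_real (norm N * norm M) * (cis k * cis (A 0) * cis (- A B))"
        by (simp add: c_def cis_cnj)
      finally show ?thesis by (simp add: cis_mult D_def add_diff_eq)
    qed
    ultimately have "norm N * norm M * sin (k + D) = sin k * (1 - (norm z)\<^sup>2)" by simp
    moreover have "sin k > 0" using B by (intro sin_gt_zero) (auto simp: k_def)
    moreover have "1 - (norm z)\<^sup>2 > 0" using z by (simp add: power_less_one_iff)
    ultimately have "norm N * norm M * sin (k + D) > 0" by simp
    moreover have "norm N * norm M \<ge> 0" by simp
    ultimately show ?thesis using zero_less_mult_iff[of "norm N * norm M" "sin (k + D)"] by linarith
  qed
  moreover have "- pi < k + D" "k + D < 2 * pi" using A[of 0] A[of B] B by (auto simp: k_def D_def)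
  ultimately have kD: "0 < k + D" "k + D < pi" using sin_pos_wide by blast+
  have "Im (sc_exponent (par_angles B) (par_exponent B \<gamma>) z) = - (\<Sum>t\<in>par_angles B. par_exponent B \<gamma> t * A t)"
    by (simp add: sc_exponent_def A_def)
  also have "\<dots> = - (2 / 3) * S + \<gamma> * D"
    unfolding par_sum[OF B] by (simp add: S_def D_def algebra_simps)
  finally have im: "Im (sc_exponent (par_angles B) (par_exponent B \<gamma>) z) = - (2 / 3) * S + \<gamma> * D" .
  define x where "x = - (2 / 3) * S + \<gamma> * (D + k - pi / 2)"
  have "\<bar>\<gamma> * (D + k - pi / 2)\<bar> \<le> 1 / 3 * (pi / 2)"
  proof -
    have "\<bar>D + k - pi / 2\<bar> \<le> pi / 2" using kD by (simp only: abs_le_iff) linarith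
    thus ?thesis unfolding abs_mult using \<gamma> by (intro mult_mono) auto
  qed
  hence "- (pi / 2) < x" "x < pi / 2" using S by (auto simp: x_def abs_le_iff)
  hence "cos x > 0" by (intro cos_gt_zero_pi) auto
  have "cis (- (\<gamma> * (B - pi) / 2)) * sc_deriv (par_angles B) (par_exponent B \<gamma>) z =
      of_real (norm (sc_deriv (par_angles B) (par_exponent B \<gamma>) z)) * cis x"
  proof -
    have "- (\<gamma> * (B - pi) / 2) + (- (2 / 3) * S + \<gamma> * D) = x"
      by (simp add: x_def k_def field_simps)
    moreover have "sc_deriv (par_angles B) (par_exponent B \<gamma>) z =
       of_real (norm (sc_deriv (par_angles B) (par_exponent B \<gamma>) z)) * cis (- (2 / 3) * S + \<gamma> * D)"
      using exp_polar[of "sc_exponent (par_angles B) (par_exponent B \<gamma>) z"] unfolding im sc_deriv_def .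
    ultimately show ?thesis by (metis cis_mult mult.left_commute)
  qed
  hence "Re (cis (- (\<gamma> * (B - pi) / 2)) * sc_deriv (par_angles B) (par_exponent B \<gamma>) z) =
      norm (sc_deriv (par_angles B) (par_exponent B \<gamma>) z) * cos x" by simp
  thus ?thesis using \<open>cos x > 0\<close> by (simp add: sc_deriv_def)
qed

section \<open>The boundary circle in the half-plane coordinate\<close>

text \<open>In the half-plane coordinate \<open>w\<close> with \<open>0\<close>, \<open>1\<close>, \<open>\<infinity>\<close> sent to the cube roots of unity
  \<open>cis (2 * pi / 3)\<close>, \<open>cis (4 * pi / 3)\<close>, \<open>1\<close>, the boundary point \<open>w\<close> is \<open>cis (circle_angle w)\<close>,
  and \<open>sqrt 3 / circle_scale w\<close> is the derivative of the angle.\<close>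
definition circle_angle :: "real \<Rightarrow> real" where "circle_angle w = pi + 2 * arctan ((2 * w - 1) / sqrt 3)"
definition circle_scale :: "real \<Rightarrow> real" where "circle_scale w = w\<^sup>2 - w + 1"

lemma circle_scale_pos: "circle_scale w > 0"
proof -
  have "circle_scale w = (w - 1/2)\<^sup>2 + 3/4" by (simp add: circle_scale_def power2_eq_square field_simps)
  moreover have "(w - 1/2)\<^sup>2 \<ge> 0" by simp
  ultimately show ?thesis by linarith
qed

lemma circle_angle_0: "circle_angle 0 = 2 * pi / 3" and circle_angle_1: "circle_angle 1 = 4 * pi / 3"
proof -
  have "arctan (1 / sqrt 3) = pi / 6"
    using tan_30 pi_gt_zero by (intro arctan_unique) auto
  thus "circle_angle 0 = 2 * pi / 3" "circle_angle 1 = 4 * pi / 3"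
    by (simp_all add: circle_angle_def arctan_minus)
qed

lemma circle_angle_has_derivative:
  "(circle_angle has_field_derivative sqrt 3 / circle_scale w) (at w)"
proof -
  have "(circle_angle has_field_derivative 2 * (2 / sqrt 3 / (1 + ((2 * w - 1) / sqrt 3)\<^sup>2))) (at w)"
    unfolding circle_angle_def by (auto intro!: derivative_eq_intros simp: divide_inverse)
  also have "1 + ((2 * w - 1) / sqrt 3)\<^sup>2 = 4 / 3 * circle_scale w"
    by (simp add: power_divide circle_scale_def power2_eq_square field_simps)
  also have "2 * (2 / sqrt 3 / (4 / 3 * circle_scale w)) = sqrt 3 / circle_scale w"
    using circle_scale_pos[of w] by (simp add: divide_simps)
  finally show ?thesis .
qed

lemma circle_angle_strict_mono: "v < w \<Longrightarrow> circle_angle v < circle_angle w"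
  by (simp add: circle_angle_def arctan_less_iff divide_strict_right_mono)

lemma circle_angle_range:
  assumes "0 < w" "w < 1" shows "2 * pi / 3 < circle_angle w" "circle_angle w < 4 * pi / 3"
  using circle_angle_strict_mono[OF assms(1)] circle_angle_strict_mono[OF assms(2)]
  by (simp_all add: circle_angle_0 circle_angle_1)

lemma circle_angle_continuous: "continuous_on S circle_angle"
  using circle_angle_has_derivative by (intro continuous_at_imp_continuous_on ballI DERIV_isCont)

lemma norm_one_minus_circle_0: "norm (1 - cis (circle_angle w) * cis (- 0)) = sqrt 3 / sqrt (circle_scale w)"
proof -
  have "norm (1 - cis (circle_angle w)) = 2 * \<bar>cos (arctan ((2 * w - 1) / sqrt 3))\<bar>"
    unfolding norm_one_minus_cis by (simp add: circle_angle_def add_divide_distrib sin_add)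
  also have "\<dots> = 2 / sqrt (1 + ((2 * w - 1) / sqrt 3)\<^sup>2)"
    by (simp add: cos_arctan)
  also have "1 + ((2 * w - 1) / sqrt 3)\<^sup>2 = 4 / 3 * circle_scale w"
    by (simp add: power_divide circle_scale_def power2_eq_square field_simps)
  also have "2 / sqrt (4 / 3 * circle_scale w) = sqrt 3 / sqrt (circle_scale w)"
    by (simp add: real_sqrt_mult real_sqrt_divide)
  finally show ?thesis by simp
qed

text \<open>A chord is twice the sine of half the angle difference, and here that half is a
  difference of arctangents. Distances to prevertices thus become |w - v|, up to scale
  factors.\<close>

lemma norm_one_minus_circle:
  "norm (1 - cis (circle_angle w) * cis (- circle_angle v)) =
     sqrt 3 * \<bar>w - v\<bar> / (sqrt (circle_scale w) * sqrt (circle_scale v))"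
proof -
  define a b where "a = (2 * w - 1) / sqrt 3" and "b = (2 * v - 1) / sqrt 3"
  have ab: "1 + a\<^sup>2 = 4 / 3 * circle_scale w" "1 + b\<^sup>2 = 4 / 3 * circle_scale v"
    by (simp_all add: a_def b_def power_divide circle_scale_def power2_eq_square field_simps)
  have s: "sqrt (1 + a\<^sup>2) * sqrt (1 + b\<^sup>2) = 4 / 3 * (sqrt (circle_scale w) * sqrt (circle_scale v))"
    unfolding ab by (simp add: real_sqrt_mult real_sqrt_divide)
  have "norm (1 - cis (circle_angle w) * cis (- circle_angle v)) = 2 * \<bar>sin (arctan a - arctan b)\<bar>"
  proof -
    have "(circle_angle w + - circle_angle v) / 2 = arctan a - arctan b"
      by (simp add: circle_angle_def a_def b_def diff_divide_distrib)
    thus ?thesis unfolding cis_mult norm_one_minus_cis by (simp only:)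
  qed
  also have "sin (arctan a - arctan b) = (a - b) / (sqrt (1 + a\<^sup>2) * sqrt (1 + b\<^sup>2))"
    by (simp add: sin_diff sin_arctan cos_arctan diff_divide_distrib)
  also have "a - b = 2 * (w - v) / sqrt 3" by (simp add: a_def b_def field_simps)
  finally have "norm (1 - cis (circle_angle w) * cis (- circle_angle v)) =
      2 * \<bar>2 * (w - v) / sqrt 3 / (4 / 3 * (sqrt (circle_scale w) * sqrt (circle_scale v)))\<bar>"
    unfolding s .
  also have "\<dots> = 3 / sqrt 3 * \<bar>w - v\<bar> / (sqrt (circle_scale w) * sqrt (circle_scale v))"
  proof -
    define S where "S = sqrt (circle_scale w) * sqrt (circle_scale v)"
    have "S > 0" using circle_scale_pos[of w] circle_scale_pos[of v] by (simp add: S_def)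
    moreover have "2 * (w - v) / sqrt 3 / (4 / 3 * S) = 3 / (2 * sqrt 3 * S) * (w - v)"
      using \<open>S > 0\<close> by (simp add: divide_simps)
    ultimately show ?thesis unfolding S_def[symmetric] by (simp only: abs_mult) (simp add: abs_mult)
  qed
  also have "3 / sqrt 3 = sqrt 3" by (rule real_div_sqrt) simp
  finally show ?thesis .
qed

section \<open>Mapping the disc onto the parallelogram and the triangle\<close>

lemma frontier_supportI:
  fixes p n :: complex
  assumes "p \<in> Q" "closed Q" "n \<noteq> 0" "\<And>q. q \<in> Q \<Longrightarrow> n \<bullet> q \<le> n \<bullet> p"
  shows "p \<in> frontier Q"
proof -
  have "p \<notin> interior Q"
  proof
    assume "p \<in> interior Q"
    then obtain e where e: "e > 0" "cball p e \<subseteq> Q" using mem_interior_cball by blast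
    define q where "q = p + (e / norm n) *\<^sub>R n"
    have "q \<in> cball p e" using e assms(3) by (simp add: q_def dist_norm)
    hence "n \<bullet> q \<le> n \<bullet> p" using e assms(4) by blast
    moreover have "n \<bullet> q = n \<bullet> p + e * norm n"
      using assms(3) by (simp add: q_def inner_add_right power2_norm_eq_inner[symmetric] power2_eq_square)
    ultimately show False using e assms(3) by (simp add: mult_le_0_iff)
  qed
  thus ?thesis using assms by (simp add: frontier_def closure_closed)
qed

abbreviation \<omega> :: complex where "\<omega> \<equiv> cis (pi / 3)"

lemma omega_simps: "Re \<omega> = 1 / 2" "Im \<omega> = sqrt 3 / 2" "cis (2 * pi / 3) = \<omega> - 1" "cis (- (2 * pi / 3)) = - \<omega>"
  by (simp_all add: complex_eq_iff cos_60 sin_60 cos_120 sin_120)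

lemma parallelogram_eq:
  assumes "r > 0"
  shows "parallelogram r = {of_real x + of_real y * \<omega> |x y. 0 \<le> x \<and> x \<le> r \<and> 0 \<le> y \<and> y \<le> 1}" (is "_ = ?P")
proof
  have "convex ?P"
  proof (rule convexI)
    fix a b :: complex and u v :: real
    assume ab: "a \<in> ?P" "b \<in> ?P" and uv: "0 \<le> u" "0 \<le> v" "u + v = 1"
    obtain x y where a: "a = of_real x + of_real y * \<omega>" "0 \<le> x" "x \<le> r" "0 \<le> y" "y \<le> 1" using ab by blast
    obtain x' y' where b: "b = of_real x' + of_real y' * \<omega>" "0 \<le> x'" "x' \<le> r" "0 \<le> y'" "y' \<le> 1" using ab by blast
    have "u *\<^sub>R a + v *\<^sub>R b = of_real (u * x + v * x') + of_real (u * y + v * y') * \<omega>"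
      by (simp add: a b scaleR_conv_of_real algebra_simps)
    moreover have "0 \<le> u * x + v * x'" "0 \<le> u * y + v * y'" using a b uv by auto
    moreover have "u * x + v * x' \<le> r" "u * y + v * y' \<le> 1" using convex_bound_le[of x r x' u v] convex_bound_le[of y 1 y' u v] a b uv by auto
    ultimately show "u *\<^sub>R a + v *\<^sub>R b \<in> ?P" by blast
  qed
  moreover have "{0, complex_of_real r, complex_of_real r + \<omega>, \<omega>} \<subseteq> ?P"
  proof -
    have "0 = of_real 0 + of_real 0 * \<omega>" "complex_of_real r = of_real r + of_real 0 * \<omega>"
      "complex_of_real r + \<omega> = of_real r + of_real 1 * \<omega>" "\<omega> = of_real 0 + of_real 1 * \<omega>" by simp_all
    thus ?thesis using assms by (intro insert_subsetI empty_subsetI CollectI) (metis order_refl less_imp_le zero_le_one)+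
  qed
  ultimately show "parallelogram r \<subseteq> ?P" unfolding parallelogram_def by (intro hull_minimal)
  show "?P \<subseteq> parallelogram r"
  proof
    fix z assume "z \<in> ?P"
    then obtain x y where z: "z = of_real x + of_real y * \<omega>" "0 \<le> x" "x \<le> r" "0 \<le> y" "y \<le> 1" by blast
    have c: "convex (parallelogram r)" by (simp add: parallelogram_def)
    have v: "0 \<in> parallelogram r" "complex_of_real r \<in> parallelogram r"
       "complex_of_real r + \<omega> \<in> parallelogram r" "\<omega> \<in> parallelogram r"
      unfolding parallelogram_def by (auto intro: hull_inc)
    define t where "t = x / r"
    have t: "0 \<le> t" "t \<le> 1" "x = t * r" using z assms by (auto simp: t_def)
    have h: "(1 - t) *\<^sub>R 0 + t *\<^sub>R complex_of_real r \<in> parallelogram r"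
         "(1 - t) *\<^sub>R \<omega> + t *\<^sub>R (complex_of_real r + \<omega>) \<in> parallelogram r"
      using t by (intro convexD_alt[OF c] v; simp)+
    have "(1 - y) *\<^sub>R ((1 - t) *\<^sub>R 0 + t *\<^sub>R complex_of_real r) + y *\<^sub>R ((1 - t) *\<^sub>R \<omega> + t *\<^sub>R (complex_of_real r + \<omega>)) \<in> parallelogram r"
      by (rule convexD_alt[OF c h z(4,5)])
    also have "(1 - y) *\<^sub>R ((1 - t) *\<^sub>R 0 + t *\<^sub>R complex_of_real r) + y *\<^sub>R ((1 - t) *\<^sub>R \<omega> + t *\<^sub>R (complex_of_real r + \<omega>)) = z"
      by (simp add: z(1) t(3) scaleR_conv_of_real algebra_simps)
    finally show "z \<in> parallelogram r" .
  qed
qed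

lemma triangle_eq: "equilateral_triangle = {of_real x + of_real y * \<omega> |x y. 0 \<le> x \<and> 0 \<le> y \<and> x + y \<le> 1}"
proof -
  have "equilateral_triangle = {u *\<^sub>R 0 + v *\<^sub>R 1 + w *\<^sub>R \<omega> |u v w. 0 \<le> u \<and> 0 \<le> v \<and> 0 \<le> w \<and> u + v + w = 1}"
    unfolding equilateral_triangle_def by (rule convex_hull_3)
  also have "\<dots> = {of_real x + of_real y * \<omega> |x y. 0 \<le> x \<and> 0 \<le> y \<and> x + y \<le> 1}"
  proof (intro Collect_cong iffI)
    fix z assume "\<exists>u v w. z = u *\<^sub>R 0 + v *\<^sub>R 1 + w *\<^sub>R \<omega> \<and> 0 \<le> u \<and> 0 \<le> v \<and> 0 \<le> w \<and> u + v + w = 1"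
    then obtain u v w where "z = u *\<^sub>R 0 + v *\<^sub>R 1 + w *\<^sub>R \<omega>" "0 \<le> u" "0 \<le> v" "0 \<le> w" "u + v + w = 1" by blast
    thus "\<exists>x y. z = of_real x + of_real y * \<omega> \<and> 0 \<le> x \<and> 0 \<le> y \<and> x + y \<le> 1"
      by (intro exI[of _ v] exI[of _ w]) (auto simp: scaleR_conv_of_real)
  next
    fix z assume "\<exists>x y. z = of_real x + of_real y * \<omega> \<and> 0 \<le> x \<and> 0 \<le> y \<and> x + y \<le> 1"
    then obtain x y where "z = of_real x + of_real y * \<omega>" "0 \<le> x" "0 \<le> y" "x + y \<le> 1" by blast
    thus "\<exists>u v w. z = u *\<^sub>R 0 + v *\<^sub>R 1 + w *\<^sub>R \<omega> \<and> 0 \<le> u \<and> 0 \<le> v \<and> 0 \<le> w \<and> u + v + w = 1"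
      by (intro exI[of _ "1 - x - y"] exI[of _ x] exI[of _ y]) (auto simp: scaleR_conv_of_real)
  qed
  finally show ?thesis .
qed

lemma polygon_compact_convex:
  "compact (parallelogram r)" "convex (parallelogram r)" "closed (parallelogram r)"
  "compact equilateral_triangle" "convex equilateral_triangle" "closed equilateral_triangle"
  unfolding parallelogram_def equilateral_triangle_def
  by (auto intro!: compact_imp_closed finite_imp_compact_convex_hull)

lemma inner_omega:
  "Complex (- 1) (1 / sqrt 3) \<bullet> (of_real x + of_real y * \<omega>) = - x"
  "Complex 1 (- 1 / sqrt 3) \<bullet> (of_real x + of_real y * \<omega>) = x"
  "Complex 1 (1 / sqrt 3) \<bullet> (of_real x + of_real y * \<omega>) = x + y"
  "Complex 0 (- 1) \<bullet> (of_real x + of_real y * \<omega>) = - (y * (sqrt 3 / 2))"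
  "Complex 0 1 \<bullet> (of_real x + of_real y * \<omega>) = y * (sqrt 3 / 2)"
  by (simp_all add: inner_complex_def cos_60 sin_60)

lemma parallelogram_frontier:
  assumes r: "r > 0" and xy: "0 \<le> x" "x \<le> r" "0 \<le> y" "y \<le> 1" "x = 0 \<or> x = r \<or> y = 0 \<or> y = 1"
  shows "of_real x + of_real y * \<omega> \<in> frontier (parallelogram r)"
proof -
  define p where "p = of_real x + of_real y * \<omega>"
  define n where "n = (if x = 0 then Complex (- 1) (1 / sqrt 3) else if x = r then Complex 1 (- 1 / sqrt 3)
      else if y = 0 then Complex 0 (- 1) else Complex 0 1)"
  have "p \<in> frontier (parallelogram r)"
  proof (rule frontier_supportI)
    show "p \<in> parallelogram r" using xy unfolding parallelogram_eq[OF r] p_def by blast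
    show "n \<noteq> 0" by (simp add: n_def complex_eq_iff)
    fix q assume "q \<in> parallelogram r"
    then obtain x' y' where q: "q = of_real x' + of_real y' * \<omega>" "0 \<le> x'" "x' \<le> r" "0 \<le> y'" "y' \<le> 1"
      unfolding parallelogram_eq[OF r] by blast
    show "n \<bullet> q \<le> n \<bullet> p"
      unfolding p_def q(1) n_def using q(2-) xy r by (auto simp only: inner_omega if_True if_False split: if_splits intro!: mult_right_mono le_imp_neg_le) auto
  qed (rule polygon_compact_convex)
  thus ?thesis by (simp add: p_def)
qed

lemma triangle_frontier:
  assumes xy: "0 \<le> x" "0 \<le> y" "x + y \<le> 1" "x = 0 \<or> y = 0 \<or> x + y = 1"
  shows "of_real x + of_real y * \<omega> \<in> frontier equilateral_triangle"
proof -
  define p where "p = of_real x + of_real y * \<omega>"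
  define n where "n = (if x = 0 then Complex (- 1) (1 / sqrt 3) else if y = 0 then Complex 0 (- 1) else Complex 1 (1 / sqrt 3))"
  have "p \<in> frontier equilateral_triangle"
  proof (rule frontier_supportI)
    show "p \<in> equilateral_triangle" using xy unfolding triangle_eq p_def by blast
    show "n \<noteq> 0" by (simp add: n_def complex_eq_iff)
    fix q assume "q \<in> equilateral_triangle"
    then obtain x' y' where q: "q = of_real x' + of_real y' * \<omega>" "0 \<le> x'" "0 \<le> y'" "x' + y' \<le> 1"
      unfolding triangle_eq by blast
    show "n \<bullet> q \<le> n \<bullet> p"
      unfolding p_def q(1) n_def using q(2-) xy by (auto simp only: inner_omega if_True if_False split: if_splits intro!: mult_right_mono le_imp_neg_le) auto
  qed (rule polygon_compact_convex)
  thus ?thesis by (simp add: p_def)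
qed

lemma cis_inj: "inj_on cis {0..<2 * pi}"
proof (rule inj_onI)
  fix s t assume st: "s \<in> {0..<2 * pi}" "t \<in> {0..<2 * pi}" "cis s = cis t"
  hence "cos s = cos t" "sin s = sin t" by (simp_all add: complex_eq_iff)
  hence "sin (s - t) = 0" "cos (s - t) = 1" by (simp_all add: sin_diff cos_diff flip: power2_eq_square)
  then obtain n :: int where n: "s - t = of_int n * (2 * pi)" by (auto simp: cos_one_2pi_int)
  have h: "real_of_int n * (2 * pi) < 1 * (2 * pi)" "(- 1) * (2 * pi) < real_of_int n * (2 * pi)"
    using st by (simp_all flip: n)
  have "real_of_int n < 1" "- 1 < real_of_int n"
    by (rule mult_right_less_imp_less[OF h(1)] mult_right_less_imp_less[OF h(2)]; simp)+
  hence "n = 0" by linarith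
  thus "s = t" using n by simp
qed

section \<open>Sides of Schwarz-Christoffel polygons\<close>

definition sc_base_direction :: "real set \<Rightarrow> (real \<Rightarrow> real) \<Rightarrow> real" where
  "sc_base_direction T \<alpha> = pi / 2 + (\<Sum>t\<in>T. \<alpha> t * ((t + pi) / 2))"

lemma sc_edge:
  assumes T: "finite T" "T \<subseteq> {0..<2 * pi}" and \<alpha>: "(\<Sum>t\<in>T. \<alpha> t) = 2"
    and der: "\<And>\<theta>. (\<And>t. t \<in> T \<Longrightarrow> cis \<theta> \<noteq> cis t) \<Longrightarrow>
       ((\<lambda>\<theta>. f (cis \<theta>)) has_vector_derivative \<i> * cis \<theta> * sc_deriv T \<alpha> (cis \<theta>)) (at \<theta>)"
    and ab: "0 \<le> a" "b \<le> 2 * pi" "T \<inter> {a<..<b} = {}"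
    and \<theta>: "a < \<theta>" "\<theta> < b"
  shows "((\<lambda>\<theta>. f (cis \<theta>)) has_vector_derivative of_real (norm (sc_deriv T \<alpha> (cis \<theta>))) *
           cis (sc_base_direction T \<alpha> + pi * (\<Sum>t\<in>T \<inter> {..a}. \<alpha> t))) (at \<theta>)"
proof -
  have nin: "\<theta> \<notin> T" using ab \<theta> by auto
  have "cis \<theta> \<noteq> cis t" if "t \<in> T" for t
    using inj_onD[OF cis_inj, of \<theta> t] nin that T ab \<theta> by auto
  hence "((\<lambda>\<theta>. f (cis \<theta>)) has_vector_derivative \<i> * cis \<theta> * sc_deriv T \<alpha> (cis \<theta>)) (at \<theta>)" by (rule der)
  moreover have "{t \<in> T. t < \<theta>} = T \<inter> {..a}" using ab \<theta> by force
  ultimately show ?thesis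
    using sc_boundary_direction[OF T \<alpha>, of \<theta>] ab \<theta> nin by (simp add: sc_base_direction_def)
qed

definition straight_side :: "(complex \<Rightarrow> complex) \<Rightarrow> real set \<Rightarrow> (real \<Rightarrow> real) \<Rightarrow> real \<Rightarrow> real \<Rightarrow> real \<Rightarrow> bool" where
  "straight_side f T \<alpha> d a b \<longleftrightarrow>
     (\<forall>\<theta>. a \<le> \<theta> \<and> \<theta> \<le> b \<longrightarrow> f (cis \<theta>) = f (cis a) + of_real (edge_length f d a \<theta>) * cis d \<and>
        0 \<le> edge_length f d a \<theta> \<and> edge_length f d a \<theta> \<le> edge_length f d a b) \<and>
     0 < edge_length f d a b \<and>
     (\<forall>\<theta>. a < \<theta> \<and> \<theta> < b \<longrightarrow>
        (edge_length f d a has_field_derivative norm (sc_deriv T \<alpha> (cis \<theta>))) (at \<theta>))"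

text \<open>Translation puts the image of \<open>cis u\<close> at 0, and rotation by -c makes the
  side leaving it point along the positive real axis; every other direction is then pi times the
  difference of accumulated exponents.\<close>

lemma sc_polygon_map:
  assumes T: "finite T" "T \<subseteq> {0..<2 * pi}" and \<alpha>: "\<And>t. t \<in> T \<Longrightarrow> 0 \<le> \<alpha> t \<and> \<alpha> t \<le> 2 / 3"
    and \<alpha>sum: "(\<Sum>t\<in>T. \<alpha> t) = 2"
    and half_plane: "\<And>z. norm z < 1 \<Longrightarrow> Re (k * sc_deriv T \<alpha> z) > 0"
  obtains f where "continuous_on (cball 0 1) f" "f holomorphic_on ball 0 1" "inj_on f (cball 0 1)" "f (cis u) = 0"
    "\<And>a b d. 0 \<le> a \<Longrightarrow> a < b \<Longrightarrow> b \<le> 2 * pi \<Longrightarrow> T \<inter> {a<..<b} = {} \<Longrightarrow>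
       d = pi * ((\<Sum>t\<in>T \<inter> {..a}. \<alpha> t) - (\<Sum>t\<in>T \<inter> {..u}. \<alpha> t)) \<Longrightarrow> straight_side f T \<alpha> d a b"
proof -
  obtain g where g: "continuous_on (cball 0 1) g"
    "\<And>z. norm z < 1 \<Longrightarrow> (g has_field_derivative sc_deriv T \<alpha> z) (at z)"
    "\<And>\<theta>. (\<And>t. t \<in> T \<Longrightarrow> cis \<theta> \<noteq> cis t) \<Longrightarrow>
       ((\<lambda>\<theta>. g (cis \<theta>)) has_vector_derivative \<i> * cis \<theta> * sc_deriv T \<alpha> (cis \<theta>)) (at \<theta>)"
  proof (rule sc_map_exists[OF T(1) inj_on_subset[OF cis_inj T(2)], of \<alpha>])
    show "t \<in> T \<Longrightarrow> 0 \<le> \<alpha> t \<and> \<alpha> t \<le> 2 / 3" for t by (rule \<alpha>)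
    fix f assume "continuous_on (cball 0 1) f"
      "\<And>z. norm z < 1 \<Longrightarrow> (f has_field_derivative sc_deriv T \<alpha> z) (at z)"
      "\<And>\<theta>. (\<And>t. t \<in> T \<Longrightarrow> cis \<theta> \<noteq> cis t) \<Longrightarrow>
        ((\<lambda>\<theta>. f (cis \<theta>)) has_vector_derivative \<i> * cis \<theta> * sc_deriv T \<alpha> (cis \<theta>)) (at \<theta>)"
    thus thesis by (rule that)
  qed
  define c where "c = sc_base_direction T \<alpha> + pi * (\<Sum>t\<in>T \<inter> {..u}. \<alpha> t)"
  define f where "f = (\<lambda>z. cis (- c) * (g z - g (cis u)))"
  have cont: "continuous_on (cball 0 1) f" unfolding f_def by (intro continuous_intros g)
  have "g holomorphic_on ball 0 1"
    unfolding holomorphic_on_open[OF open_ball]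
  proof
    fix z :: complex assume "z \<in> ball 0 1"
    hence "(g has_field_derivative sc_deriv T \<alpha> z) (at z)" by (intro g(2)) simp
    thus "\<exists>g'. (g has_field_derivative g') (at z)" by blast
  qed
  hence hol: "f holomorphic_on ball 0 1" unfolding f_def by (intro holomorphic_intros)
  have "inj_on g (cball 0 1)"
    by (rule Noshiro_Warschawski_closed_disc[OF g(1,2) half_plane])
  hence inj: "inj_on f (cball 0 1)" by (auto simp: inj_on_def f_def)
  have side: "straight_side f T \<alpha> d a b"
    if ab: "0 \<le> a" "a < b" "b \<le> 2 * pi" "T \<inter> {a<..<b} = {}"
      and d: "d = pi * ((\<Sum>t\<in>T \<inter> {..a}. \<alpha> t) - (\<Sum>t\<in>T \<inter> {..u}. \<alpha> t))" for a b d
  proof -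
    define m where "m = (\<lambda>\<theta>. norm (sc_deriv T \<alpha> (cis \<theta>)))"
    have e: "\<forall>\<theta>\<in>{a<..<b}. ((\<lambda>\<theta>. f (cis \<theta>)) has_vector_derivative of_real (m \<theta>) * cis d) (at \<theta>)"
    proof
      fix \<theta> assume "\<theta> \<in> {a<..<b}"
      hence \<theta>: "a < \<theta>" "\<theta> < b" by auto
      let ?D = "sc_base_direction T \<alpha> + pi * (\<Sum>t\<in>T \<inter> {..a}. \<alpha> t)"
      have "((\<lambda>\<theta>. f (cis \<theta>)) has_vector_derivative cis (- c) * (of_real (m \<theta>) * cis ?D - 0)) (at \<theta>)"
        unfolding f_def m_def
        by (intro has_vector_derivative_mult_right has_vector_derivative_diff has_vector_derivative_const
              sc_edge[OF T \<alpha>sum g(3) ab(1,3,4) \<theta>])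
      also have "cis (- c) * (of_real (m \<theta>) * cis ?D - 0) = of_real (m \<theta>) * (cis (- c) * cis ?D)" by simp
      also have "cis (- c) * cis ?D = cis d" by (simp add: cis_mult c_def d algebra_simps)
      finally show "((\<lambda>\<theta>. f (cis \<theta>)) has_vector_derivative of_real (m \<theta>) * cis d) (at \<theta>)" .
    qed
    have "\<forall>\<theta>\<in>{a<..<b}. m \<theta> > 0" by (simp add: m_def sc_deriv_def)
    from straight_edge[OF cont ab(2) e this] show ?thesis
      unfolding straight_side_def m_def by blast
  qed
  show ?thesis
  proof (rule that)
    show "f (cis u) = 0" by (simp add: f_def)
  qed (fact cont hol inj side)+
qed

text \<open>The density may blow up at both ends, so the fundamental theorem is applied with a
  primitive that is continuous on the closed interval and differentiable only inside.\<close>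

lemma edge_integral:
  assumes cont: "continuous_on (cball 0 1) f" and uv: "u < v"
    and der: "\<And>\<theta>. circle_angle u < \<theta> \<Longrightarrow> \<theta> < circle_angle v \<Longrightarrow>
      (edge_length f c (circle_angle u) has_field_derivative m \<theta>) (at \<theta>)"
    and dens: "\<And>w. u < w \<Longrightarrow> w < v \<Longrightarrow> m (circle_angle w) * (sqrt 3 / circle_scale w) = K * d w"
  shows "((\<lambda>w. K * d w) has_integral edge_length f c (circle_angle u) (circle_angle v)) {u..v}"
proof -
  let ?G = "\<lambda>w. edge_length f c (circle_angle u) (circle_angle w)"
  have "((\<lambda>w. K * d w) has_integral ?G v - ?G u) {u..v}"
  proof (rule fundamental_theorem_of_calculus_interior)
    show "continuous_on {u..v} ?G"
      unfolding edge_length_def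
      by (intro continuous_intros continuous_on_compose2[OF cont] circle_angle_continuous) auto
    fix w assume w: "w \<in> {u<..<v}"
    have "(edge_length f c (circle_angle u) has_field_derivative m (circle_angle w)) (at (circle_angle w))"
      using w by (intro der circle_angle_strict_mono) auto
    from DERIV_chain2[OF this circle_angle_has_derivative]
    show "(?G has_vector_derivative K * d w) (at w)"
      using dens[of w] w by (simp add: has_real_derivative_iff_has_vector_derivative)
  qed (use uv in auto)
  thus ?thesis by (simp add: edge_length_def)
qed

lemma unit_circle_angle:
  assumes "norm z = 1" obtains \<theta> where "0 \<le> \<theta>" "\<theta> < 2 * pi" "z = cis \<theta>"
  using complex_unimodular_polar[OF assms] by (metis cis.code)

definition tri_density :: "real \<Rightarrow> real" where
  "tri_density w = w powr (- 2 / 3) * (1 - w) powr (- 2 / 3)"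

definition par_density :: "real \<Rightarrow> real \<Rightarrow> real" where
  "par_density l w = tri_density w * \<bar>w - l\<bar> powr (- 1 / 3)"

lemma circle_scale_01 [simp]: "circle_scale 0 = 1" "circle_scale 1 = 1"
  by (simp_all add: circle_scale_def)

text \<open>Taking logarithms, every factor contributes -1/2 ln of the scale at w, weighted by its
  exponent. The exponents sum to 2, so exactly one power of the scale appears and cancels against
  the derivative of the angle. The prevertex at infinity leaves no factor in w.\<close>

lemma norm_sc_deriv_on_circle:
  assumes w: "0 < w" "w < 1" "w \<noteq> l" and l: "0 < l" "l < 1"
  defines "B \<equiv> circle_angle l"
  shows "norm (sc_deriv (par_angles B) (par_exponent B \<gamma>) (cis (circle_angle w))) * (sqrt 3 / circle_scale w) =
           (circle_scale l powr (\<gamma> / 2) / sqrt 3) * (tri_density w * \<bar>w - l\<bar> powr (- \<gamma>))"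
proof -
  have B: "2 * pi / 3 < B" "B < 4 * pi / 3" unfolding B_def by (rule circle_angle_range[OF l])+
  define N M where "N = circle_scale w" and "M = circle_scale l"
  have NM: "N > 0" "M > 0" by (simp_all add: N_def M_def circle_scale_pos)
  have ne: "cis (circle_angle w) \<noteq> cis t" if "t \<in> par_angles B" for t
  proof -
    have cw: "2 * pi / 3 < circle_angle w" "circle_angle w < 4 * pi / 3" by (rule circle_angle_range[OF w(1,2)])+
    have "circle_angle w \<noteq> B"
      using circle_angle_strict_mono[of w l] circle_angle_strict_mono[of l w] w(3)
      unfolding B_def by (cases "w < l") auto
    hence "t \<noteq> circle_angle w" using that cw by (auto simp: par_angles_def)
    moreover have "t \<in> {0..<2 * pi}" using that B by (auto simp: par_angles_def)
    moreover have "circle_angle w \<in> {0..<2 * pi}" using cw by auto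
    ultimately show ?thesis using inj_onD[OF cis_inj] by blast
  qed
  define n where "n = (\<lambda>t. ln (norm (1 - cis (circle_angle w) * cis (- t))))"
  have n0: "n 0 = ln 3 / 2 - ln N / 2"
    unfolding n_def norm_one_minus_circle_0 using NM by (simp add: N_def ln_div ln_sqrt)
  have nc: "n (circle_angle v) = ln 3 / 2 + ln \<bar>w - v\<bar> - (ln N / 2 + ln (circle_scale v) / 2)" if "v \<noteq> w" for v
    unfolding n_def norm_one_minus_circle using that NM circle_scale_pos[of v]
    by (simp add: N_def ln_div ln_mult ln_sqrt)
  have "norm (sc_deriv (par_angles B) (par_exponent B \<gamma>) (cis (circle_angle w))) =
      exp (- (\<Sum>t\<in>par_angles B. par_exponent B \<gamma> t * n t))"
    unfolding n_def by (rule norm_sc_deriv) (use ne in \<open>auto simp: par_angles_def\<close>)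
  also have "(\<Sum>t\<in>par_angles B. par_exponent B \<gamma> t * n t) =
      (2 / 3 - \<gamma>) * n 0 + 2 / 3 * n (circle_angle 0) + \<gamma> * n (circle_angle l) + 2 / 3 * n (circle_angle 1)"
    unfolding par_sum[OF B] circle_angle_0 circle_angle_1 by (simp add: B_def)
  also have "\<dots> = ln 3 - ln N + 2 / 3 * ln w + 2 / 3 * ln (1 - w) + \<gamma> * ln \<bar>w - l\<bar> - \<gamma> / 2 * ln M"
    using w by (simp add: n0 nc M_def field_simps)
  finally have "norm (sc_deriv (par_angles B) (par_exponent B \<gamma>) (cis (circle_angle w))) =
      exp (ln N + - ln 3 + (\<gamma> / 2 * ln M + ((- 2 / 3) * ln w + (- 2 / 3) * ln (1 - w) + (- \<gamma>) * ln \<bar>w - l\<bar>)))"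
    by (simp add: algebra_simps)
  also have "\<dots> = N / 3 * (M powr (\<gamma> / 2) * (tri_density w * \<bar>w - l\<bar> powr (- \<gamma>)))"
    unfolding exp_add exp_minus using w NM by (simp add: tri_density_def powr_def)
  finally have "norm (sc_deriv (par_angles B) (par_exponent B \<gamma>) (cis (circle_angle w))) =
      N / 3 * (M powr (\<gamma> / 2) * (tri_density w * \<bar>w - l\<bar> powr (- \<gamma>)))" .
  hence "norm (sc_deriv (par_angles B) (par_exponent B \<gamma>) (cis (circle_angle w))) * (sqrt 3 / N) =
      N / 3 * (M powr (\<gamma> / 2) * (tri_density w * \<bar>w - l\<bar> powr (- \<gamma>))) * (sqrt 3 / N)" by (simp only:)
  also have "\<dots> = M powr (\<gamma> / 2) * (tri_density w * \<bar>w - l\<bar> powr (- \<gamma>)) * (sqrt 3 / 3)" using NM by simp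
  also have "sqrt 3 / 3 = 1 / sqrt 3" using real_div_sqrt[of 3] by (simp add: field_simps)
  finally show ?thesis by (simp add: N_def M_def)
qed

text \<open>The jumps fix the side directions -2pi/3, 0, pi/3, pi, so closing up forces opposite
  sides to be equal. Dividing by the slanted side \<open>L\<close> leaves one shape parameter, the
  quotient of two side integrals.\<close>

theorem parallelogram_disc_map:
  assumes l: "0 < l" "l < 1"
  obtains S r J1 J2 where "r > 0" "continuous_on (cball 0 1) S" "S holomorphic_on ball 0 1" "inj_on S (cball 0 1)"
    "S ` ball 0 1 = interior (parallelogram r)" "S ` cball 0 1 = parallelogram r"
    "S (cis (2 * pi / 3)) = 0" "S (cis (circle_angle l)) = of_real r"
    "S (cis (4 * pi / 3)) = of_real r + \<omega>" "S 1 = \<omega>"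
    "(par_density l has_integral J1) {0..l}" "(par_density l has_integral J2) {l..1}" "r = J1 / J2"
proof -
  define B where "B = circle_angle l"
  define T where "T = par_angles B"
  define \<alpha> where "\<alpha> = par_exponent B (1 / 3)"
  have B: "2 * pi / 3 < B" "B < 4 * pi / 3" unfolding B_def by (rule circle_angle_range[OF l])+
  have T: "finite T" "T \<subseteq> {0..<2 * pi}" using B by (auto simp: T_def par_angles_def)
  have \<alpha>sum: "(\<Sum>t\<in>T. \<alpha> t) = 2"
    using par_sum[OF B, of "1/3" "\<lambda>_. 1"] by (simp add: T_def \<alpha>_def)
  have \<alpha>: "0 \<le> \<alpha> t \<and> \<alpha> t \<le> 2 / 3" for t by (simp add: \<alpha>_def par_exponent_def)
  obtain f where f: "continuous_on (cball 0 1) f" "f holomorphic_on ball 0 1" "inj_on f (cball 0 1)" "f (cis (2 * pi / 3)) = 0"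
    and side: "\<And>a b d. 0 \<le> a \<Longrightarrow> a < b \<Longrightarrow> b \<le> 2 * pi \<Longrightarrow> T \<inter> {a<..<b} = {} \<Longrightarrow>
       d = pi * ((\<Sum>t\<in>T \<inter> {..a}. \<alpha> t) - (\<Sum>t\<in>T \<inter> {..2 * pi / 3}. \<alpha> t)) \<Longrightarrow> straight_side f T \<alpha> d a b"
  proof (rule sc_polygon_map[OF T \<alpha> \<alpha>sum, of "cis (- (1 / 3 * (B - pi) / 2))" "2 * pi / 3"])
    show "Re (cis (- (1 / 3 * (B - pi) / 2)) * sc_deriv T \<alpha> z) > 0" if "norm z < 1" for z
      using par_deriv_half_plane[OF B, of "1/3" z] that by (simp only: T_def \<alpha>_def)
  qed (rule that)
  have sums: "T \<inter> {..0} = {0}" "T \<inter> {..2 * pi / 3} = {0, 2 * pi / 3}" "T \<inter> {..B} = {0, 2 * pi / 3, B}" "T \<inter> {..4 * pi / 3} = T"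
    and free: "T \<inter> {0<..<2 * pi / 3} = {}" "T \<inter> {2 * pi / 3<..<B} = {}" "T \<inter> {B<..<4 * pi / 3} = {}" "T \<inter> {4 * pi / 3<..<2 * pi} = {}"
    using B by (auto simp: T_def par_angles_def)
  have \<alpha>v: "\<alpha> 0 = 1 / 3" "\<alpha> (2 * pi / 3) = 2 / 3" "\<alpha> B = 1 / 3"
    using B by (simp_all add: \<alpha>_def par_exponent_def)
  have s1: "straight_side f T \<alpha> (- (2 * pi / 3)) 0 (2 * pi / 3)" and s2: "straight_side f T \<alpha> 0 (2 * pi / 3) B"
    and s3: "straight_side f T \<alpha> (pi / 3) B (4 * pi / 3)" and s4: "straight_side f T \<alpha> pi (4 * pi / 3) (2 * pi)"
    by (rule side; use B in \<open>simp add: sums free \<alpha>v \<alpha>sum\<close>)+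
  define l1 l2 l3 l4 where "l1 = edge_length f (- (2 * pi / 3)) 0" and "l2 = edge_length f 0 (2 * pi / 3)"
    and "l3 = edge_length f (pi / 3) B" and "l4 = edge_length f pi (4 * pi / 3)"
  note s = s1[unfolded straight_side_def l1_def[symmetric]] s2[unfolded straight_side_def l2_def[symmetric]]
    s3[unfolded straight_side_def l3_def[symmetric]] s4[unfolded straight_side_def l4_def[symmetric]]
  have P2: "f (cis \<theta>) = of_real (l2 \<theta>)" if "2 * pi / 3 \<le> \<theta>" "\<theta> \<le> B" for \<theta>
    using s(2) that f(4) by simp
  have P3: "f (cis \<theta>) = of_real (l2 B) + of_real (l3 \<theta>) * \<omega>" if "B \<le> \<theta>" "\<theta> \<le> 4 * pi / 3" for \<theta>
    using s(3) that P2[of B] B by simp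
  have P4: "f (cis \<theta>) = of_real (l2 B - l4 \<theta>) + of_real (l3 (4 * pi / 3)) * \<omega>" if "4 * pi / 3 \<le> \<theta>" "\<theta> \<le> 2 * pi" for \<theta>
    using s(4) that P3[of "4 * pi / 3"] B by simp
  have Pone: "f 1 = of_real (l2 B - l4 (2 * pi)) + of_real (l3 (4 * pi / 3)) * \<omega>"
    using P4[of "2 * pi"] by simp
  have P1: "f (cis \<theta>) = of_real (l2 B - l4 (2 * pi)) + of_real (l3 (4 * pi / 3) - l1 \<theta>) * \<omega>" if "0 \<le> \<theta>" "\<theta> \<le> 2 * pi / 3" for \<theta>
  proof -
    have "f (cis \<theta>) = f (cis 0) + of_real (l1 \<theta>) * cis (- (2 * pi / 3))" using s(1) that by blast
    thus ?thesis unfolding cis_zero Pone omega_simps(4) by (simp add: algebra_simps)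
  qed
  have pos: "l2 B > 0" "l3 (4 * pi / 3) > 0" using s(2,3) by blast+
  \<comment> \<open>The boundary curve returns to 0; both coordinates in the basis 1, \<omega>
    vanish.\<close>
  have "of_real (l2 B - l4 (2 * pi)) + of_real (l3 (4 * pi / 3) - l1 (2 * pi / 3)) * \<omega> = 0"
    using P1[of "2 * pi / 3"] f(4) by simp
  hence close: "l1 (2 * pi / 3) = l3 (4 * pi / 3)" "l4 (2 * pi) = l2 B"
    by (auto simp: complex_eq_iff sin_60 cos_60)
  define L where "L = l3 (4 * pi / 3)"
  define r where "r = l2 B / L"
  define S where "S = (\<lambda>z. f z / of_real L)"
  have L: "L > 0" "r > 0" using pos by (simp_all add: L_def r_def)
  have S_coord: "S z = of_real (x / L) + of_real (y / L) * \<omega>" if "f z = of_real x + of_real y * \<omega>" for z x y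
    by (simp add: S_def that add_divide_distrib)
  have cont: "continuous_on (cball 0 1) S" unfolding S_def using L by (intro continuous_intros f) auto
  have hol: "S holomorphic_on ball 0 1" unfolding S_def using L by (intro holomorphic_intros f) auto
  have injS: "inj_on S (cball 0 1)"
    using f(3) L by (auto simp: inj_on_def S_def)
  have bd: "S ` sphere 0 1 \<subseteq> frontier (parallelogram r)"
  proof safe
    fix z :: complex assume "z \<in> sphere 0 1"
    then obtain \<theta> where \<theta>: "0 \<le> \<theta>" "\<theta> < 2 * pi" "z = cis \<theta>" by (auto elim: unit_circle_angle)
    consider "\<theta> \<le> 2 * pi / 3" | "2 * pi / 3 \<le> \<theta>" "\<theta> \<le> B" | "B \<le> \<theta>" "\<theta> \<le> 4 * pi / 3" | "4 * pi / 3 \<le> \<theta>" by linarith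
    thus "S z \<in> frontier (parallelogram r)"
    proof cases
      case 1
      have *: "S z = of_real (0 / L) + of_real ((L - l1 \<theta>) / L) * \<omega>"
        unfolding \<theta>(3) using P1[of \<theta>] \<theta> 1 by (intro S_coord) (simp add: close L_def)
      show ?thesis unfolding * using s(1) \<theta> 1 L close
        by (intro parallelogram_frontier) (auto simp: L_def[symmetric])
    next
      case 2
      have *: "S z = of_real (l2 \<theta> / L) + of_real (0 / L) * \<omega>"
        unfolding \<theta>(3) using P2[of \<theta>] 2 by (intro S_coord) simp
      show ?thesis unfolding * using s(2) 2 L
        by (intro parallelogram_frontier) (auto simp: r_def divide_right_mono)
    next
      case 3
      have *: "S z = of_real (l2 B / L) + of_real (l3 \<theta> / L) * \<omega>"
        unfolding \<theta>(3) using P3[of \<theta>] 3 by (intro S_coord) simp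
      show ?thesis unfolding * using s(3) 3 L pos
        by (intro parallelogram_frontier) (auto simp: L_def[symmetric] r_def)
    next
      case 4
      have *: "S z = of_real ((l2 B - l4 \<theta>) / L) + of_real (L / L) * \<omega>"
        unfolding \<theta>(3) using P4[of \<theta>] 4 \<theta> by (intro S_coord) (simp add: L_def)
      show ?thesis unfolding * using s(4) 4 \<theta> L close
        by (intro parallelogram_frontier) (auto simp: r_def divide_right_mono)
    qed
  qed
  have img: "S ` ball 0 1 = interior (parallelogram r)" "S ` cball 0 1 = parallelogram r"
    by (rule image_disc_eq_convex[OF cont hol inj_on_subset[OF injS] polygon_compact_convex(1,2) bd]; auto)+
  have v: "S (cis (2 * pi / 3)) = 0" "S (cis B) = of_real r" "S (cis (4 * pi / 3)) = of_real r + \<omega>" "S 1 = \<omega>"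
    using P2[of B] P3[of "4 * pi / 3"] Pone f(4) B L
    by (auto simp: S_def r_def L_def close add_divide_distrib)
  \<comment> \<open>Common to both side integrals, so it cancels in their quotient; 1/6 is
    \<gamma>/2.\<close>
  define K where "K = circle_scale l powr (1 / 6) / sqrt 3"
  have K: "K > 0" using circle_scale_pos[of l] by (simp add: K_def)
  have dens: "norm (sc_deriv T \<alpha> (cis (circle_angle w))) * (sqrt 3 / circle_scale w) = K * par_density l w"
    if "0 < w" "w < 1" "w \<noteq> l" for w
    using norm_sc_deriv_on_circle[OF that l, of "1/3"] by (simp add: T_def \<alpha>_def B_def K_def par_density_def)
  have I1: "((\<lambda>w. K * par_density l w) has_integral l2 B) {0..l}"
    unfolding l2_def B_def circle_angle_0[symmetric]
    by (rule edge_integral[OF f(1) l(1) _ dens]) (use s(2) l in \<open>auto simp: circle_angle_0 B_def l2_def\<close>)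
  have I2: "((\<lambda>w. K * par_density l w) has_integral l3 (4 * pi / 3)) {l..1}"
    unfolding l3_def B_def circle_angle_1[symmetric]
    by (rule edge_integral[OF f(1) l(2) _ dens]) (use s(3) l in \<open>auto simp: circle_angle_1 B_def l3_def\<close>)
  have "(par_density l has_integral l2 B / K) {0..l}" "(par_density l has_integral L / K) {l..1}"
    using has_integral_mult_right[OF I1, of "1 / K"] has_integral_mult_right[OF I2, of "1 / K"] K by (simp_all add: L_def)
  moreover have "r = (l2 B / K) / (L / K)" using K by (simp add: r_def)
  ultimately show ?thesis
    using that[OF L(2) cont hol injS img v(1) v(2)[unfolded B_def] v(3,4)] by blast
qed

definition tri_angles :: "real set" where "tri_angles = {0, 2 * pi / 3, 4 * pi / 3}"

lemma tri_deriv_eq: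
  assumes "2 * pi / 3 < B" "B < 4 * pi / 3"
  shows "sc_deriv tri_angles (\<lambda>_. 2 / 3) z = sc_deriv (par_angles B) (par_exponent B 0) z"
  using assms by (simp add: sc_deriv_def sc_exponent_def tri_angles_def par_angles_def par_exponent_def)

lemma norm_tri_deriv_on_circle:
  assumes w: "0 < w" "w < 1"
  shows "norm (sc_deriv tri_angles (\<lambda>_. 2 / 3) (cis (circle_angle w))) * (sqrt 3 / circle_scale w) =
           1 / sqrt 3 * tri_density w"
proof -
  \<comment> \<open>With \<gamma> = 0 the fourth prevertex has exponent 0 and may sit anywhere in
    the arc; w/2 keeps it distinct from w.\<close>
  have "2 * pi / 3 < circle_angle (w / 2)" "circle_angle (w / 2) < 4 * pi / 3"
    using circle_angle_range[of "w / 2"] w by simp_all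
  note eq = tri_deriv_eq[OF this]
  have "circle_scale (w / 2) > 0" by (rule circle_scale_pos)
  thus ?thesis
    unfolding eq using norm_sc_deriv_on_circle[of w "w / 2" 0] w by simp
qed

text \<open>\<open>k\<close> is the position on the side from 0 to 1 as a function of w; with its
  derivative and end values it is a regularised incomplete Beta integral.\<close>

theorem triangle_disc_map:
  obtains V k where "continuous_on (cball 0 1) V" "V holomorphic_on ball 0 1" "inj_on V (cball 0 1)"
    "V ` ball 0 1 = interior equilateral_triangle" "V ` cball 0 1 = equilateral_triangle"
    "V (cis (2 * pi / 3)) = 0" "V (cis (4 * pi / 3)) = 1" "V 1 = \<omega>"
    "\<And>w. 0 \<le> w \<Longrightarrow> w \<le> 1 \<Longrightarrow> V (cis (circle_angle w)) = of_real (k w)"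
    "continuous_on {0..1} k" "k 0 = 0" "k 1 = 1"
    "\<And>w. 0 < w \<Longrightarrow> w < 1 \<Longrightarrow> (k has_field_derivative tri_density w / Beta (1 / 3) (1 / 3)) (at w)"
proof -
  define T where "T = tri_angles"
  define \<alpha> :: "real \<Rightarrow> real" where "\<alpha> = (\<lambda>_. 2 / 3)"
  have T: "finite T" "T \<subseteq> {0..<2 * pi}" by (auto simp: T_def tri_angles_def)
  have \<alpha>sum: "(\<Sum>t\<in>T. \<alpha> t) = 2" by (simp add: T_def tri_angles_def \<alpha>_def)
  have \<alpha>: "0 \<le> \<alpha> t \<and> \<alpha> t \<le> 2 / 3" for t by (simp add: \<alpha>_def)
  have B: "2 * pi / 3 < pi" "pi < 4 * pi / 3" using pi_gt_zero by linarith+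
  obtain f where f: "continuous_on (cball 0 1) f" "f holomorphic_on ball 0 1" "inj_on f (cball 0 1)" "f (cis (2 * pi / 3)) = 0"
    and side: "\<And>a b d. 0 \<le> a \<Longrightarrow> a < b \<Longrightarrow> b \<le> 2 * pi \<Longrightarrow> T \<inter> {a<..<b} = {} \<Longrightarrow>
       d = pi * ((\<Sum>t\<in>T \<inter> {..a}. \<alpha> t) - (\<Sum>t\<in>T \<inter> {..2 * pi / 3}. \<alpha> t)) \<Longrightarrow> straight_side f T \<alpha> d a b"
  proof (rule sc_polygon_map[OF T \<alpha> \<alpha>sum, of "cis 0" "2 * pi / 3"])
    show "Re (cis 0 * sc_deriv T \<alpha> z) > 0" if "norm z < 1" for z
      using par_deriv_half_plane[OF B, of 0 z] that by (simp add: T_def \<alpha>_def tri_deriv_eq[OF B])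
  qed (rule that)
  define m where "m = (\<lambda>\<theta>. norm (sc_deriv T \<alpha> (cis \<theta>)))"
  have sums: "T \<inter> {..0} = {0}" "T \<inter> {..2 * pi / 3} = {0, 2 * pi / 3}" "T \<inter> {..4 * pi / 3} = T"
    and free: "T \<inter> {0<..<2 * pi / 3} = {}" "T \<inter> {2 * pi / 3<..<4 * pi / 3} = {}" "T \<inter> {4 * pi / 3<..<2 * pi} = {}"
    using pi_gt_zero by (auto simp: T_def tri_angles_def simp del: pi_gt_zero)
  have \<alpha>v: "\<alpha> 0 = 2 / 3" "\<alpha> (2 * pi / 3) = 2 / 3" by (simp_all add: \<alpha>_def)
  have s1: "straight_side f T \<alpha> (- (2 * pi / 3)) 0 (2 * pi / 3)" and s2: "straight_side f T \<alpha> 0 (2 * pi / 3) (4 * pi / 3)"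
    and s3: "straight_side f T \<alpha> (2 * pi / 3) (4 * pi / 3) (2 * pi)"
    by (rule side; simp add: sums free \<alpha>sum \<alpha>v)+
  define l1 l2 l3 where "l1 = edge_length f (- (2 * pi / 3)) 0" and "l2 = edge_length f 0 (2 * pi / 3)"
    and "l3 = edge_length f (2 * pi / 3) (4 * pi / 3)"
  note s = s1[unfolded straight_side_def l1_def[symmetric]] s2[unfolded straight_side_def l2_def[symmetric]]
    s3[unfolded straight_side_def l3_def[symmetric]]
  define L where "L = l2 (4 * pi / 3)"
  have P2: "f (cis \<theta>) = of_real (l2 \<theta>)" if "2 * pi / 3 \<le> \<theta>" "\<theta> \<le> 4 * pi / 3" for \<theta>
    using s(2) that f(4) by simp
  have P3: "f (cis \<theta>) = of_real (L - l3 \<theta>) + of_real (l3 \<theta>) * \<omega>" if "4 * pi / 3 \<le> \<theta>" "\<theta> \<le> 2 * pi" for \<theta>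
  proof -
    have "f (cis \<theta>) = f (cis (4 * pi / 3)) + of_real (l3 \<theta>) * cis (2 * pi / 3)" using s(3) that by blast
    thus ?thesis unfolding omega_simps(3) using P2[of "4 * pi / 3"] by (simp add: L_def algebra_simps)
  qed
  have Pone: "f 1 = of_real (L - l3 (2 * pi)) + of_real (l3 (2 * pi)) * \<omega>"
    using P3[of "2 * pi"] by simp
  have P1: "f (cis \<theta>) = of_real (L - l3 (2 * pi)) + of_real (l3 (2 * pi) - l1 \<theta>) * \<omega>" if "0 \<le> \<theta>" "\<theta> \<le> 2 * pi / 3" for \<theta>
  proof -
    have "f (cis \<theta>) = f (cis 0) + of_real (l1 \<theta>) * cis (- (2 * pi / 3))" using s(1) that by blast
    thus ?thesis unfolding cis_zero Pone omega_simps(4) by (simp add: algebra_simps)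
  qed
  have "of_real (L - l3 (2 * pi)) + of_real (l3 (2 * pi) - l1 (2 * pi / 3)) * \<omega> = 0"
    using P1[of "2 * pi / 3"] f(4) by simp
  hence close: "l1 (2 * pi / 3) = L" "l3 (2 * pi) = L"
    by (auto simp: complex_eq_iff sin_60 cos_60)
  define V where "V = (\<lambda>z. f z / of_real L)"
  have L: "L > 0" using s(2) by (simp add: L_def)
  have V_coord: "V z = of_real (x / L) + of_real (y / L) * \<omega>" if "f z = of_real x + of_real y * \<omega>" for z x y
    by (simp add: V_def that add_divide_distrib)
  have cont: "continuous_on (cball 0 1) V" unfolding V_def using L by (intro continuous_intros f) auto
  have hol: "V holomorphic_on ball 0 1" unfolding V_def using L by (intro holomorphic_intros f) auto
  have injV: "inj_on V (cball 0 1)"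
    using f(3) L by (auto simp: inj_on_def V_def)
  have bd: "V ` sphere 0 1 \<subseteq> frontier equilateral_triangle"
  proof safe
    fix z :: complex assume "z \<in> sphere 0 1"
    then obtain \<theta> where \<theta>: "0 \<le> \<theta>" "\<theta> < 2 * pi" "z = cis \<theta>" by (auto elim: unit_circle_angle)
    consider "\<theta> \<le> 2 * pi / 3" | "2 * pi / 3 \<le> \<theta>" "\<theta> \<le> 4 * pi / 3" | "4 * pi / 3 \<le> \<theta>" by linarith
    thus "V z \<in> frontier equilateral_triangle"
    proof cases
      case 1
      have *: "V z = of_real (0 / L) + of_real ((L - l1 \<theta>) / L) * \<omega>"
        unfolding \<theta>(3) using P1[of \<theta>] \<theta> 1 by (intro V_coord) (simp add: close)
      show ?thesis unfolding * using s(1) \<theta> 1 L close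
        by (intro triangle_frontier) auto
    next
      case 2
      have *: "V z = of_real (l2 \<theta> / L) + of_real (0 / L) * \<omega>"
        unfolding \<theta>(3) using P2[of \<theta>] 2 by (intro V_coord) simp
      show ?thesis unfolding * using s(2) 2 L
        by (intro triangle_frontier) (auto simp: L_def[symmetric])
    next
      case 3
      have *: "V z = of_real ((L - l3 \<theta>) / L) + of_real (l3 \<theta> / L) * \<omega>"
        unfolding \<theta>(3) using P3[of \<theta>] 3 \<theta> by (intro V_coord) simp
      have sum: "(L - l3 \<theta>) / L + l3 \<theta> / L = 1" using L by (simp add: diff_divide_distrib)
      show ?thesis unfolding * using s(3) 3 \<theta> L close sum
        by (intro triangle_frontier) auto
    qed
  qed
  have img: "V ` ball 0 1 = interior equilateral_triangle" "V ` cball 0 1 = equilateral_triangle"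
    by (rule image_disc_eq_convex[OF cont hol inj_on_subset[OF injV] polygon_compact_convex(4,5) bd]; auto)+
  have v: "V (cis (2 * pi / 3)) = 0" "V (cis (4 * pi / 3)) = 1" "V 1 = \<omega>"
    using P2[of "4 * pi / 3"] Pone L by (auto simp: V_def f(4) L_def[symmetric] close)
  define k where "k = (\<lambda>w. l2 (circle_angle w) / L)"
  have mono: "circle_angle x \<le> circle_angle y" if "x \<le> y" for x y
    using circle_angle_strict_mono[of x y] that by (cases "x = y") auto
  have range: "2 * pi / 3 \<le> circle_angle w" "circle_angle w \<le> 4 * pi / 3" if "0 \<le> w" "w \<le> 1" for w
    using mono[of 0 w] mono[of w 1] that unfolding circle_angle_0 circle_angle_1 by auto
  have Vk: "V (cis (circle_angle w)) = of_real (k w)" if "0 \<le> w" "w \<le> 1" for w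
    using P2[OF range[OF that]] by (simp add: V_def k_def)
  have k01: "k 0 = 0" "k 1 = 1"
    using L unfolding k_def circle_angle_0 circle_angle_1 L_def[symmetric] by (simp_all add: l2_def edge_length_def)
  have contk: "continuous_on {0..1} k"
    unfolding k_def l2_def edge_length_def using L
    by (intro continuous_intros continuous_on_compose2[OF f(1)] circle_angle_continuous) auto
  have derk: "(k has_field_derivative tri_density w / (sqrt 3 * L)) (at w)" if w: "0 < w" "w < 1" for w
  proof -
    have "2 * pi / 3 < circle_angle w" "circle_angle w < 4 * pi / 3" by (rule circle_angle_range[OF w(1,2)])+
    hence "(l2 has_field_derivative m (circle_angle w)) (at (circle_angle w))"
      unfolding m_def using s(2) by blast
    from DERIV_cdivide[OF DERIV_chain2[OF this circle_angle_has_derivative], of L]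
    show ?thesis unfolding m_def T_def \<alpha>_def norm_tri_deriv_on_circle[OF w] by (simp add: k_def[abs_def])
  qed
  \<comment> \<open>The unknown side length \<open>L\<close> is found by comparing the total
    increment k 1 - k 0 = 1 with the complete Beta integral.\<close>
  have "((\<lambda>w. tri_density w / (sqrt 3 * L)) has_integral k 1 - k 0) {0..1}"
    using derk by (intro fundamental_theorem_of_calculus_interior contk)
       (auto simp: has_real_derivative_iff_has_vector_derivative[symmetric])
  moreover have "((\<lambda>w. tri_density w / (sqrt 3 * L)) has_integral Beta (1 / 3) (1 / 3) / (sqrt 3 * L)) {0..1}"
    using has_integral_divide[OF has_integral_Beta_real[of "1/3" "1/3"], of "sqrt 3 * L"] by (simp add: tri_density_def)
  ultimately have "k 1 - k 0 = Beta (1 / 3) (1 / 3) / (sqrt 3 * L)"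
    by (rule has_integral_unique)
  hence beta: "sqrt 3 * L = Beta (1 / 3) (1 / 3)" using L k01 by simp
  show ?thesis
  proof (rule that[of V k])
    show "V (cis (circle_angle w)) = of_real (k w)" if "0 \<le> w" "w \<le> 1" for w
      by (rule Vk[OF that])
    show "(k has_field_derivative tri_density w / Beta (1 / 3) (1 / 3)) (at w)" if "0 < w" "w < 1" for w
      by (rule derk[OF that, unfolded beta])
  qed (fact cont hol injV img v contk k01)+
qed

section \<open>Identification of the Cardy-Smirnov map\<close>

lemma disc_map_inverse:
  assumes "continuous_on (cball 0 1) V" "V holomorphic_on ball 0 1" "inj_on V (cball 0 1)"
    "V ` ball 0 1 = interior Q" "V ` cball (0::complex) 1 = Q"
  obtains W where "homeomorphism (cball 0 1) Q V W" "W holomorphic_on interior Q" "W ` interior Q = ball 0 1"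
proof -
  obtain W where W: "homeomorphism (cball 0 1) Q V W"
    using homeomorphism_compact[OF compact_cball assms(1,5,3)] by blast
  have inj: "inj_on V (ball 0 1)" using assms(3) by (rule inj_on_subset) auto
  obtain G where G: "G holomorphic_on V ` ball 0 1" "\<And>z. z \<in> ball 0 1 \<Longrightarrow> G (V z) = z"
    using holomorphic_has_inverse[OF assms(2) open_ball inj] by metis
  have WV: "W (V z) = z" if "z \<in> ball 0 1" for z
    using W that by (auto simp: homeomorphism_def)
  have "W holomorphic_on interior Q"
    using G(1) unfolding assms(4)
  proof (rule holomorphic_transform)
    fix x assume "x \<in> interior Q"
    then obtain z where "z \<in> ball 0 1" "x = V z" unfolding assms(4)[symmetric] by blast
    thus "G x = W x" using G(2) WV by simp
  qed
  moreover have "W ` interior Q = ball 0 1"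
    unfolding assms(4)[symmetric] image_image using WV by simp
  ultimately show ?thesis using W that by blast
qed

text \<open>Composing \<open>V\<close> with the inverse of \<open>S\<close> gives one admissible
  map. Any other, \<open>g1\<close>, transported to the disc as V^(-1) o g1 o S, is an automorphism
  fixing the three cube roots of unity, hence the identity, so the two agree on the parallelogram.
  Extensionality settles the rest.\<close>

theorem cardy_smirnov_map_value:
  assumes S: "continuous_on (cball 0 1) S" "S holomorphic_on ball 0 1" "inj_on S (cball 0 1)"
      "S ` ball 0 1 = interior (parallelogram r)" "S ` cball 0 1 = parallelogram r"
      "S (cis (2 * pi / 3)) = 0" "S p = of_real r"
      "S (cis (4 * pi / 3)) = of_real r + \<omega>" "S 1 = \<omega>" and p: "p \<in> cball 0 1"
    and V: "continuous_on (cball 0 1) V" "V holomorphic_on ball 0 1" "inj_on V (cball 0 1)"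
      "V ` ball 0 1 = interior equilateral_triangle" "V ` cball 0 1 = equilateral_triangle"
      "V (cis (2 * pi / 3)) = 0" "V (cis (4 * pi / 3)) = 1" "V 1 = \<omega>"
  shows "cardy_smirnov_map r (of_real r) = V p"
proof -
  let ?P = "parallelogram r" and ?D = equilateral_triangle
  obtain S' where S': "homeomorphism (cball 0 1) ?P S S'" "S' holomorphic_on interior ?P" "S' ` interior ?P = ball 0 1"
    using disc_map_inverse[OF S(1-5)] by blast
  obtain V' where V': "homeomorphism (cball 0 1) ?D V V'" "V' holomorphic_on interior ?D" "V' ` interior ?D = ball 0 1"
    using disc_map_inverse[OF V(1-5)] by blast
  have S'S: "S' (S z) = z" if "z \<in> cball 0 1" for z using S'(1) that by (auto simp: homeomorphism_def)
  have V'V: "V' (V z) = z" if "z \<in> cball 0 1" for z using V'(1) that by (auto simp: homeomorphism_def)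
  have pts: "cis (2 * pi / 3) \<in> cball 0 1" "cis (4 * pi / 3) \<in> cball 0 1" "(1::complex) \<in> cball 0 1" by auto
  define g where "g = restrict (V \<circ> S') ?P"
  have hom: "homeomorphism ?P ?D (V \<circ> S') (S \<circ> V')"
    by (rule homeomorphism_compose[OF homeomorphism_symD[OF S'(1)] V'(1)])
  have g_hom: "homeomorphism ?P ?D g (S \<circ> V')"
    using hom by (rule homeomorphism_cong) (auto simp: g_def)
  have sub: "interior ?P \<subseteq> ?P" by (rule interior_subset)
  have g_hol: "g holomorphic_on interior ?P"
  proof (rule holomorphic_transform)
    show "V \<circ> S' holomorphic_on interior ?P"
      by (rule holomorphic_on_compose_gen[OF S'(2) V(2)]) (use S'(3) in auto)
  qed (use sub in \<open>auto simp: g_def\<close>)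
  have g_img: "g ` interior ?P = interior ?D"
  proof -
    have "g ` interior ?P = V ` (S' ` interior ?P)" unfolding image_image using sub by (intro image_cong) (auto simp: g_def)
    thus ?thesis unfolding S'(3) V(4) .
  qed
  have h_hol: "(S \<circ> V') holomorphic_on interior ?D"
    by (rule holomorphic_on_compose_gen[OF V'(2) S(2)]) (use V'(3) in auto)
  have SP: "S z \<in> ?P" if "z \<in> cball 0 1" for z using S(5) that by blast
  have gS: "g (S z) = V z" if "z \<in> cball 0 1" for z using SP[OF that] S'S[OF that] by (simp add: g_def)
  have g_cs: "is_cardy_smirnov_map r g"
    unfolding is_cardy_smirnov_map_def
    using g_hom g_img g_hol h_hol gS[OF pts(1)] gS[OF pts(2)] gS[OF pts(3)] S(6,8,9) V(6,7,8) by auto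
  have uniq: "g1 = g" if g1: "g1 \<in> extensional ?P" "is_cardy_smirnov_map r g1" for g1
  proof -
    obtain h1 where h1: "homeomorphism ?P ?D g1 h1" "g1 ` interior ?P = interior ?D" "g1 holomorphic_on interior ?P"
        "h1 holomorphic_on interior ?D"
      and vert: "g1 0 = 0" "g1 (of_real r + \<omega>) = 1" "g1 \<omega> = \<omega>"
      using g1(2) unfolding is_cardy_smirnov_map_def by blast
    have inv1: "g1 (h1 y) = y" if "y \<in> ?D" for y using h1(1) that by (auto simp: homeomorphism_def)
    have inv2: "h1 (g1 x) = x" if "x \<in> ?P" for x using h1(1) that by (auto simp: homeomorphism_def)
    have h1_img: "h1 ` interior ?D = interior ?P"
      unfolding h1(2)[symmetric] image_image using inv2 sub by (force simp: subset_iff)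
    define F where "F = V' \<circ> (g1 \<circ> S)"
    define G where "G = S' \<circ> (h1 \<circ> V)"
    have homF: "homeomorphism (cball 0 1) (cball 0 1) F G"
      unfolding F_def G_def
      using homeomorphism_compose[OF homeomorphism_compose[OF S'(1) h1(1)] homeomorphism_symD[OF V'(1)]]
      by (simp add: o_assoc)
    have contF: "continuous_on (cball 0 1) F" using homF by (simp add: homeomorphism_def)
    have holF: "F holomorphic_on ball 0 1" unfolding F_def
      by (rule holomorphic_on_compose_gen[OF holomorphic_on_compose_gen[OF S(2) h1(3)] V'(2)])
         (use S(4) h1(2) in \<open>auto simp: image_comp[symmetric]\<close>)
    have holG: "G holomorphic_on ball 0 1" unfolding G_def
      by (rule holomorphic_on_compose_gen[OF holomorphic_on_compose_gen[OF V(2) h1(4)] S'(2)])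
         (use V(4) h1_img in \<open>auto simp: image_comp[symmetric]\<close>)
    have imgF: "F ` ball 0 1 \<subseteq> ball 0 1"
      unfolding F_def image_comp[symmetric] S(4) h1(2) V'(3) by simp
    have imgG: "G ` ball 0 1 \<subseteq> ball 0 1"
      unfolding G_def image_comp[symmetric] V(4) h1_img S'(3) by simp
    have FG: "F (G z) = z" "G (F z) = z" if "norm z < 1" for z
      using homF that by (auto simp: homeomorphism_def)
    have fixed: "F (cis (2 * pi / 3)) = cis (2 * pi / 3)" "F (cis (4 * pi / 3)) = cis (4 * pi / 3)" "F 1 = 1"
      using V'V[OF pts(1)] V'V[OF pts(2)] V'V[OF pts(3)] by (simp_all add: F_def S vert V(6-8))
    \<comment> \<open>The three prevertices are distinct because \<open>V\<close> sends them to the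
      distinct points 0, 1 and \<omega>.\<close>
    have dist: "cis (2 * pi / 3) \<noteq> cis (4 * pi / 3)" "cis (2 * pi / 3) \<noteq> 1" "cis (4 * pi / 3) \<noteq> 1"
    proof -
      have "\<omega> \<noteq> 0" "\<omega> \<noteq> 1" by (simp_all add: complex_eq_iff cos_60)
      thus "cis (2 * pi / 3) \<noteq> cis (4 * pi / 3)" "cis (2 * pi / 3) \<noteq> 1" "cis (4 * pi / 3) \<noteq> 1"
        using V(6-8) by force+
    qed
    have id: "F z = z" if "z \<in> cball 0 1" for z
      by (rule disc_automorphism_three_fixed_points[OF contF holF holG imgF imgG FG fixed dist pts that])
    have eq: "g1 (S z) = V z" if "z \<in> cball 0 1" for z
    proof -
      have "g1 (S z) \<in> ?D" using SP[OF that] h1(1) by (auto simp: homeomorphism_def)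
      hence "g1 (S z) = V (V' (g1 (S z)))" using V'(1) by (auto simp: homeomorphism_def)
      also have "V' (g1 (S z)) = z" using id[OF that] by (simp add: F_def)
      finally show ?thesis .
    qed
    show "g1 = g"
    proof (rule extensionalityI[OF g1(1)])
      show "g \<in> extensional ?P" by (simp add: g_def)
      fix x assume "x \<in> ?P"
      then obtain z where "z \<in> cball 0 1" "x = S z" using S(5) by blast
      thus "g1 x = g x" using eq gS by simp
    qed
  qed
  have "cardy_smirnov_map r = g"
    unfolding cardy_smirnov_map_def
  proof (rule the_equality)
    show "g \<in> extensional ?P \<and> is_cardy_smirnov_map r g" using g_cs by (simp add: g_def)
  qed (use uniq in blast)
  thus ?thesis using gS[OF p] S(7) by simp
qed

section \<open>The Carleson length as an integral\<close>

lemma hyp_coeff_Beta: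
  "pochhammer (2 / 3) n / fact n * Beta (real n + 1 / 3) (2 / 3) = Gamma (1 / 3) * Gamma (2 / 3) * hyp_coeff n"
proof -
  have "Gamma (1 / 3 + real n) = pochhammer (1 / 3) n * Gamma (1 / 3)"
  proof -
    have "(1 / 3 :: real) \<notin> \<int>\<^sub>\<le>\<^sub>0" by (auto elim!: nonpos_Ints_cases)
    moreover from this have "Gamma (1 / 3 :: real) \<noteq> 0" by (simp add: Gamma_eq_zero_iff)
    ultimately show ?thesis using pochhammer_Gamma[of "1 / 3 :: real" n] by (simp add: field_simps)
  qed
  moreover have "Gamma (1 + real n) = fact n" by (rule Gamma_fact)
  ultimately show ?thesis
    by (simp add: Beta_def hyp_coeff_def add_ac power2_eq_square)
qed

text \<open>The binomial series of (1 - xu)^(-2/3) has nonnegative terms here, so monotone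
  convergence permits termwise integration; each term is a Beta integral.\<close>

lemma hyp_Euler_integral:
  assumes x: "0 < x" "x < 1"
  shows "((\<lambda>u. u powr (- 2 / 3) * (1 - u) powr (- 1 / 3) * (1 - x * u) powr (- 2 / 3)) has_integral
     Gamma (1 / 3) * Gamma (2 / 3) * hyp x) {0..1}"
proof -
  define f where "f = (\<lambda>n u. pochhammer (2 / 3) n / fact n * x ^ n * (u powr (real n + 1 / 3 - 1) * (1 - u) powr (2 / 3 - 1)))"
  have nn: "f n u \<ge> 0" for n u
    using x by (simp add: f_def pochhammer_nonneg)
  have int_f: "(f n has_integral Gamma (1 / 3) * Gamma (2 / 3) * (hyp_coeff n * x ^ n)) {0..1}" for n
  proof -
    have "(f n has_integral pochhammer (2 / 3) n / fact n * x ^ n * Beta (real n + 1 / 3) (2 / 3)) {0..1}"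
      unfolding f_def by (intro has_integral_mult_right has_integral_Beta_real) auto
    also have "pochhammer (2 / 3) n / fact n * x ^ n * Beta (real n + 1 / 3) (2 / 3) =
        pochhammer (2 / 3) n / fact n * Beta (real n + 1 / 3) (2 / 3) * x ^ n" by (simp only: mult_ac)
    finally show ?thesis unfolding hyp_coeff_Beta by (simp only: mult.assoc)
  qed
  show ?thesis
  proof (rule has_integral_monotone_convergence_increasing)
    show "((\<lambda>u. \<Sum>n<k. f n u) has_integral (\<Sum>n<k. Gamma (1 / 3) * Gamma (2 / 3) * (hyp_coeff n * x ^ n))) {0..1}" for k
      by (intro has_integral_sum int_f) auto
    show "(\<Sum>n<k. f n u) \<le> (\<Sum>n<Suc k. f n u)" for k u using nn[of k u] by simp
    have "(\<lambda>n. hyp_coeff n * x ^ n) sums hyp x" unfolding hyp_def using x by (intro summable_sums hyp_summable) auto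
    hence "(\<lambda>n. Gamma (1 / 3) * Gamma (2 / 3) * (hyp_coeff n * x ^ n)) sums (Gamma (1 / 3) * Gamma (2 / 3) * hyp x)"
      by (rule sums_mult)
    thus "(\<lambda>k. \<Sum>n<k. Gamma (1 / 3) * Gamma (2 / 3) * (hyp_coeff n * x ^ n)) \<longlonglongrightarrow> Gamma (1 / 3) * Gamma (2 / 3) * hyp x"
      unfolding sums_def .
    fix u :: real assume u: "u \<in> {0..1}"
    have "(\<lambda>n. f n u) sums (u powr (- 2 / 3) * (1 - u) powr (- 1 / 3) * (1 - x * u) powr (- 2 / 3))"
    \<comment> \<open>At the endpoints all terms and the limit are 0, since \<open>0 powr a\<close>
      is 0 for every exponent.\<close>
    proof (cases "u = 0 \<or> u = 1")
      case True
      thus ?thesis by (auto simp: f_def)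
    next
      case False
      hence u: "0 < u" "u < 1" using u by auto
      have xu: "\<bar>- (x * u)\<bar> < 1" using x u mult_strict_mono[of x 1 u 1] by (simp add: abs_mult)
      from gen_binomial_real[OF xu, of "- 2 / 3"]
      have "(\<lambda>n. ((- 2 / 3) gchoose n) * (- (x * u)) ^ n) sums (1 - x * u) powr (- 2 / 3)" by simp
      hence "(\<lambda>n. u powr (- 2 / 3) * (1 - u) powr (- 1 / 3) * (((- 2 / 3) gchoose n) * (- (x * u)) ^ n)) sums
          (u powr (- 2 / 3) * (1 - u) powr (- 1 / 3) * (1 - x * u) powr (- 2 / 3))"
        by (rule sums_mult)
      moreover have "u powr (- 2 / 3) * (1 - u) powr (- 1 / 3) * (((- 2 / 3) gchoose n) * (- (x * u)) ^ n) = f n u" for n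
      proof -
        have "((- 2 / 3) gchoose n) * (- (x * u)) ^ n = pochhammer (2 / 3) n / fact n * (x ^ n * u ^ n)"
          by (simp add: gbinomial_pochhammer power_mult_distrib power_minus[of "x * u"] flip: power_mult)
        moreover have "u powr (real n + 1 / 3 - 1) = u powr (- 2 / 3) * u ^ n"
          using u by (simp add: powr_realpow[symmetric] powr_add[symmetric])
        ultimately show ?thesis by (simp add: f_def)
      qed
      ultimately show ?thesis by simp
    qed
    thus "(\<lambda>k. \<Sum>n<k. f n u) \<longlonglongrightarrow> u powr (- 2 / 3) * (1 - u) powr (- 1 / 3) * (1 - x * u) powr (- 2 / 3)"
      unfolding sums_def .
  qed
qed

text \<open>Substituting w = l u gives Euler's integral; the powers l^(2/3) and l^(1/3) from the
  rescaled factors cancel the Jacobian 1/l.\<close>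

lemma par_density_integral_left:
  assumes l: "0 < l" "l < 1"
  shows "(par_density l has_integral Gamma (1 / 3) * Gamma (2 / 3) * hyp l) {0..l}"
proof -
  let ?C = "Gamma (1 / 3) * Gamma (2 / 3) * hyp l"
  let ?f = "\<lambda>u. u powr (- 2 / 3) * (1 - u) powr (- 1 / 3) * (1 - l * u) powr (- 2 / 3)"
  have "((\<lambda>w. ?f ((1 / l) *\<^sub>R w + 0)) has_integral (1 / \<bar>1 / l\<bar> ^ DIM(real)) *\<^sub>R ?C)
      ((\<lambda>w. (1 / (1 / l)) *\<^sub>R w + - ((1 / (1 / l)) *\<^sub>R 0)) ` cbox 0 1)"
    using l hyp_Euler_integral[OF l] by (intro has_integral_affinity) auto
  moreover have "(\<lambda>w. (1 / (1 / l)) *\<^sub>R w + - ((1 / (1 / l)) *\<^sub>R 0)) ` cbox 0 1 = {0..l}"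
    using l by (simp add: image_mult_atLeastAtMost)
  ultimately have "((\<lambda>w. ?f (w / l)) has_integral l * ?C) {0..l}" using l by simp
  from has_integral_mult_right[OF this, of "1 / l"]
  have "((\<lambda>w. 1 / l * ?f (w / l)) has_integral ?C) {0..l}" using l by simp
  thus ?thesis
  proof (rule has_integral_eq[rotated])
    fix w assume w: "w \<in> {0..l}"
    have m1: "(w / l) powr (- 2 / 3) = w powr (- 2 / 3) * l powr (2 / 3)"
      using w l by (simp add: powr_divide powr_minus_divide)
    have m2: "(1 - w / l) powr (- 1 / 3) = (l - w) powr (- 1 / 3) * l powr (1 / 3)"
    proof -
      have "1 - w / l = (l - w) / l" using l by (simp add: diff_divide_distrib)
      thus ?thesis using w l by (simp add: powr_divide powr_minus_divide)
    qed
    have m3: "l * (w / l) = w" using l by simp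
    have m4: "l powr (2 / 3) * l powr (1 / 3) = l" using l by (simp flip: powr_add)
    have "1 / l * ?f (w / l) = 1 / l * (l powr (2 / 3) * l powr (1 / 3)) * (w powr (- 2 / 3) * (l - w) powr (- 1 / 3) * (1 - w) powr (- 2 / 3))"
      unfolding m1 m2 m3 by (simp only: mult_ac)
    also have "\<dots> = par_density l w"
      unfolding m4 using w l by (simp add: par_density_def tri_density_def abs_minus_commute[of w])
    finally show "1 / l * ?f (w / l) = par_density l w" .
  qed
qed

text \<open>The reflection w -> 1 - w swaps the two equal exponents at 0 and 1 and replaces l by 1 -
  l.\<close>

lemma par_density_integral_right:
  assumes l: "0 < l" "l < 1"
  shows "(par_density l has_integral Gamma (1 / 3) * Gamma (2 / 3) * hyp (1 - l)) {l..1}"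
proof -
  let ?C = "Gamma (1 / 3) * Gamma (2 / 3) * hyp (1 - l)"
  have "((\<lambda>w. par_density (1 - l) ((- 1) *\<^sub>R w + 1)) has_integral (1 / \<bar>- 1\<bar> ^ DIM(real)) *\<^sub>R ?C)
      ((\<lambda>w. (1 / (- 1)) *\<^sub>R w + - ((1 / (- 1)) *\<^sub>R 1)) ` cbox 0 (1 - l))"
    using par_density_integral_left[of "1 - l"] l by (intro has_integral_affinity) auto
  moreover have "(\<lambda>w. (1 / (- 1)) *\<^sub>R w + - ((1 / (- 1)) *\<^sub>R 1)) ` cbox 0 (1 - l) = {l..1}"
    by (auto simp: image_iff intro!: bexI[of _ "1 - _"])
  moreover have "par_density (1 - l) ((- 1) *\<^sub>R w + 1) = par_density l w" for w
  proof -
    have "\<bar>l - w\<bar> = \<bar>w - l\<bar>" by (rule abs_minus_commute)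
    thus ?thesis by (simp add: par_density_def tri_density_def mult_ac)
  qed
  ultimately show ?thesis by simp
qed

section \<open>Nome, modulus and the eta product\<close>

definition nome :: "real \<Rightarrow> real" where "nome t = exp (- (2 * pi / sqrt 3) * t)"
text \<open>The inverse function of \<open>hyp_ratio\<close>: the rate 2 pi / sqrt 3 in the nome is
  1 / \<open>hyp_const\<close>, which normalises the ratio at \<open>nome t\<close> to t.\<close>

definition modulus :: "real \<Rightarrow> real" where "modulus t = cubic_x (nome t)"

lemma nome_range: "t > 0 \<Longrightarrow> 0 < nome t" "t > 0 \<Longrightarrow> nome t < 1"
  by (simp_all add: nome_def)

lemma modulus_range: "t > 0 \<Longrightarrow> 0 < modulus t" "t > 0 \<Longrightarrow> modulus t < 1"
  using cubic_x_range[of "nome t"] nome_range[of t] by (simp_all add: modulus_def)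

lemma hyp_ratio_modulus:
  assumes "t > 0" shows "hyp_ratio (modulus t) = t"
proof -
  have "hyp_ratio (modulus t) = hyp_const * (2 * pi / sqrt 3) * t"
    using hyp_ratio_cubic_x[of "nome t"] nome_range[of t] assms by (simp add: modulus_def) (simp add: nome_def)
  also have "hyp_const * (2 * pi / sqrt 3) = 1" by (simp add: hyp_const_def)
  finally show ?thesis by simp
qed

lemma hyp_ratio_strict_antimono:
  assumes "0 < x" "x < y" "y < 1" shows "hyp_ratio y < hyp_ratio x"
proof (rule DERIV_neg_imp_decreasing[OF assms(2)])
  fix z assume z: "x \<le> z" "z \<le> y"
  have "hyp z \<ge> 1" using z assms by (intro hyp_bounds) auto
  hence "- hyp_const / (z * (1 - z) * (hyp z)\<^sup>2) < 0"
    using z assms hyp_const_pos by (auto intro!: divide_neg_pos mult_pos_pos)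
  thus "\<exists>d. (hyp_ratio has_field_derivative d) (at z) \<and> d < 0"
    using hyp_ratio_has_derivative[of z] z assms by auto
qed

lemma modulus_hyp_ratio:
  assumes "0 < x" "x < 1" shows "modulus (hyp_ratio x) = x"
proof -
  have "hyp_ratio x > 0"
    using hyp_bounds(1)[of x] hyp_bounds(1)[of "1 - x"] assms by (simp add: hyp_ratio_def)
  hence m: "0 < modulus (hyp_ratio x)" "modulus (hyp_ratio x) < 1" "hyp_ratio (modulus (hyp_ratio x)) = hyp_ratio x"
    by (simp_all add: modulus_range hyp_ratio_modulus)
  show ?thesis
    using hyp_ratio_strict_antimono[of x "modulus (hyp_ratio x)"] hyp_ratio_strict_antimono[of "modulus (hyp_ratio x)" x] m assms
    by (metis less_irrefl linorder_neqE_linordered_idom)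
qed

lemma modulus_has_derivative:
  assumes t: "t > 0"
  defines "x \<equiv> modulus t"
  shows "(modulus has_field_derivative - (x * (1 - x) * (hyp x)\<^sup>2 / hyp_const)) (at t)"
proof -
  have x: "0 < x" "x < 1" "hyp_ratio x = t" using modulus_range t hyp_ratio_modulus by (auto simp: x_def)
  have h: "hyp x \<ge> 1" using x by (intro hyp_bounds) auto
  have "isCont modulus (hyp_ratio x)"
  proof (rule isCont_inverse_function2[of "x / 2" x "(1 + x) / 2"])
    fix z assume "x / 2 \<le> z" "z \<le> (1 + x) / 2"
    hence z: "0 < z" "z < 1" using x by auto
    show "modulus (hyp_ratio z) = z" by (rule modulus_hyp_ratio[OF z])
    show "isCont hyp_ratio z" by (rule DERIV_isCont[OF hyp_ratio_has_derivative[OF z]])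
  qed (use x in auto)
  hence cont: "isCont modulus t" by (simp add: x(3))
  have "(modulus has_field_derivative inverse (- hyp_const / (x * (1 - x) * (hyp x)\<^sup>2))) (at t)"
  proof (rule DERIV_inverse_function[of hyp_ratio _ modulus t "t / 2" "t + 1"])
    show "(hyp_ratio has_field_derivative - hyp_const / (x * (1 - x) * (hyp x)\<^sup>2)) (at (modulus t))"
      using hyp_ratio_has_derivative[OF x(1,2)] by (simp add: x_def)
    show "- hyp_const / (x * (1 - x) * (hyp x)\<^sup>2) \<noteq> 0" using x h hyp_const_pos by simp
    show "hyp_ratio (modulus y) = y" if "t / 2 < y" "y < t + 1" for y
      using that t by (intro hyp_ratio_modulus) auto
  qed (use t cont in auto)
  thus ?thesis by (simp add: field_simps)
qed

definition eta_product :: "real \<Rightarrow> real" where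
  "eta_product t = root 3 (nome t) * (euler_real (nome t))\<^sup>2 * (euler_real (nome t ^ 3))\<^sup>2"

lemma eta_product_eq:
  assumes t: "t > 0"
  shows "dedekind_eta (\<i> / of_real (sqrt 3) * of_real t) ^ 2 * dedekind_eta (\<i> * of_real (sqrt 3) * of_real t) ^ 2 =
    of_real (eta_product t)"
proof -
  define q where "q = nome t"
  have q: "0 < q" "q < 1" and q3: "0 < q ^ 3" "q ^ 3 < 1"
    using nome_range[OF t] power3_less_1[of q] by (auto simp: q_def)
  have s3: "sqrt 3 * sqrt 3 = 3" by simp
  have a1: "2 * of_real pi * \<i> * (\<i> / of_real (sqrt 3) * of_real t) = of_real (- (2 * pi / sqrt 3) * t)"
    by (simp add: field_simps)
  have a2: "2 * of_real pi * \<i> * (\<i> * of_real (sqrt 3) * of_real t) = of_real (3 * (- (2 * pi / sqrt 3) * t))"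
  proof -
    have "- (2 * pi) * sqrt 3 * t = 3 * (- (2 * pi / sqrt 3) * t)"
      using real_div_sqrt[of 3] by (simp add: field_simps)
    moreover have "2 * of_real pi * \<i> * (\<i> * of_real (sqrt 3) * of_real t) = of_real (- (2 * pi) * sqrt 3 * t)"
      by (simp add: algebra_simps)
    ultimately show ?thesis by simp
  qed
  have e1: "exp (of_real (- (2 * pi / sqrt 3) * t)) = complex_of_real q"
    unfolding exp_of_real q_def nome_def ..
  have e2: "exp (of_real (3 * (- (2 * pi / sqrt 3) * t))) = complex_of_real (q ^ 3)"
    unfolding exp_of_real q_def nome_def by (simp flip: exp_of_nat_mult)
  have d: "exp (complex_of_real y / 24) = of_real (exp (y / 24))" for y
    by (simp flip: exp_of_real)
  have d1: "dedekind_eta (\<i> / of_real (sqrt 3) * of_real t) = of_real (exp (- (2 * pi / sqrt 3) * t / 24) * euler_real q)"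
    unfolding dedekind_eta_def a1 e1 d euler_prod_def[symmetric] euler_prod_of_real[OF less_imp_le[OF q(1)] q(2)]
    by (simp only: of_real_mult)
  have d2: "dedekind_eta (\<i> * of_real (sqrt 3) * of_real t) = of_real (exp (3 * (- (2 * pi / sqrt 3) * t) / 24) * euler_real (q ^ 3))"
    unfolding dedekind_eta_def a2 e2 d euler_prod_def[symmetric] euler_prod_of_real[OF less_imp_le[OF q3(1)] q3(2)]
    by (simp only: of_real_mult)
  have "root 3 q = exp (- (2 * pi / sqrt 3) * t / 3)"
    by (rule real_root_pos_unique) (simp_all add: q_def nome_def flip: exp_of_nat_mult)
  \<comment> \<open>The exponents 2/24 and 6/24 of the nome add up to 1/3.\<close>
  moreover have "exp (- (2 * pi / sqrt 3) * t / 24) ^ 2 * exp (3 * (- (2 * pi / sqrt 3) * t) / 24) ^ 2 = exp (- (2 * pi / sqrt 3) * t / 3)"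
    by (simp flip: exp_of_nat_mult exp_add)
  ultimately have "(exp (- (2 * pi / sqrt 3) * t / 24) * euler_real q)\<^sup>2 *
      (exp (3 * (- (2 * pi / sqrt 3) * t) / 24) * euler_real (q ^ 3))\<^sup>2 = eta_product t"
    unfolding eta_product_def q_def[symmetric] power_mult_distrib by (simp only: mult_ac)
  thus ?thesis unfolding d1 d2 by (simp only: of_real_power[symmetric] of_real_mult[symmetric])
qed

lemma eta_product_nonneg: "t > 0 \<Longrightarrow> eta_product t \<ge> 0"
  by (simp add: eta_product_def nome_def)

text \<open>Origin of the prefactor: Beta(1/3, 1/3) = Gamma(1/3)^2 / Gamma(2/3), and reflection
  replaces 1 / Gamma(2/3) by \<open>hyp_const\<close> * Gamma(1/3). The left side becomes
  \<open>hyp_const\<close>^2 Gamma(1/3)^3, with \<open>hyp_const\<close>^2 = 3 / (4 pi^2).\<close>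

lemma Beta_third: "hyp_const * Beta (1 / 3) (1 / 3) = 3 / (4 * pi ^ 2 / Gamma (1 / 3) ^ 3)"
proof -
  have g: "Gamma (1 / 3 :: real) > 0" "Gamma (2 / 3 :: real) > 0" by (simp_all add: Gamma_real_pos)
  have "inverse (Gamma (1 / 3)) * inverse (Gamma (2 / 3)) = hyp_const"
    using rGamma_thirds by (simp only: rGamma_inverse_Gamma)
  moreover have "b = 1 / (h * a)" if "inverse a * inverse b = h" "a > 0" "b > 0" for a b h :: real
    using that by (auto simp: divide_simps mult_ac)
  ultimately have "Gamma (2 / 3) = 1 / (hyp_const * Gamma (1 / 3 :: real))" using g by blast
  hence "hyp_const * Beta (1 / 3) (1 / 3) = hyp_const\<^sup>2 * Gamma (1 / 3) ^ 3"
    using g hyp_const_pos by (simp add: Beta_def power2_eq_square power3_eq_cube)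
  also have "hyp_const\<^sup>2 = 3 / (4 * pi\<^sup>2)" by (simp add: hyp_const_def power_divide power_mult_distrib)
  finally show ?thesis by simp
qed

text \<open>With x = (c/a)^3, 1 - x = (b/a)^3 and F(x) = a, each cube y^3 contributes (y^3)^(-2/3)
  y^3 = y. What remains is (b/a)(c/a) a^2 = b c.\<close>

lemma tri_density_modulus:
  assumes t: "t > 0"
  defines "x \<equiv> modulus t"
  shows "tri_density (1 - x) * (x * (1 - x) * (hyp x)\<^sup>2) = 3 * eta_product t"
proof -
  define q where "q = nome t"
  have q: "0 < q" "q < 1" using nome_range[OF t] by (auto simp: q_def)
  define a b c where "a = cubic_a q" and "b = cubic_b q" and "c = cubic_c q"
  have pos: "a > 0" "b > 0" "c > 0" using cubic_pos[OF q] by (simp_all add: a_def b_def c_def)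
  have xq: "x = cubic_x q" by (simp add: x_def modulus_def q_def)
  have x: "x = (c / a) ^ 3" "1 - x = (b / a) ^ 3" "hyp x = a"
    unfolding xq a_def b_def c_def
    by (rule cubic_x_def, rule one_minus_cubic_x[OF q], rule cubic_a_eq_hyp[OF q, symmetric])
  have p: "(y ^ 3) powr (- 2 / 3) * y ^ 3 = y" if "y > 0" for y :: real
  proof -
    have "(y ^ 3) powr (- 2 / 3) * y ^ 3 = (y ^ 3) powr (- 2 / 3) * (y ^ 3) powr 1" using that by simp
    also have "\<dots> = (y ^ 3) powr (1 / 3)" by (simp only: powr_add[symmetric]) simp
    also have "\<dots> = y"
    proof -
      have e: "y ^ 3 = y powr 3" using that by simp
      show ?thesis unfolding e powr_powr using that by simp
    qed
    finally show ?thesis .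
  qed
  have "tri_density (1 - x) * (x * (1 - x) * (hyp x)\<^sup>2) =
      ((1 - x) powr (- 2 / 3) * (1 - x)) * (x powr (- 2 / 3) * x) * (hyp x)\<^sup>2"
    by (simp add: tri_density_def mult_ac)
  also have "\<dots> = (b / a) * (c / a) * a\<^sup>2"
    unfolding x(2,3) unfolding x(1) using p[of "b / a"] p[of "c / a"] pos by simp
  also have "\<dots> = b * c" using pos by (simp add: power2_eq_square)
  also have "\<dots> = 3 * eta_product t"
    using cubic_b_times_c[OF q] by (simp add: b_def c_def eta_product_def q_def)
  finally show ?thesis .
qed

lemma root_nome_tendsto: "filterlim nome (at_right 0) at_top"
proof -
  have "filterlim (\<lambda>t::real. - (2 * pi / sqrt 3) * t) at_bot at_top"
    by (rule filterlim_tendsto_neg_mult_at_bot[OF tendsto_const _ filterlim_ident]) simp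
  hence "(nome \<longlongrightarrow> 0) at_top"
    unfolding nome_def by (rule filterlim_compose[OF exp_at_bot])
  thus ?thesis unfolding filterlim_at by (simp add: nome_def)
qed

text \<open>The integrand is nonnegative, so the fundamental theorem on a half-line gives the
  Lebesgue integral together with integrability. Measurability comes from writing the infinite
  products as limits of finite ones.\<close>

lemma nn_integral_eta_product:
  assumes r: "r > 0" and F: "\<And>t. t \<ge> r \<Longrightarrow> (F has_field_derivative eta_product t) (at t)"
    and lim: "(F \<longlongrightarrow> T) at_top"
  shows "has_bochner_integral lborel (\<lambda>t. indicator {r..} t * eta_product t) (T - F r)"
proof -
  define g where "g = (\<lambda>t. if t \<ge> r then eta_product t else 0)"
  have meas: "g \<in> borel_measurable borel"
  proof (rule borel_measurable_LIMSEQ_real)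
    fix t :: real
    show "(\<lambda>n. if t \<ge> r then root 3 (nome t) * (qpoch n (nome t))\<^sup>2 * (qpoch n (nome t ^ 3))\<^sup>2 else 0) \<longlonglongrightarrow> g t"
    proof (cases "t \<ge> r")
      case True
      have q: "0 < nome t" "nome t < 1" using nome_range[of t] True r by auto
      have "(\<lambda>n. qpoch n x) \<longlonglongrightarrow> euler_real x" if "0 < x" "x < 1" for x
      proof -
        have "convergent_prod (\<lambda>n. 1 - x ^ Suc n)" using that by (intro convergent_prod_euler) auto
        thus ?thesis unfolding qpoch_def euler_real_def
          using convergent_prod_LIMSEQ LIMSEQ_lessThan_iff_atMost by blast
      qed
      thus ?thesis using True q power3_less_1[OF q] unfolding g_def eta_product_def
        by (auto intro!: tendsto_intros)
    qed (simp add: g_def)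
  next
    fix n
    have "continuous_on UNIV nome" unfolding nome_def by (intro continuous_intros)
    hence [measurable]: "nome \<in> borel_measurable borel" by (rule borel_measurable_continuous_onI)
    have [measurable]: "root 3 \<in> borel_measurable borel"
      by (intro borel_measurable_continuous_onI continuous_intros)
    show "(\<lambda>t. if t \<ge> r then root 3 (nome t) * (qpoch n (nome t))\<^sup>2 * (qpoch n (nome t ^ 3))\<^sup>2 else 0) \<in> borel_measurable borel"
      unfolding qpoch_def by measurable
  qed
  have nonneg: "0 \<le> g t" for t using eta_product_nonneg[of t] r by (auto simp: g_def)
  have mono: "F x \<le> F y" if "r \<le> x" "x \<le> y" for x y
  proof (rule DERIV_nonneg_imp_nondecreasing[OF that(2)])
    fix z assume "x \<le> z" "z \<le> y"
    thus "\<exists>d. (F has_field_derivative d) (at z) \<and> d \<ge> 0" using F[of z] eta_product_nonneg[of z] that r by auto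
  qed
  have "F r \<le> T"
    by (rule tendsto_lowerbound[OF lim]) (use mono in \<open>auto intro: eventually_mono[OF eventually_ge_at_top[of r]]\<close>)
  have "(\<integral>\<^sup>+ t. ennreal (g t) * indicator {r..} t \<partial>lborel) = ennreal (T - F r)"
    using F lim eta_product_nonneg r by (intro nn_integral_FTC_atLeast meas) (auto simp: g_def)
  also have "(\<lambda>t. ennreal (g t) * indicator {r..} t) = (\<lambda>t. ennreal (indicator {r..} t * eta_product t))"
    by (auto simp: g_def indicator_def)
  finally have "(\<integral>\<^sup>+ t. ennreal (indicator {r..} t * eta_product t) \<partial>lborel) = ennreal (T - F r)" .
  moreover have eq: "indicator {r..} t * eta_product t = g t" for t by (auto simp: g_def indicator_def)
  ultimately show ?thesis
    using meas nonneg \<open>F r \<le> T\<close> unfolding eq by (intro has_bochner_integral_nn_integral) auto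
qed

theorem theorem1p3:
  fixes r :: real
  assumes "r > 0"
  shows "Pi_h_par r =
    complex_of_real (4 * pi ^ 2 / Gamma (1 / 3) ^ 3) *
    (LINT t:{r..}|lborel.
       dedekind_eta (\<i> / of_real (sqrt 3) * of_real t) ^ 2 *
       dedekind_eta (\<i> * of_real (sqrt 3) * of_real t) ^ 2)"
proof -
  obtain V k where V: "continuous_on (cball 0 1) V" "V holomorphic_on ball 0 1" "inj_on V (cball 0 1)"
      "V ` ball 0 1 = interior equilateral_triangle" "V ` cball 0 1 = equilateral_triangle"
      "V (cis (2 * pi / 3)) = 0" "V (cis (4 * pi / 3)) = 1" "V 1 = \<omega>"
    and Vk: "\<And>w. 0 \<le> w \<Longrightarrow> w \<le> 1 \<Longrightarrow> V (cis (circle_angle w)) = of_real (k w)"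
    and k: "continuous_on {0..1} k" "k 0 = 0" "k 1 = 1"
      "\<And>w. 0 < w \<Longrightarrow> w < 1 \<Longrightarrow> (k has_field_derivative tri_density w / Beta (1 / 3) (1 / 3)) (at w)"
  proof (rule triangle_disc_map)
    fix V k assume "continuous_on (cball 0 1) V" "V holomorphic_on ball 0 1" "inj_on V (cball 0 1)"
      "V ` ball 0 1 = interior equilateral_triangle" "V ` cball 0 1 = equilateral_triangle"
      "V (cis (2 * pi / 3)) = 0" "V (cis (4 * pi / 3)) = 1" "V 1 = \<omega>"
      "\<And>w. 0 \<le> w \<Longrightarrow> w \<le> 1 \<Longrightarrow> V (cis (circle_angle w)) = of_real (k w)"
      "continuous_on {0..1} k" "k 0 = 0" "k 1 = 1"
      "\<And>w. 0 < w \<Longrightarrow> w < 1 \<Longrightarrow> (k has_field_derivative tri_density w / Beta (1 / 3) (1 / 3)) (at w)"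
    thus thesis by (rule that)
  qed
  define c where "c = 4 * pi ^ 2 / Gamma (1 / 3 :: real) ^ 3"
  have "Gamma (1 / 3 :: real) > 0" by (simp add: Gamma_real_pos)
  hence c: "c > 0" by (simp add: c_def)
  \<comment> \<open>The prevertex is chosen as l = 1 - x with x the modulus of r; the side ratio
    \<open>s\<close> of the resulting parallelogram is computed afterwards and turns out to be
    r.\<close>
  have val: "Pi_h_par r = of_real (1 - k (1 - modulus r))"
  proof -
    define l where "l = 1 - modulus r"
    have l: "0 < l" "l < 1" using modulus_range assms by (auto simp: l_def)
    obtain S s J1 J2 where S: "s > 0" "continuous_on (cball 0 1) S" "S holomorphic_on ball 0 1" "inj_on S (cball 0 1)"
        "S ` ball 0 1 = interior (parallelogram s)" "S ` cball 0 1 = parallelogram s"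
        "S (cis (2 * pi / 3)) = 0" "S (cis (circle_angle l)) = of_real s"
        "S (cis (4 * pi / 3)) = of_real s + \<omega>" "S 1 = \<omega>"
      and J: "(par_density l has_integral J1) {0..l}" "(par_density l has_integral J2) {l..1}" "s = J1 / J2"
      by (rule parallelogram_disc_map[OF l])
    have "J1 = Gamma (1 / 3) * Gamma (2 / 3) * hyp l" "J2 = Gamma (1 / 3) * Gamma (2 / 3) * hyp (1 - l)"
      using J(1,2) par_density_integral_left[OF l] par_density_integral_right[OF l] has_integral_unique by blast+
    moreover have "Gamma (1 / 3 :: real) \<noteq> 0" "Gamma (2 / 3 :: real) \<noteq> 0"
      by (rule less_imp_neq[symmetric], rule Gamma_real_pos, simp)+
    ultimately have "s = hyp_ratio (modulus r)" using J(3) by (simp add: hyp_ratio_def l_def)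
    hence "s = r" using hyp_ratio_modulus[OF assms] by simp
    hence "cardy_smirnov_map r (of_real r) = V (cis (circle_angle l))"
      using cardy_smirnov_map_value[OF S(2-10) _ V] by simp
    thus ?thesis using Vk[of l] l by (simp add: Pi_h_par_def l_def)
  qed
  \<comment> \<open>Minus the Carleson length over the prefactor: a primitive of the eta product
    that vanishes at infinity, where the modulus tends to 0 and the image point tends to 1.\<close>
  define F where "F = (\<lambda>t. - (1 - k (1 - modulus t)) / c)"
  have F: "(F has_field_derivative eta_product t) (at t)" if t: "t > 0" for t
  proof -
    define x where "x = modulus t"
    have x: "0 < 1 - x" "1 - x < 1" using modulus_range[OF t] by (simp_all add: x_def)
    define X' where "X' = - (x * (1 - x) * (hyp x)\<^sup>2 / hyp_const)"
    have "((\<lambda>t. 1 - modulus t) has_field_derivative 0 - X') (at t)"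
      unfolding X'_def x_def by (intro DERIV_diff DERIV_const modulus_has_derivative t)
    from DERIV_chain2[OF k(4)[OF x, unfolded x_def] this[unfolded x_def]]
    have "((\<lambda>t. k (1 - modulus t)) has_field_derivative tri_density (1 - x) / Beta (1 / 3) (1 / 3) * (0 - X')) (at t)"
      by (simp add: x_def)
    hence "(F has_field_derivative (- (0 - tri_density (1 - x) / Beta (1 / 3) (1 / 3) * (0 - X')) / c)) (at t)"
      unfolding F_def by (intro DERIV_cdivide DERIV_minus DERIV_diff DERIV_const)
    also have "- (0 - tri_density (1 - x) / Beta (1 / 3) (1 / 3) * (0 - X')) / c =
        tri_density (1 - x) * (x * (1 - x) * (hyp x)\<^sup>2) / (hyp_const * Beta (1 / 3) (1 / 3) * c)"
      by (simp add: X'_def)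
    \<comment> \<open>This 3 cancels the 3 in b c = 3 times the eta product, leaving the integrand
      with coefficient 1.\<close>
    also have "hyp_const * Beta (1 / 3) (1 / 3) * c = 3" using c by (simp only: Beta_third c_def[symmetric]) simp
    also have "tri_density (1 - x) * (x * (1 - x) * (hyp x)\<^sup>2) / 3 = eta_product t"
      unfolding x_def tri_density_modulus[OF t] by simp
    finally show ?thesis .
  qed
  have lim: "(F \<longlongrightarrow> 0) at_top"
  proof -
    have "(modulus \<longlongrightarrow> 0) at_top"
      unfolding modulus_def using filterlim_compose[OF cubic_x_tendsto root_nome_tendsto] by simp
    hence "((\<lambda>t. 1 - modulus t) \<longlongrightarrow> 1 - 0) at_top" by (intro tendsto_intros)
    moreover have "\<forall>\<^sub>F t in at_top. 1 - modulus t \<in> {0..1}"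
      using eventually_gt_at_top[of 0] by eventually_elim (use modulus_range in \<open>auto intro: less_imp_le\<close>)
    ultimately have "((\<lambda>t. k (1 - modulus t)) \<longlongrightarrow> k 1) at_top"
      by (intro continuous_on_tendsto_compose[OF k(1)]) auto
    hence "(F \<longlongrightarrow> - (1 - k 1) / c) at_top" unfolding F_def using c by (intro tendsto_intros) auto
    thus ?thesis by (simp add: k(3))
  qed
  have "has_bochner_integral lborel (\<lambda>t. indicator {r..} t * eta_product t) (0 - F r)"
    using F assms lim by (intro nn_integral_eta_product) auto
  hence int: "has_bochner_integral lborel (\<lambda>t. complex_of_real (indicator {r..} t * eta_product t)) (of_real (0 - F r))"
    by (rule has_bochner_integral_of_real)
  have "(LINT t:{r..}|lborel. dedekind_eta (\<i> / of_real (sqrt 3) * of_real t) ^ 2 *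
       dedekind_eta (\<i> * of_real (sqrt 3) * of_real t) ^ 2) =
      (LINT t|lborel. complex_of_real (indicator {r..} t * eta_product t))"
    unfolding set_lebesgue_integral_def
    using eta_product_eq assms by (intro Bochner_Integration.integral_cong refl) (auto simp: indicator_def)
  also have "\<dots> = of_real (0 - F r)" using int by (rule has_bochner_integral_integral_eq)
  finally show ?thesis unfolding val c_def[symmetric] using c by (simp add: F_def)
qed

end
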